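(* Let $f$ be a dominant algebraically stable rational self-map of the complex projective plane $\mathbb{P}^2$ of degree at least $2$. Let $\mathcal{F}$, $\mathcal{F}_s$ and $\mathcal{F}_w$ denote the Fatou set, the strong Fatou set and the weak Fatou set of $f$, respectively. Then $$\mathcal{F}=\mathcal{F}_s=\mathcal{F}_w.$$
   Context: $\mathbb{P}^2$ is equipped with the Fubini-Study distance. A rational self-map $f$ of $\mathbb{P}^2$ lifts to a polynomial self-map $F=(P_0,P_1,P_2)$ of $\mathbb{C}^3$, where the $P_i$ are homogeneous polynomials of the same degree without common factor; this degree is $\deg(f)$. The indeterminacy set $I(f)$ is the set of points $p\in\mathbb{P}^2$ such that $F$ vanishes on the complex line corresponding to $p$. The $n$-th iterate $f^n$ is the rational map whose lift is obtained from $F^n$ by cancelling common factors of the components. The map $f$ is dominant if $f(\mathbb{P}^2)=\mathbb{P}^2$ (for rational maps: the image of $\mathbb{P}^2\setminus I(f)$ is Zariski dense). $f$ is algebraically stable (AS) if for every $n\ge 1$, $f^n$ maps no complex hypersurface of $\mathbb{P}^2$ into $I(f)$; equivalently, $\deg(f^n)=(\deg f)^n$ for all $n\ge 1$. The Fatou set $\mathcal{F}$ of $f$ is the maximal open subset of $\mathbb{P}^2\setminus\overline{\bigcup_{n\ge 1}I(f^n)}$ in which the sequence of iterates $\{f^n\}_{n\ge1}$ (all holomorphic there) is locally equicontinuous. Let $X,Y$ be complex manifolds, let $g_n:X\to Y$ ($n\ge1$) and $g:X\to Y$ be meromorphic maps, and let $\Gamma_n,\Gamma\subset X\times Y$ be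 the graphs of $g_n$ and $g$ (the graph of a meromorphic map being the closed analytic subset of $X\times Y$ that is the closure of the graph of the map over the complement of its indeterminacy set). - $\{g_n\}$ strongly converges to $g$ in $X$ if for every compact set $K\subset X$, $\lim_{n\to\infty}\Gamma_n\cap(K\times Y)=\Gamma\cap(K\times Y)$ with respect to the Hausdorff metric. - $\{g_n\}$ weakly converges to $g$ in $X$ if there is an analytic subset $A\subset X$ with $\operatorname{codim}_{\mathbb{C}}A\ge 2$ such that $\{g_n\}$ strongly converges to $g$ in $X\setminus A$. - A sequence $\{g_n\}$ of meromorphic maps from $X$ to $Y$ is strongly (resp. weakly) normal in $X$ if every subsequence of $\{g_n\}$ has a further subsequence which converges in $X$ in the strong (resp. weak) sense to some meromorphic map $X\to Y$. The strong Fatou set $\mathcal{F}_s$ (resp. weak Fatou set $\mathcal{F}_w$) of $f$ is the maximal open subset of $\mathbb{P}^2$ in which the sequence of iterates $\{f^n\}_{n\ge1}$, viewed as meromorphic maps to $\mathbb{P}^2$, is strongly (resp. weakly) normal. *)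

theory Defs
  imports "HOL-Analysis.Analysis" "HOL-Library.Poly_Mapping"
begin

definition herm :: "complex^3 \<Rightarrow> complex^3 \<Rightarrow> complex" where
  "herm z w = (\<Sum>i\<in>UNIV. z $ i * cnj (w $ i))"

lemma herm_add_left: "herm (x + y) w = herm x w + herm y w"
  by (simp add: herm_def algebra_simps sum.distrib)

lemma herm_diff_left: "herm (x - y) w = herm x w - herm y w"
  by (simp add: herm_def algebra_simps sum_subtractf)

lemma herm_smult_left: "herm (c *s x) w = c * herm x w"
  by (simp add: herm_def sum_distrib_left mult.assoc)

lemma herm_commute: "herm w x = cnj (herm x w)"
  by (simp add: herm_def mult.commute)

lemma herm_diff_right: "herm w (x - y) = herm w x - herm w y"
  by (simp add: herm_def algebra_simps sum_subtractf)

lemma herm_smult_right: "herm w (c *s x) = cnj c * herm w x"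
  by (simp add: herm_def sum_distrib_left mult_ac)

lemma norm_vec_power2: "(norm (x :: complex^3))\<^sup>2 = (\<Sum>i\<in>UNIV. (cmod (x $ i))\<^sup>2)"
  by (simp add: norm_vec_def L2_set_def sum_nonneg)

lemma herm_self: "herm x x = of_real ((norm x)\<^sup>2)"
  by (simp only: herm_def norm_vec_power2 of_real_sum complex_norm_square)

lemma norm_smult: "norm (c *s (x :: complex^3)) = cmod c * norm x"
proof -
  have "(norm (c *s x))\<^sup>2 = (cmod c * norm x)\<^sup>2"
    by (simp add: norm_vec_power2 norm_mult power_mult_distrib sum_distrib_left)
  thus ?thesis
    by (simp add: power2_eq_iff_nonneg)
qed

lemma herm_cauchy_schwarz: "cmod (herm x y) \<le> norm x * norm y"
proof -
  have "cmod (herm x y) \<le> (\<Sum>i\<in>UNIV. \<bar>cmod (x $ i)\<bar> * \<bar>cmod (y $ i)\<bar>)"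
    unfolding herm_def by (rule order_trans[OF norm_sum]) (simp add: norm_mult)
  also have "\<dots> \<le> L2_set (\<lambda>i. cmod (x $ i)) UNIV * L2_set (\<lambda>i. cmod (y $ i)) UNIV"
    by (rule L2_set_mult_ineq)
  finally show ?thesis by (simp add: norm_vec_def)
qed

lemma norm_orth_part:
  assumes "norm x = 1" "norm y = 1"
  shows "(norm (x - herm x y *s y))\<^sup>2 = 1 - (cmod (herm x y))\<^sup>2"
proof -
  let ?u = "x - herm x y *s y"
  have yy: "herm y y = 1" and xx: "herm x x = 1" using assms by (simp_all add: herm_self)
  have "complex_of_real ((norm ?u)\<^sup>2) = herm ?u ?u" by (rule herm_self[symmetric])
  also have "\<dots> = 1 - herm x y * cnj (herm x y)"
    using herm_commute[of y x] yy xx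
    by (simp add: herm_diff_left herm_diff_right herm_smult_left herm_smult_right algebra_simps)
  also have "\<dots> = of_real (1 - (cmod (herm x y))\<^sup>2)"
    by (simp add: complex_norm_square[symmetric])
  finally show ?thesis using of_real_eq_iff by blast
qed

lemma herm_eq_unit_imp:
  assumes "norm x = 1" "norm y = 1" "cmod (herm x y) = 1"
  shows "x = herm x y *s y"
  using norm_orth_part[OF assms(1,2)] assms(3) by simp

lemma arccos_herm_triangle:
  assumes "norm x = 1" "norm y = 1" "norm z = 1"
  shows "arccos (cmod (herm x z)) \<le> arccos (cmod (herm x y)) + arccos (cmod (herm y z))"
proof -
  define a b where "a = cmod (herm x y)" and "b = cmod (herm y z)"
  define u v where "u = x - herm x y *s y" and "v = z - herm z y *s y"
  have rng: "0 \<le> a" "a \<le> 1" "0 \<le> b" "b \<le> 1" "cmod (herm x z) \<le> 1"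
    using herm_cauchy_schwarz[of x y] herm_cauchy_schwarz[of y z] herm_cauchy_schwarz[of x z] assms
    by (simp_all add: a_def b_def)
  have b': "cmod (herm z y) = b"
    unfolding b_def by (subst herm_commute) simp
  have "norm u = sqrt (1 - a\<^sup>2)" "norm v = sqrt (1 - b\<^sup>2)"
    using norm_orth_part[OF assms(1,2)] norm_orth_part[OF assms(3,2)] b'
    by (simp_all add: u_def v_def a_def real_sqrt_unique[symmetric])
  moreover have yy: "herm y y = 1" using assms by (simp add: herm_self)
  have "herm x z = herm x y * herm y z + herm u v"
    using herm_commute[of y z] yy
    by (simp add: u_def v_def herm_diff_left herm_diff_right herm_smult_left herm_smult_right
        algebra_simps)
  hence "cmod (herm x y * herm y z) \<le> cmod (herm x z) + cmod (herm u v)"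
    using norm_triangle_ineq4[of "herm x z" "herm u v"] by simp
  ultimately have "a * b - sqrt (1 - a\<^sup>2) * sqrt (1 - b\<^sup>2) \<le> cmod (herm x z)"
    using herm_cauchy_schwarz[of u v] by (simp add: norm_mult a_def b_def)
  moreover have "cos (arccos a + arccos b) = a * b - sqrt (1 - a\<^sup>2) * sqrt (1 - b\<^sup>2)"
    using rng by (simp add: cos_add sin_arccos)
  ultimately have le: "cos (arccos a + arccos b) \<le> cmod (herm x z)" by simp
  have "arccos a \<le> pi / 2" "arccos b \<le> pi / 2" "0 \<le> arccos a" "0 \<le> arccos b"
    using rng arccos_le_pi2 arccos_lbound by auto
  hence "arccos (cos (arccos a + arccos b)) = arccos a + arccos b"
    by (intro arccos_cos) auto
  thus ?thesis
    using arccos_le_arccos[of "cos (arccos a + arccos b)" "cmod (herm x z)"] le rng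
    unfolding a_def[symmetric] b_def[symmetric] by simp
qed

definition proj_rel :: "complex^3 \<Rightarrow> complex^3 \<Rightarrow> bool" where
  "proj_rel z w \<longleftrightarrow> z \<noteq> 0 \<and> w \<noteq> 0 \<and> (\<exists>c. z = c *s w)"

lemma part_equivp_proj_rel: "part_equivp proj_rel"
proof (rule part_equivpI)
  show "\<exists>z. proj_rel z z"
    unfolding proj_rel_def
    by (rule exI[of _ "axis 1 1"]) (simp add: axis_eq_0_iff, rule exI[of _ 1], simp)
  show "symp proj_rel"
  proof (rule sympI)
    fix z w assume "proj_rel z w"
    then obtain c where c: "z \<noteq> 0" "w \<noteq> 0" "z = c *s w" unfolding proj_rel_def by blast
    hence "c \<noteq> 0" by auto
    hence "inverse c *s z = w" by (simp only: c(3) vector_smult_assoc) simp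
    thus "proj_rel w z" unfolding proj_rel_def using c(1,2) by metis
  qed
  show "transp proj_rel"
  proof (rule transpI)
    fix x y z assume "proj_rel x y" "proj_rel y z"
    then obtain c d where "x \<noteq> 0" "z \<noteq> 0" "x = c *s y" "y = d *s z"
      unfolding proj_rel_def by blast
    moreover from this have "x = (c * d) *s z" by (simp only: vector_smult_assoc)
    ultimately show "proj_rel x z" unfolding proj_rel_def by blast
  qed
qed

quotient_type cp2 = "complex^3" / partial: proj_rel
  morphisms rep_cp2 proj
  by (rule part_equivp_proj_rel)

lemma rep_cp2_nonzero: "rep_cp2 p \<noteq> 0"
  using Quotient3_rep_reflp[OF Quotient3_cp2, of p] unfolding proj_rel_def by blast

lemma proj_rep_cp2: "proj (rep_cp2 p) = p"
  by (rule Quotient3_abs_rep[OF Quotient3_cp2])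

lemma proj_eq_iff:
  assumes "z \<noteq> 0" "w \<noteq> 0"
  shows "proj z = proj w \<longleftrightarrow> (\<exists>c. z = c *s w)"
proof -
  have "proj_rel x x" if "x \<noteq> 0" for x :: "complex^3"
    using that unfolding proj_rel_def by (intro conjI exI[of _ 1]) simp_all
  thus ?thesis
    using Quotient3_rel[OF Quotient3_cp2, of z w] assms unfolding proj_rel_def
    by (metis (no_types, lifting) vector_smult_lid)
qed

definition fubini_study :: "complex^3 \<Rightarrow> complex^3 \<Rightarrow> real" where
  "fubini_study z w = arccos (cmod (herm z w) / (norm z * norm w))"

lemma fubini_study_unit:
  assumes "z \<noteq> 0" "w \<noteq> 0"
  obtains x y :: "complex^3" where
    "norm x = 1" "norm y = 1" "x = of_real (inverse (norm z)) *s z"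
    "y = of_real (inverse (norm w)) *s w"
proof (rule that[OF _ _ refl refl])
  show "norm (complex_of_real (inverse (norm z)) *s z) = 1"
    "norm (complex_of_real (inverse (norm w)) *s w) = 1"
    using assms by (simp_all add: norm_smult norm_inverse)
qed

lemma fubini_study_normalize:
  "fubini_study z w =
    arccos (cmod (herm (of_real (inverse (norm z)) *s z) (of_real (inverse (norm w)) *s w)))"
  by (simp add: fubini_study_def herm_smult_left herm_smult_right norm_mult norm_inverse norm_divide
      field_simps)

lemma fubini_study_cong:
  assumes "proj_rel z z'" "proj_rel w w'"
  shows "fubini_study z w = fubini_study z' w'"
proof -
  from assms obtain c d where "z = c *s z'" "w = d *s w'" "z \<noteq> 0" "w \<noteq> 0"
    unfolding proj_rel_def by blast
  moreover from this have "c \<noteq> 0" "d \<noteq> 0" by auto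
  ultimately show ?thesis
    by (simp add: fubini_study_def herm_smult_left herm_smult_right norm_mult norm_smult)
qed

instantiation cp2 :: metric_space
begin

lift_definition dist_cp2 :: "cp2 \<Rightarrow> cp2 \<Rightarrow> real" is fubini_study
  by (rule fubini_study_cong)

definition uniformity_cp2 :: "(cp2 \<times> cp2) filter" where
  "uniformity_cp2 = (INF e\<in>{0<..}. principal {(x, y). dist x y < e})"

definition open_cp2 :: "cp2 set \<Rightarrow> bool" where
  "open_cp2 U \<longleftrightarrow> (\<forall>x\<in>U. eventually (\<lambda>(x', y). x' = x \<longrightarrow> y \<in> U) uniformity)"

instance
proof
  fix p q r :: cp2
  have d: "dist p q = fubini_study (rep_cp2 p) (rep_cp2 q)" for p q :: cp2
    by (simp add: dist_cp2_def)
  show "dist p q \<le> dist p r + dist q r"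
  proof -
    let ?n = "\<lambda>p. complex_of_real (inverse (norm (rep_cp2 p))) *s rep_cp2 p"
    have n: "norm (?n x) = 1" for x
      using rep_cp2_nonzero[of x] by (simp add: norm_smult norm_inverse)
    have "cmod (herm (?n q) (?n r)) = cmod (herm (?n r) (?n q))"
      by (subst herm_commute) (rule complex_mod_cnj)
    thus ?thesis
      unfolding d fubini_study_normalize
      using arccos_herm_triangle[OF n[of p] n[of r] n[of q]] by (simp only:)
  qed
  show "(dist p q = 0) = (p = q)"
  proof
    assume "p = q"
    thus "dist p q = 0"
      using rep_cp2_nonzero[of q]
      by (simp add: d fubini_study_def herm_self norm_mult power2_eq_square)
  next
    assume "dist p q = 0"
    obtain x y where xy: "norm x = 1" "norm y = 1"
      "x = of_real (inverse (norm (rep_cp2 p))) *s rep_cp2 p"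
      "y = of_real (inverse (norm (rep_cp2 q))) *s rep_cp2 q"
      by (rule fubini_study_unit[OF rep_cp2_nonzero rep_cp2_nonzero])
    have le: "cmod (herm x y) \<le> 1" using herm_cauchy_schwarz[of x y] xy(1,2) by simp
    have "arccos (cmod (herm x y)) = 0"
      using \<open>dist p q = 0\<close> unfolding d fubini_study_normalize xy(3,4) .
    hence "cmod (herm x y) = 1"
      using cos_arccos[of "cmod (herm x y)"] le norm_ge_zero[of "herm x y"] by simp
    hence "x = herm x y *s y" using herm_eq_unit_imp xy by blast
    hence "of_real (norm (rep_cp2 p)) *s x =
        of_real (norm (rep_cp2 p)) *s (herm x y *s y)" by (rule arg_cong)
    also have "\<dots> = (of_real (norm (rep_cp2 p)) * herm x y *
        of_real (inverse (norm (rep_cp2 q)))) *s rep_cp2 q"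
      by (subst xy(4)) (simp only: vector_smult_assoc mult.assoc)
    finally have "of_real (norm (rep_cp2 p)) *s x = (of_real (norm (rep_cp2 p)) * herm x y *
        of_real (inverse (norm (rep_cp2 q)))) *s rep_cp2 q" .
    moreover have "of_real (norm (rep_cp2 p)) *s x = rep_cp2 p"
      using rep_cp2_nonzero[of p]
      by (simp only: xy(3) vector_smult_assoc) (simp flip: of_real_mult)
    ultimately have "\<exists>c. rep_cp2 p = c *s rep_cp2 q" by auto
    hence "proj (rep_cp2 p) = proj (rep_cp2 q)"
      using proj_eq_iff rep_cp2_nonzero by blast
    thus "p = q" by (simp add: proj_rep_cp2)
  qed
qed (simp_all add: uniformity_cp2_def open_cp2_def)

end

text \<open>
  Polynomials in three variables over \<open>\<complex>\<close>: the exponents of a monomial form a finitely supported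
  map on the index type \<^typ>\<open>3\<close>, which is also the index type of \<^typ>\<open>complex^3\<close>.
\<close>

type_synonym poly3 = "(3 \<Rightarrow>\<^sub>0 nat) \<Rightarrow>\<^sub>0 complex"

definition poly3_eval :: "poly3 \<Rightarrow> complex^3 \<Rightarrow> complex" where
  "poly3_eval P z =
    (\<Sum>m\<in>Poly_Mapping.keys P. Poly_Mapping.lookup P m * (\<Prod>i\<in>UNIV. z $ i ^ Poly_Mapping.lookup m i))"

definition homogeneous :: "nat \<Rightarrow> poly3 \<Rightarrow> bool" where
  "homogeneous d P \<longleftrightarrow> (\<forall>m\<in>Poly_Mapping.keys P. (\<Sum>i\<in>UNIV. Poly_Mapping.lookup m i) = d)"

definition self_map :: "poly3^3 \<Rightarrow> complex^3 \<Rightarrow> complex^3" where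
  "self_map F z = (\<chi> i. poly3_eval (F $ i) z)"

text \<open>
  The condition on common divisors also excludes \<open>F = 0\<close>, since \<open>0\<close> divides \<open>0\<close> and is not a unit.
\<close>

definition reduced :: "poly3^3 \<Rightarrow> bool" where
  "reduced F \<longleftrightarrow> (\<exists>d. \<forall>i. homogeneous d (F $ i)) \<and> (\<forall>G. (\<forall>i. G dvd F $ i) \<longrightarrow> G dvd 1)"

text \<open>
  A rational self-map is a partial map, undefined exactly on its indeterminacy set. For homogeneous
  \<open>F\<close> the result does not depend on the representative of \<open>p\<close>, and \<open>self_map F (rep_cp2 p) = 0\<close> means
  that \<open>F\<close> vanishes on the whole complex line \<open>p\<close>.
\<close>

definition rational_map_of :: "poly3^3 \<Rightarrow> (cp2 \<rightharpoonup> cp2)" where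
  "rational_map_of F p =
    (if self_map F (rep_cp2 p) = 0 then None else Some (proj (self_map F (rep_cp2 p))))"

definition rational_map :: "(cp2 \<rightharpoonup> cp2) \<Rightarrow> bool" where
  "rational_map f \<longleftrightarrow> (\<exists>F. reduced F \<and> f = rational_map_of F)"

definition indet :: "(cp2 \<rightharpoonup> cp2) \<Rightarrow> cp2 set" where
  "indet f = - dom f"

text \<open>
  The reduced lift of a rational map is unique up to a nonzero constant, so the choice of a lift
  affects neither the degree nor the iterates.
\<close>

definition lift_of :: "(cp2 \<rightharpoonup> cp2) \<Rightarrow> poly3^3" where
  "lift_of f = (SOME F. reduced F \<and> f = rational_map_of F)"

definition rat_degree :: "(cp2 \<rightharpoonup> cp2) \<Rightarrow> nat" where
  "rat_degree f = (THE d. \<forall>i. homogeneous d (lift_of f $ i))"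

text \<open>
  \<open>h\<close> is the common factor cancelled from the components of the \<open>n\<close>-fold composition of \<open>F\<close>. Over
  \<open>\<complex>\<close> polynomials and polynomial functions agree, so the factorization is expressed pointwise.
\<close>

definition iterate_lift :: "poly3^3 \<Rightarrow> nat \<Rightarrow> poly3^3" where
  "iterate_lift F n =
    (SOME H. reduced H \<and> (\<exists>h. h \<noteq> 0 \<and> (\<forall>z. (self_map F ^^ n) z = poly3_eval h z *s self_map H z)))"

definition iterate :: "(cp2 \<rightharpoonup> cp2) \<Rightarrow> nat \<Rightarrow> (cp2 \<rightharpoonup> cp2)" where
  "iterate f n = rational_map_of (iterate_lift (lift_of f) n)"

definition zero_locus :: "poly3 set \<Rightarrow> cp2 set" where
  "zero_locus Ps = {p. \<forall>P\<in>Ps. poly3_eval P (rep_cp2 p) = 0}"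

definition zariski_closed :: "cp2 set \<Rightarrow> bool" where
  "zariski_closed S \<longleftrightarrow> (\<exists>Ps. (\<forall>P\<in>Ps. \<exists>d. homogeneous d P) \<and> S = zero_locus Ps)"

definition zariski_dense :: "cp2 set \<Rightarrow> bool" where
  "zariski_dense S \<longleftrightarrow> (\<forall>C. zariski_closed C \<and> S \<subseteq> C \<longrightarrow> C = UNIV)"

definition dominant :: "(cp2 \<rightharpoonup> cp2) \<Rightarrow> bool" where
  "dominant f \<longleftrightarrow> zariski_dense (ran f)"

text \<open>By Chow's theorem every closed complex hypersurface of the projective plane is of this form.\<close>

definition hypersurface :: "cp2 set \<Rightarrow> bool" where
  "hypersurface S \<longleftrightarrow> (\<exists>P d. homogeneous d P \<and> P \<noteq> 0 \<and> 1 \<le> d \<and> S = zero_locus {P})"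

definition algebraically_stable :: "(cp2 \<rightharpoonup> cp2) \<Rightarrow> bool" where
  "algebraically_stable f \<longleftrightarrow>
    (\<forall>n\<ge>1. \<not> (\<exists>S. hypersurface S \<and> {q. \<exists>p\<in>S. iterate f n p = Some q} \<subseteq> indet f))"

definition locally_equicontinuous_on :: "cp2 set \<Rightarrow> (nat \<Rightarrow> cp2 \<Rightarrow> cp2) \<Rightarrow> bool" where
  "locally_equicontinuous_on U g \<longleftrightarrow>
    (\<forall>p\<in>U. \<exists>V. open V \<and> p \<in> V \<and> V \<subseteq> U \<and>
      (\<forall>x\<in>V. \<forall>\<epsilon>>0. \<exists>\<delta>>0. \<forall>n. \<forall>y\<in>V. dist x y < \<delta> \<longrightarrow> dist (g n x) (g n y) < \<epsilon>))"

text \<open>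
  Each of the three normality properties is local, so the maximal open set with the property is the
  union of all open sets with the property. Sequences are indexed from \<open>0\<close>, hence the \<open>Suc\<close>.
\<close>

definition fatou_set :: "(cp2 \<rightharpoonup> cp2) \<Rightarrow> cp2 set" where
  "fatou_set f = \<Union>{U. open U \<and> U \<subseteq> - closure (\<Union>n\<in>{1..}. indet (iterate f n)) \<and>
    locally_equicontinuous_on U (\<lambda>n x. the (iterate f (Suc n) x))}"

text \<open>
  Complex differentiability on a complex vector space whose multiplication by the imaginary unit is
  \<open>J\<close>: the real derivative exists and is complex linear.
\<close>

definition complex_differentiable_on ::
    "('a::real_normed_vector \<Rightarrow> 'a) \<Rightarrow> ('a \<Rightarrow> complex) \<Rightarrow> 'a set \<Rightarrow> bool" where
  "complex_differentiable_on J h S \<longleftrightarrow>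
    (\<forall>z\<in>S. \<exists>D. (h has_derivative D) (at z) \<and> (\<forall>v. D (J v) = \<i> * D v))"

text \<open>
  The complex structures of \<open>\<P>\<^sup>2\<close> and \<open>\<P>\<^sup>2 \<times> \<P>\<^sup>2\<close> are the quotient structures: a function on an open set
  is holomorphic iff its pullback to the cone over that set is.
\<close>

definition holo :: "(cp2 \<Rightarrow> complex) \<Rightarrow> cp2 set \<Rightarrow> bool" where
  "holo h V \<longleftrightarrow>
    complex_differentiable_on (\<lambda>v. \<i> *s v) (\<lambda>z. h (proj z)) {z. z \<noteq> 0 \<and> proj z \<in> V}"

definition holo2 :: "(cp2 \<times> cp2 \<Rightarrow> complex) \<Rightarrow> (cp2 \<times> cp2) set \<Rightarrow> bool" where
  "holo2 h V \<longleftrightarrow>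
    complex_differentiable_on (\<lambda>(v, w). (\<i> *s v, \<i> *s w)) (\<lambda>(z, w). h (proj z, proj w))
      {(z, w). z \<noteq> 0 \<and> w \<noteq> 0 \<and> (proj z, proj w) \<in> V}"

definition holomorphic_map_on :: "cp2 set \<Rightarrow> (cp2 \<Rightarrow> cp2) \<Rightarrow> bool" where
  "holomorphic_map_on V g \<longleftrightarrow> open V \<and> continuous_on V g \<and>
    (\<forall>W h. open W \<longrightarrow> holo h W \<longrightarrow> holo (h \<circ> g) (V \<inter> g -` W))"

text \<open>
  The parameter \<open>hol\<close> is the sheaf of holomorphic functions, \<^const>\<open>holo\<close> or \<^const>\<open>holo2\<close>. Since the
  condition is required at every point of \<open>X\<close>, an analytic subset of \<open>X\<close> is closed in \<open>X\<close>.
\<close>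

definition analytic_subset ::
    "(('a::topological_space \<Rightarrow> complex) \<Rightarrow> 'a set \<Rightarrow> bool) \<Rightarrow> 'a set \<Rightarrow> 'a set \<Rightarrow> bool" where
  "analytic_subset hol X A \<longleftrightarrow> A \<subseteq> X \<and>
    (\<forall>x\<in>X. \<exists>V H. open V \<and> x \<in> V \<and> V \<subseteq> X \<and> finite H \<and> (\<forall>h\<in>H. hol h V) \<and>
      A \<inter> V = {y\<in>V. \<forall>h\<in>H. h y = 0})"

text \<open>
  The local dimension of an analytic set \<open>A\<close> at \<open>p \<in> A\<close> is the least number of holomorphic functions
  near \<open>p\<close>, vanishing at \<open>p\<close>, that cut out \<open>p\<close> as an isolated point of \<open>A\<close>; the codimension is taken
  in the complex dimension 2 of the plane.
\<close>

definition local_dim :: "cp2 set \<Rightarrow> cp2 \<Rightarrow> nat" where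
  "local_dim A p = (LEAST k. \<exists>V (h :: nat \<Rightarrow> cp2 \<Rightarrow> complex). open V \<and> p \<in> V \<and>
    (\<forall>j<k. holo (h j) V \<and> h j p = 0) \<and> {x \<in> A \<inter> V. \<forall>j<k. h j x = 0} = {p})"

definition codim_ge :: "nat \<Rightarrow> cp2 set \<Rightarrow> bool" where
  "codim_ge c A \<longleftrightarrow> (\<forall>p\<in>A. local_dim A p + c \<le> 2)"

definition graph_on :: "cp2 set \<Rightarrow> (cp2 \<rightharpoonup> cp2) \<Rightarrow> (cp2 \<times> cp2) set" where
  "graph_on X g = closure {(x, y). x \<in> X \<and> g x = Some y} \<inter> X \<times> UNIV"

text \<open>
  A meromorphic map from an open set \<open>X\<close> to the plane: a holomorphic map off an analytic set of
  codimension at least 2 whose graph, closed up in \<open>X \<times> \<P>\<^sup>2\<close>, is analytic.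
\<close>

definition meromorphic_map_on :: "cp2 set \<Rightarrow> (cp2 \<rightharpoonup> cp2) \<Rightarrow> bool" where
  "meromorphic_map_on X g \<longleftrightarrow> open X \<and> dom g \<subseteq> X \<and>
    analytic_subset holo X (X - dom g) \<and> codim_ge 2 (X - dom g) \<and>
    holomorphic_map_on (dom g) (\<lambda>x. the (g x)) \<and>
    analytic_subset holo2 (X \<times> UNIV) (graph_on X g)"

definition hausdorff_dist :: "'a::metric_space set \<Rightarrow> 'a set \<Rightarrow> ennreal" where
  "hausdorff_dist A B =
    Inf {ennreal e |e. 0 < e \<and> A \<subseteq> (\<Union>b\<in>B. ball b e) \<and> B \<subseteq> (\<Union>a\<in>A. ball a e)}"

definition strongly_converges_on ::
    "cp2 set \<Rightarrow> (nat \<Rightarrow> (cp2 \<rightharpoonup> cp2)) \<Rightarrow> (cp2 \<rightharpoonup> cp2) \<Rightarrow> bool" where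
  "strongly_converges_on X g l \<longleftrightarrow>
    (\<forall>K. compact K \<and> K \<subseteq> X \<longrightarrow>
      (\<lambda>n. hausdorff_dist (graph_on X (g n) \<inter> K \<times> UNIV) (graph_on X l \<inter> K \<times> UNIV)) \<longlonglongrightarrow> 0)"

definition weakly_converges_on ::
    "cp2 set \<Rightarrow> (nat \<Rightarrow> (cp2 \<rightharpoonup> cp2)) \<Rightarrow> (cp2 \<rightharpoonup> cp2) \<Rightarrow> bool" where
  "weakly_converges_on X g l \<longleftrightarrow>
    (\<exists>A. analytic_subset holo X A \<and> codim_ge 2 A \<and> strongly_converges_on (X - A) g l)"

definition strongly_normal_on :: "cp2 set \<Rightarrow> (nat \<Rightarrow> (cp2 \<rightharpoonup> cp2)) \<Rightarrow> bool" where
  "strongly_normal_on X g \<longleftrightarrow>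
    (\<forall>r::nat \<Rightarrow> nat. strict_mono r \<longrightarrow>
      (\<exists>s l. strict_mono (s :: nat \<Rightarrow> nat) \<and> meromorphic_map_on X l \<and>
        strongly_converges_on X (g \<circ> r \<circ> s) l))"

definition weakly_normal_on :: "cp2 set \<Rightarrow> (nat \<Rightarrow> (cp2 \<rightharpoonup> cp2)) \<Rightarrow> bool" where
  "weakly_normal_on X g \<longleftrightarrow>
    (\<forall>r::nat \<Rightarrow> nat. strict_mono r \<longrightarrow>
      (\<exists>s l. strict_mono (s :: nat \<Rightarrow> nat) \<and> meromorphic_map_on X l \<and>
        weakly_converges_on X (g \<circ> r \<circ> s) l))"

definition strong_fatou_set :: "(cp2 \<rightharpoonup> cp2) \<Rightarrow> cp2 set" where
  "strong_fatou_set f = \<Union>{U. open U \<and> strongly_normal_on U (\<lambda>n. iterate f (Suc n))}"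

definition weak_fatou_set :: "(cp2 \<rightharpoonup> cp2) \<Rightarrow> cp2 set" where
  "weak_fatou_set f = \<Union>{U. open U \<and> weakly_normal_on U (\<lambda>n. iterate f (Suc n))}"

end

theory Submission
  imports
    Defs
    "HOL-Complex_Analysis.Complex_Analysis"
    "HOL-Computational_Algebra.Computational_Algebra"
    "HOL-Computational_Algebra.Field_as_Ring"
    "HOL-Library.Diagonal_Subsequence"
begin

text \<open>
  Only the inclusion of the weak Fatou set in the Fatou set is deep. By algebraic stability the iterate
  \<open>f ^ n\<close> is lifted by \<open>F ^ n\<close>, which is homogeneous of degree \<open>d ^ n\<close> and, for \<open>n \<ge> 1\<close>, vanishes exactly over
  the finite set of indeterminacy points. Under weak normality the iterates converge, up to subsequences,
  away from isolated points. On a disc through such a point, \<open>F ^ n\<close> divided by a zero-free function is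
  bounded and its order of vanishing at the centre is bounded uniformly in \<open>n\<close>. If a limit of rescaled
  iterates vanished at the centre, composition with \<open>F ^ j\<close> would multiply its order by \<open>d ^ j\<close>, beyond this
  bound, unless the limit disc lies in the indeterminacy cone of \<open>f ^ j\<close>. These cones
  are countably many lines, so the limit map would be constant near the point, and then the rescaled limit
  cannot vanish at the centre after all. So the limit is nonzero at the centre, and the maximum principle on bidiscs extends the
  convergence, and hence equicontinuity, over the point. Conversely, equicontinuity gives strong normality
  by the Arzela--Ascoli theorem, since a uniform limit of holomorphic maps has an analytic graph.
\<close>

text \<open>The obstacle is that the iterates are controlled only off the isolated point, whereas a
  lift is determined only up to a scalar function, so a limit of maps says nothing directly about
  the size of \<open>E n\<close> at the centre of a disc. Winding numbers bridge this gap. On a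
  suitable circle around the centre some component \<open>i\<close> of \<open>E n\<close> is
  zero-free, and its winding number counts its zeros in the disc. Sliding the disc in a transversal
  direction moves it off the point; there two late iterates are uniformly close, so they are never
  orthogonal, their Hermitian product has a continuous logarithm, and their winding numbers agree.
  Sliding back along the circles shows that the number of zeros in the disc through the point is
  eventually constant. That count is the degree of a monic factor, and the maximum principle turns
  it into both bounds, from above and from below. Convergence of graphs controls iterates only where
  they are defined, so late iterates must be shown to have no indeterminacy points near the compact
  sets in question; here finiteness of the indeterminacy sets enters, because the zero set of a
  single component is a curve.\<close>

no_notation fps_nth (infixl "$" 75)

section \<open>Homogeneous polynomials in three variables\<close>

definition monomial_eval :: "(3 \<Rightarrow>\<^sub>0 nat) \<Rightarrow> complex^3 \<Rightarrow> complex" where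
  "monomial_eval m z = (\<Prod>i\<in>UNIV. z $ i ^ Poly_Mapping.lookup m i)"

lemma monomial_eval_add: "monomial_eval (m + m') z = monomial_eval m z * monomial_eval m' z"
  by (simp add: monomial_eval_def lookup_add power_add prod.distrib)

lemma poly3_eval_superset:
  assumes "finite A" "Poly_Mapping.keys P \<subseteq> A"
  shows "poly3_eval P z = (\<Sum>m\<in>A. Poly_Mapping.lookup P m * monomial_eval m z)"
  unfolding poly3_eval_def monomial_eval_def
  by (rule sum.mono_neutral_left) (use assms in \<open>auto simp: in_keys_iff\<close>)

lemma poly3_eval_0 [simp]: "poly3_eval 0 z = 0"
  by (simp add: poly3_eval_def)

lemma poly3_eval_add [simp]: "poly3_eval (P + Q) z = poly3_eval P z + poly3_eval Q z"
proof -
  let ?A = "Poly_Mapping.keys P \<union> Poly_Mapping.keys Q"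
  have "finite ?A" "Poly_Mapping.keys (P + Q) \<subseteq> ?A" by (auto dest: subsetD[OF keys_add])
  thus ?thesis
    using poly3_eval_superset[of ?A]
    by (simp add: lookup_add distrib_right sum.distrib)
qed

lemma poly3_eval_single: "poly3_eval (Poly_Mapping.single m a) z = a * monomial_eval m z"
  by (cases "a = 0") (simp_all add: poly3_eval_def monomial_eval_def)

lemma poly3_eval_sum: "poly3_eval (\<Sum>x\<in>A. p x) z = (\<Sum>x\<in>A. poly3_eval (p x) z)"
  by (induction A rule: infinite_finite_induct) simp_all

lemma poly_mapping_sum_single:
  "(P :: 'a \<Rightarrow>\<^sub>0 'b::comm_monoid_add) =
    (\<Sum>m\<in>Poly_Mapping.keys P. Poly_Mapping.single m (Poly_Mapping.lookup P m))"
proof (rule poly_mapping_eqI)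
  fix k
  show "Poly_Mapping.lookup P k = Poly_Mapping.lookup
      (\<Sum>m\<in>Poly_Mapping.keys P. Poly_Mapping.single m (Poly_Mapping.lookup P m)) k"
  proof (cases "k \<in> Poly_Mapping.keys P")
    case True
    then show ?thesis
      by (simp add: lookup_sum lookup_single when_def sum.delta)
  next
    case False
    then show ?thesis
      by (simp add: lookup_sum lookup_single when_def in_keys_iff)
  qed
qed

lemma poly3_eval_mult [simp]: "poly3_eval (P * Q) z = poly3_eval P z * poly3_eval Q z"
proof -
  have "poly3_eval (P * Q) z = poly3_eval (\<Sum>m\<in>Poly_Mapping.keys P. \<Sum>l\<in>Poly_Mapping.keys Q.
      Poly_Mapping.single (m + l) (Poly_Mapping.lookup P m * Poly_Mapping.lookup Q l)) z"
    by (subst (1) poly_mapping_sum_single[of P], subst (1) poly_mapping_sum_single[of Q])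
      (simp add: sum_product mult_single)
  also have "\<dots> = poly3_eval P z * poly3_eval Q z"
    unfolding poly3_eval_superset[OF finite_keys order_refl, of P] poly3_eval_superset[OF finite_keys order_refl, of Q]
    by (simp add: poly3_eval_sum poly3_eval_single monomial_eval_add sum_product mult_ac)
  finally show ?thesis .
qed

lemma poly3_eval_1 [simp]: "poly3_eval 1 z = 1"
  by (subst single_one[symmetric], subst poly3_eval_single) (simp add: monomial_eval_def)

lemma poly3_eval_uminus [simp]: "poly3_eval (- P) z = - poly3_eval P z"
  using poly3_eval_add[of P "- P" z] by (simp add: eq_neg_iff_add_eq_0 add.commute)

lemma poly3_eval_diff [simp]: "poly3_eval (P - Q) z = poly3_eval P z - poly3_eval Q z"
  using poly3_eval_add[of P "- Q" z] by simp

lemma poly3_eval_const [simp]: "poly3_eval (Poly_Mapping.single 0 c) z = c"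
  by (simp add: poly3_eval_single monomial_eval_def)

lemma poly3_eval_power [simp]: "poly3_eval (P ^ n) z = poly3_eval P z ^ n"
  by (induction n) simp_all

lemma poly3_eval_prod: "poly3_eval (\<Prod>x\<in>A. p x) z = (\<Prod>x\<in>A. poly3_eval (p x) z)"
  by (induction A rule: infinite_finite_induct) simp_all

definition poly3_var :: "3 \<Rightarrow> poly3" where
  "poly3_var i = Poly_Mapping.single (Poly_Mapping.single i 1) 1"

lemma poly3_eval_var [simp]: "poly3_eval (poly3_var i) z = z $ i"
proof -
  have "(\<Prod>j\<in>UNIV. z $ j ^ Poly_Mapping.lookup (Poly_Mapping.single i (1::nat)) j) =
      (\<Prod>j\<in>UNIV. if j = i then z $ j else 1)"
    by (rule prod.cong) (auto simp: lookup_single when_def)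
  thus ?thesis
    by (simp add: poly3_var_def poly3_eval_single monomial_eval_def)
qed

text \<open>Iterated univariate polynomials carry the gcds and pseudo-division used for the
  finiteness of the indeterminacy set. The outermost variable is the third argument
  \<open>z\<close>, the innermost is \<open>x\<close>.\<close>

definition eval3 :: "complex poly poly poly \<Rightarrow> complex \<Rightarrow> complex \<Rightarrow> complex \<Rightarrow> complex" where
  "eval3 A x y z = poly (poly (poly A [:[:z:]:]) [:y:]) x"

lemma poly_zero_if_const_zero:
  fixes A :: "'a::{idom,ring_char_0} poly poly"
  assumes "\<And>z. poly A [:z:] = 0"
  shows "A = 0"
proof (rule ccontr)
  assume "A \<noteq> 0"
  hence "finite {x. poly A x = 0}" by (rule poly_roots_finite)
  moreover have "range (\<lambda>z. [:z:]) \<subseteq> {x. poly A x = 0}" using assms by auto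
  ultimately have "finite (range (\<lambda>z::'a. [:z:]))" using finite_subset by blast
  moreover have "inj (\<lambda>z::'a. [:z:])" by (auto intro: injI)
  ultimately have "finite (UNIV :: 'a set)" using finite_imageD by blast
  thus False by (simp add: infinite_UNIV_char_0)
qed

lemma eval3_eq_0:
  assumes "\<And>x y z. eval3 A x y z = 0"
  shows "A = 0"
proof (rule poly_zero_if_const_zero)
  fix z :: "complex poly"
  have *: "poly A [:[:z:]:] = 0" for z :: complex
  proof (rule poly_zero_if_const_zero)
    fix y
    have "poly (poly (poly A [:[:z:]:]) [:y:]) x = 0" for x
      using assms[of x y z] unfolding eval3_def by simp
    thus "poly (poly A [:[:z:]:]) [:y:] = 0"
      using poly_all_0_iff_0 by blast
  qed
  have "A = 0"
  proof (rule ccontr)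
    assume "A \<noteq> 0"
    hence "finite {x. poly A x = 0}" by (rule poly_roots_finite)
    moreover have "range (\<lambda>z. [:[:z:]:]) \<subseteq> {x. poly A x = 0}" using * by auto
    ultimately have "finite (range (\<lambda>z::complex. [:[:z:]:]))" using finite_subset by blast
    moreover have "inj (\<lambda>z::complex. [:[:z:]:])" by (auto intro: injI)
    ultimately have "finite (UNIV :: complex set)" using finite_imageD by blast
    thus False by (simp add: infinite_UNIV_char_0)
  qed
  thus "poly A [:z:] = 0" by simp
qed

lemma eval3_simps [simp]:
  "eval3 (A + B) x y z = eval3 A x y z + eval3 B x y z"
  "eval3 (A * B) x y z = eval3 A x y z * eval3 B x y z"
  "eval3 1 x y z = 1" "eval3 0 x y z = 0"
  "eval3 (A - B) x y z = eval3 A x y z - eval3 B x y z"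
  by (simp_all add: eval3_def)

lemma eval3_sum: "eval3 (\<Sum>a\<in>S. p a) x y z = (\<Sum>a\<in>S. eval3 (p a) x y z)"
  by (induction S rule: infinite_finite_induct) simp_all

lemma eval3_monom:
  "eval3 (monom (monom (monom c i) j) k) x y z = c * x ^ i * y ^ j * z ^ k"
proof -
  have "[:[:z:]:] ^ k = [:[:z ^ k:]:]" "[:y:] ^ j = [:y ^ j:]"
    by (induction k, simp_all add: pCons_one) (induction j, simp_all add: pCons_one)
  thus ?thesis by (simp add: eval3_def poly_monom)
qed

lemma UNIV_3_distinct:
  fixes i j k :: 3
  assumes "distinct [i, j, k]"
  shows "UNIV = {i, j, k}"
proof -
  have "card {i, j, k} = 3" using assms by simp
  moreover have "card (UNIV :: 3 set) = 3" by simp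
  ultimately show ?thesis by (metis card_subset_eq finite subset_UNIV)
qed

lemma prod_3_distinct:
  fixes i j k :: 3
  assumes "distinct [i, j, k]"
  shows "prod f UNIV = f i * f j * f k"
  using assms by (subst UNIV_3_distinct[OF assms]) (simp add: mult.assoc)

lemma eval3_of_poly3:
  assumes "distinct [i, j, k]"
  shows "\<exists>A. \<forall>z. eval3 A (z $ i) (z $ j) (z $ k) = poly3_eval P z"
proof (intro exI allI)
  fix z
  show "eval3 (\<Sum>m\<in>Poly_Mapping.keys P. monom (monom (monom (Poly_Mapping.lookup P m) (Poly_Mapping.lookup m i))
    (Poly_Mapping.lookup m j)) (Poly_Mapping.lookup m k)) (z $ i) (z $ j) (z $ k) = poly3_eval P z"
    by (simp add: eval3_sum eval3_monom poly3_eval_def prod_3_distinct[OF assms] mult.assoc)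
qed

lemma poly3_of_eval3:
  "\<exists>P. \<forall>z. poly3_eval P z = eval3 A (z $ i) (z $ j) (z $ k)"
proof -
  have 1: "\<exists>P. \<forall>z. poly3_eval P z = poly A (z $ i)" for A :: "complex poly"
  proof (induction A)
    case 0
    show ?case by (rule exI[of _ 0]) simp
  next
    case (pCons a A)
    then obtain P where "\<forall>z. poly3_eval P z = poly A (z $ i)" by blast
    thus ?case
      by (intro exI[of _ "Poly_Mapping.single 0 a + poly3_var i * P"]) simp
  qed
  have 2: "\<exists>P. \<forall>z. poly3_eval P z = poly (poly A [:z $ j:]) (z $ i)" for A :: "complex poly poly"
  proof (induction A)
    case 0
    show ?case by (rule exI[of _ 0]) simp
  next
    case (pCons a A)
    then obtain P where "\<forall>z. poly3_eval P z = poly (poly A [:z $ j:]) (z $ i)" by blast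
    moreover obtain Q where "\<forall>z. poly3_eval Q z = poly a (z $ i)" using 1 by blast
    ultimately show ?case
      by (intro exI[of _ "Q + poly3_var j * P"]) simp
  qed
  show ?thesis
  proof (induction A)
    case 0
    show ?case by (rule exI[of _ 0]) simp
  next
    case (pCons a A)
    then obtain P where "\<forall>z. poly3_eval P z = eval3 A (z $ i) (z $ j) (z $ k)" by blast
    moreover obtain Q where "\<forall>z. poly3_eval Q z = poly (poly a [:z $ j:]) (z $ i)" using 2 by blast
    ultimately show ?case
      by (intro exI[of _ "Q + poly3_var k * P"]) (simp add: eval3_def)
  qed
qed

text \<open>The iterated coefficients of \<open>A\<close> are exactly the coefficients of
  \<open>P\<close>, because a monomial is determined by its three exponents; so vanishing of the
  function forces \<open>A = 0\<close> and with it \<open>P = 0\<close>.\<close>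

lemma poly3_eval_eq_0:
  assumes "\<And>z. poly3_eval P z = 0"
  shows "P = 0"
proof -
  define A where "A = (\<Sum>m\<in>Poly_Mapping.keys P. monom (monom (monom (Poly_Mapping.lookup P m)
    (Poly_Mapping.lookup m 1)) (Poly_Mapping.lookup m 2)) (Poly_Mapping.lookup m 3))"
  have d: "distinct [1, 2, 3 :: 3]" by simp
  have A: "eval3 A (z $ 1) (z $ 2) (z $ 3) = poly3_eval P z" for z
    unfolding A_def
    by (simp add: eval3_sum eval3_monom poly3_eval_def prod_3_distinct[OF d] mult.assoc)
  have "A = 0"
  proof (rule eval3_eq_0)
    fix x y z
    show "eval3 A x y z = 0"
      using A[of "vector [x, y, z]"] assms by (simp add: vector_3)
  qed
  have "Poly_Mapping.lookup P m = 0" for m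
  proof (rule ccontr)
    assume ne: "Poly_Mapping.lookup P m \<noteq> 0"
    have eq: "m' = m" if "Poly_Mapping.lookup m' 1 = Poly_Mapping.lookup m 1"
      "Poly_Mapping.lookup m' 2 = Poly_Mapping.lookup m 2"
      "Poly_Mapping.lookup m' 3 = Poly_Mapping.lookup m 3" for m'
      using that by (intro poly_mapping_eqI) (metis exhaust_3)
    have "0 = coeff (coeff (coeff A (Poly_Mapping.lookup m 3)) (Poly_Mapping.lookup m 2)) (Poly_Mapping.lookup m 1)"
      using \<open>A = 0\<close> by simp
    also have "\<dots> = (\<Sum>m'\<in>Poly_Mapping.keys P. if m' = m then Poly_Mapping.lookup P m' else 0)"
      unfolding A_def coeff_sum
      by (rule sum.cong) (auto dest: eq)
    also have "\<dots> = Poly_Mapping.lookup P m"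
      using ne by (simp add: in_keys_iff)
    finally show False using ne by simp
  qed
  thus ?thesis by (intro poly_mapping_eqI) simp
qed

lemma poly3_eqI:
  assumes "\<And>z. poly3_eval P z = poly3_eval Q z"
  shows "P = Q"
  using poly3_eval_eq_0[of "P - Q"] assms by simp

section \<open>Homogeneity tested along lines through the origin\<close>

definition total_degree :: "(3 \<Rightarrow>\<^sub>0 nat) \<Rightarrow> nat" where
  "total_degree m = (\<Sum>i\<in>UNIV. Poly_Mapping.lookup m i)"

lemma monomial_eval_smult: "monomial_eval m (t *s z) = t ^ total_degree m * monomial_eval m z"
  by (simp add: monomial_eval_def total_degree_def power_mult_distrib prod.distrib power_sum)

text \<open>The restriction of \<open>P\<close> to the line through \<open>z\<close>. Its
  coefficients are the values of the homogeneous parts at \<open>z\<close>, which turns statements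
  on homogeneity into statements on polynomials in one variable.\<close>

definition ray_poly :: "poly3 \<Rightarrow> complex^3 \<Rightarrow> complex poly" where
  "ray_poly P z = (\<Sum>m\<in>Poly_Mapping.keys P.
    monom (Poly_Mapping.lookup P m * monomial_eval m z) (total_degree m))"

lemma poly_ray_poly: "poly (ray_poly P z) t = poly3_eval P (t *s z)"
  by (simp add: ray_poly_def poly_sum poly_monom poly3_eval_superset[OF finite_keys order_refl]
      monomial_eval_smult mult_ac)

lemma poly_eqI_eval: "(\<And>x. poly p x = poly q x) \<Longrightarrow> p = (q :: complex poly)"
  by (metis poly_eq_poly_eq_iff ext)

lemma ray_poly_mult: "ray_poly (P * Q) z = ray_poly P z * ray_poly Q z"
  by (rule poly_eqI_eval) (simp add: poly_ray_poly)

definition hom_part :: "nat \<Rightarrow> poly3 \<Rightarrow> poly3" where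
  "hom_part d P = (\<Sum>m | m \<in> Poly_Mapping.keys P \<and> total_degree m = d.
    Poly_Mapping.single m (Poly_Mapping.lookup P m))"

lemma coeff_ray_poly: "coeff (ray_poly P z) d = poly3_eval (hom_part d P) z"
proof -
  have "coeff (ray_poly P z) d = (\<Sum>m\<in>Poly_Mapping.keys P.
      if total_degree m = d then Poly_Mapping.lookup P m * monomial_eval m z else 0)"
    by (simp add: ray_poly_def coeff_sum)
  also have "\<dots> = poly3_eval (hom_part d P) z"
    unfolding hom_part_def poly3_eval_sum poly3_eval_single by (simp add: sum.inter_filter)
  finally show ?thesis .
qed

lemma lookup_hom_part:
  "Poly_Mapping.lookup (hom_part d P) m = (if total_degree m = d then Poly_Mapping.lookup P m else 0)"
proof -
  let ?S = "{m \<in> Poly_Mapping.keys P. total_degree m = d}"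
  have "Poly_Mapping.lookup (hom_part d P) m =
      (\<Sum>m'\<in>?S. if m' = m then Poly_Mapping.lookup P m' else 0)"
    by (simp add: hom_part_def lookup_sum lookup_single when_def)
  thus ?thesis by (simp add: in_keys_iff)
qed

lemma homogeneous_iff_hom_part: "homogeneous d P \<longleftrightarrow> (\<forall>e. e \<noteq> d \<longrightarrow> hom_part e P = 0)"
proof
  assume "homogeneous d P"
  thus "\<forall>e. e \<noteq> d \<longrightarrow> hom_part e P = 0"
    by (auto simp: poly_mapping_eq_iff lookup_hom_part fun_eq_iff homogeneous_def in_keys_iff
        total_degree_def)
next
  assume *: "\<forall>e. e \<noteq> d \<longrightarrow> hom_part e P = 0"
  show "homogeneous d P"
    unfolding homogeneous_def total_degree_def[symmetric]
  proof (intro ballI, rule ccontr)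
    fix m assume m: "m \<in> Poly_Mapping.keys P" "total_degree m \<noteq> d"
    hence "Poly_Mapping.lookup (hom_part (total_degree m) P) m = 0" using * by simp
    thus False using m by (simp add: lookup_hom_part in_keys_iff)
  qed
qed

lemma ray_poly_homogeneous:
  assumes "homogeneous d P"
  shows "ray_poly P z = monom (poly3_eval P z) d"
proof (rule poly_eqI)
  have "poly3_eval (hom_part d P) z = poly3_eval P z"
  proof -
    have "hom_part d P = P"
      using assms
      by (auto simp: poly_mapping_eq_iff lookup_hom_part fun_eq_iff homogeneous_def in_keys_iff
        total_degree_def)
    thus ?thesis by simp
  qed
  thus "coeff (ray_poly P z) e = coeff (monom (poly3_eval P z) d) e" for e
    using assms by (auto simp: coeff_ray_poly homogeneous_iff_hom_part)
qed

lemma homogeneous_iff_eval: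
  "homogeneous d P \<longleftrightarrow> (\<forall>t z. poly3_eval P (t *s z) = t ^ d * poly3_eval P z)"
proof
  assume "homogeneous d P"
  thus "\<forall>t z. poly3_eval P (t *s z) = t ^ d * poly3_eval P z"
    by (metis poly_ray_poly ray_poly_homogeneous poly_monom mult.commute)
next
  assume *: "\<forall>t z. poly3_eval P (t *s z) = t ^ d * poly3_eval P z"
  have "ray_poly P z = monom (poly3_eval P z) d" for z
    by (rule poly_eqI_eval) (simp add: poly_ray_poly * poly_monom)
  hence "poly3_eval (hom_part e P) z = 0" if "e \<noteq> d" for e z
    using that coeff_ray_poly[of P z e] by simp
  thus "homogeneous d P" unfolding homogeneous_iff_hom_part by (blast intro: poly3_eval_eq_0)
qed

lemma homogeneous_eval: "homogeneous d P \<Longrightarrow> poly3_eval P (t *s z) = t ^ d * poly3_eval P z"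
  by (simp add: homogeneous_iff_eval)

text \<open>As long as \<open>D\<close> is positive, one of the two factors vanishes at
  \<open>0\<close>, so the variable can be stripped from it and the induction applied.\<close>

lemma factor_of_monom:
  assumes "p * q = monom c D" "c \<noteq> (0::complex)"
  shows "\<exists>m a. p = monom a m"
  using assms
proof (induction D arbitrary: p q)
  case 0
  hence "p * q \<noteq> 0" "degree (p * q) = 0" by (simp_all add: degree_monom_eq)
  hence "degree p = 0" by (metis add_is_0 degree_mult_eq mult_eq_0_iff)
  thus ?case by (metis degree_eq_zeroE monom_0)
next
  case (Suc D)
  have "coeff (p * q) 0 = 0" using Suc.prems by simp
  hence "coeff p 0 = 0 \<or> coeff q 0 = 0" by (simp add: coeff_mult)
  thus ?case
  proof
    assume "coeff p 0 = 0"
    then obtain p' where p: "p = pCons 0 p'" by (metis coeff_pCons_0 pCons_cases)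
    with Suc.prems have "p' * q = monom c D" by (simp add: monom_Suc)
    then obtain m a where "p' = monom a m" using Suc.IH Suc.prems by blast
    thus ?case using p by (metis monom_Suc)
  next
    assume "coeff q 0 = 0"
    then obtain q' where p: "q = pCons 0 q'" by (metis coeff_pCons_0 pCons_cases)
    with Suc.prems have "p * q' = monom c D" by (simp add: monom_Suc)
    thus ?case using Suc.IH Suc.prems by blast
  qed
qed

text \<open>On each line where \<open>G * K\<close> is nonzero, \<open>G\<close> restricts to a
  factor of a monomial, hence to a monomial, so two different homogeneous parts of \<open>G\<close>
  are not both nonzero there. Their product with \<open>G * K\<close> therefore vanishes
  identically, and polynomials form a domain.\<close>

lemma factor_homogeneous:
  assumes "homogeneous D (G * K)" "G * K \<noteq> 0"
  shows "\<exists>a. homogeneous a G"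
proof -
  have prod0: "hom_part m G = 0 \<or> hom_part m' G = 0" if "m \<noteq> m'" for m m'
  proof -
    have "hom_part m G * hom_part m' G * (G * K) = 0"
    proof (rule poly3_eval_eq_0)
      fix z
      show "poly3_eval (hom_part m G * hom_part m' G * (G * K)) z = 0"
      proof (cases "poly3_eval (G * K) z = 0")
        case False
        have "ray_poly G z * ray_poly K z = monom (poly3_eval (G * K) z) D"
          using ray_poly_homogeneous[OF assms(1)] by (simp add: ray_poly_mult)
        then obtain n a where "ray_poly G z = monom a n" using factor_of_monom False by blast
        hence "coeff (ray_poly G z) m = 0 \<or> coeff (ray_poly G z) m' = 0" using that by auto
        thus ?thesis by (auto simp: coeff_ray_poly)
      qed simp
    qed
    thus ?thesis using assms(2) by simp
  qed
  show ?thesis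
  proof (cases "\<exists>a. hom_part a G \<noteq> 0")
    case True
    then obtain a where "hom_part a G \<noteq> 0" by blast
    thus ?thesis using prod0 unfolding homogeneous_iff_hom_part by blast
  qed (auto simp: homogeneous_iff_hom_part)
qed

lemma homogeneous_unique:
  assumes "homogeneous a P" "homogeneous b P" "P \<noteq> 0"
  shows "a = b"
proof -
  have "Poly_Mapping.keys P \<noteq> {}" using assms(3) by simp
  then obtain m where "m \<in> Poly_Mapping.keys P" by blast
  hence "sum (Poly_Mapping.lookup m) UNIV = a" "sum (Poly_Mapping.lookup m) UNIV = b"
    using assms(1,2) unfolding homogeneous_def by auto
  thus ?thesis by simp
qed

lemma homogeneous_mult:
  "homogeneous a P \<Longrightarrow> homogeneous b Q \<Longrightarrow> homogeneous (a + b) (P * Q)"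
  by (simp add: homogeneous_iff_eval power_add)

lemma homogeneous_0 [simp]: "homogeneous d 0"
  by (simp add: homogeneous_def)

lemma homogeneous_quotient:
  assumes "homogeneous a G" "homogeneous D (G * K)" "G \<noteq> 0" "K \<noteq> 0"
  shows "a \<le> D" "homogeneous (D - a) K"
proof -
  have "G * K \<noteq> 0" using assms by simp
  moreover from this obtain b where b: "homogeneous b K"
    using factor_homogeneous[of D K G] assms(2) by (auto simp: mult.commute)
  ultimately have "D = a + b"
    using homogeneous_mult[OF assms(1) b] homogeneous_unique assms(2) by blast
  thus "a \<le> D" "homogeneous (D - a) K" using b by simp_all
qed

lemma homogeneous_0_unit:
  assumes "homogeneous 0 G" "G \<noteq> 0"
  shows "G dvd 1"
proof -
  have c: "poly3_eval G z = poly3_eval G 0" for z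
  proof -
    have "poly3_eval G (0 *s z) = poly3_eval G z" by (subst homogeneous_eval[OF assms(1)]) simp
    thus ?thesis by simp
  qed
  hence "poly3_eval G 0 \<noteq> 0" using assms(2) poly3_eval_eq_0[of G] by metis
  moreover have "G = Poly_Mapping.single 0 (poly3_eval G 0)"
    by (rule poly3_eqI) (simp, rule c)
  ultimately have "G * Poly_Mapping.single 0 (inverse (poly3_eval G 0)) = 1"
    by (intro poly3_eqI) (simp, subst c, simp)
  thus ?thesis by (metis dvd_triv_left)
qed

lemma reduced_nonzero: "reduced H \<Longrightarrow> \<exists>i. H $ i \<noteq> 0"
  unfolding reduced_def by (metis dvd_0_right dvd_0_left zero_neq_one)

text \<open>As long as a common non-unit factor remains, it is homogeneous of positive degree, and
  dividing by it lowers \<open>D\<close>; this induction takes the place of a gcd of the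
  components.\<close>

lemma reduced_factorization:
  assumes "\<forall>i. homogeneous D (W $ i)" "\<exists>i. W $ i \<noteq> 0"
  shows "\<exists>H h. reduced H \<and> h \<noteq> 0 \<and> (\<forall>i. W $ i = h * H $ i)"
  using assms
proof (induction D arbitrary: W rule: less_induct)
  case (less D)
  show ?case
  proof (cases "reduced W")
    case True
    thus ?thesis by (intro exI[of _ W] exI[of _ 1]) simp
  next
    case False
    then obtain G where G: "\<And>i. G dvd W $ i" "\<not> G dvd 1"
      using less.prems unfolding reduced_def by blast
    then obtain K where K: "\<And>i. W $ i = G * K i" unfolding dvd_def by metis
    obtain i0 where i0: "W $ i0 \<noteq> 0" using less.prems by blast
    hence nz: "G \<noteq> 0" "K i0 \<noteq> 0" using K[of i0] by auto
    obtain a where a: "homogeneous a G"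
      using factor_homogeneous[of D G "K i0"] less.prems(1) i0 K by metis
    have "a \<noteq> 0"
    proof
      assume "a = 0"
      thus False using homogeneous_0_unit[of G] a nz G by blast
    qed
    have K2: "homogeneous (D - a) (K i)" for i
      using homogeneous_quotient[OF a, of D "K i"] less.prems(1) K nz by (cases "K i = 0") auto
    have "a \<le> D" using homogeneous_quotient[OF a, of D "K i0"] less.prems(1) K nz by metis
    with \<open>a \<noteq> 0\<close> have "D - a < D" by simp
    from less.IH[OF this, of "\<chi> i. K i"] K2 nz(2)
    obtain H h where "reduced H" "h \<noteq> 0" "\<forall>i. K i = h * H $ i" by auto
    thus ?thesis using K nz(1)
      by (intro exI[of _ H] exI[of _ "G * h"]) (simp add: mult.assoc)
  qed
qed

section \<open>Composition of homogeneous maps and their action on projective points\<close>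

lemma self_map_comp:
  assumes "homogeneous e P" "\<forall>i. homogeneous d (W $ i)"
  shows "\<exists>Q. homogeneous (d * e) Q \<and> (\<forall>z. poly3_eval Q z = poly3_eval P (self_map W z))"
proof (intro exI conjI allI)
  let ?Q = "\<Sum>m\<in>Poly_Mapping.keys P. Poly_Mapping.single 0 (Poly_Mapping.lookup P m) *
    (\<Prod>i\<in>UNIV. W $ i ^ Poly_Mapping.lookup m i)"
  show ev: "poly3_eval ?Q z = poly3_eval P (self_map W z)" for z
    by (simp add: poly3_eval_sum poly3_eval_prod poly3_eval_def[of P] self_map_def)
  have "self_map W (t *s z) = t ^ d *s self_map W z" for t z
    using assms(2) by (simp add: self_map_def homogeneous_eval vec_eq_iff)
  thus "homogeneous (d * e) ?Q"
    unfolding homogeneous_iff_eval ev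
    using assms(1) by (simp add: homogeneous_eval power_mult)
qed

lemma self_map_iterate:
  assumes "\<forall>i. homogeneous d (F $ i)"
  shows "\<exists>W. (\<forall>i. homogeneous (d ^ n) (W $ i)) \<and> self_map W = self_map F ^^ n"
proof (induction n)
  case 0
  have "homogeneous 1 (poly3_var i)" for i by (simp add: homogeneous_iff_eval)
  thus ?case
    by (intro exI[of _ "\<chi> i. poly3_var i"]) (auto simp: self_map_def fun_eq_iff vec_eq_iff)
next
  case (Suc n)
  then obtain W where W: "\<forall>i. homogeneous (d ^ n) (W $ i)" "self_map W = self_map F ^^ n" by blast
  have "\<forall>i. \<exists>Q. homogeneous (d ^ n * d) Q \<and> (\<forall>z. poly3_eval Q z = poly3_eval (F $ i) (self_map W z))"
    using self_map_comp[OF _ W(1)] assms by blast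
  then obtain Q where Q: "\<And>i. homogeneous (d ^ n * d) (Q i)"
    "\<And>i z. poly3_eval (Q i) z = poly3_eval (F $ i) (self_map W z)" by metis
  show ?case
    using Q W(2)
    by (intro exI[of _ "\<chi> i. Q i"])
      (auto simp: self_map_def[of "vec_lambda Q"] self_map_def[of F "(self_map F ^^ n) _"] fun_eq_iff mult.commute)
qed

lemma self_map_smult:
  assumes "\<forall>i. homogeneous d (W $ i)"
  shows "self_map W (t *s z) = t ^ d *s self_map W z"
  using assms by (simp add: self_map_def homogeneous_eval vec_eq_iff)

lemma rep_cp2_proj:
  assumes "z \<noteq> 0"
  obtains c where "c \<noteq> 0" "rep_cp2 (proj z) = c *s z"
proof -
  have "proj (rep_cp2 (proj z)) = proj z" by (rule proj_rep_cp2)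
  then obtain c where "rep_cp2 (proj z) = c *s z"
    using proj_eq_iff[OF rep_cp2_nonzero assms] by blast
  moreover from this have "c \<noteq> 0" using rep_cp2_nonzero[of "proj z"] by auto
  ultimately show ?thesis using that by blast
qed

lemma smult_eq_0_iff: "c *s (z::complex^'n) = 0 \<longleftrightarrow> c = 0 \<or> z = 0"
  by (auto simp: vec_eq_iff)

lemma proj_smult: "c \<noteq> 0 \<Longrightarrow> proj (c *s z) = proj z"
  by (cases "z = 0") (auto simp: proj_eq_iff smult_eq_0_iff)

lemma rational_map_of_proj:
  assumes "\<forall>i. homogeneous d (W $ i)" "z \<noteq> 0"
  shows "rational_map_of W (proj z) =
    (if self_map W z = 0 then None else Some (proj (self_map W z)))"
proof -
  obtain c where c: "c \<noteq> 0" "rep_cp2 (proj z) = c *s z" using rep_cp2_proj assms(2) by blast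
  thus ?thesis
    by (simp add: rational_map_of_def self_map_smult[OF assms(1)] smult_eq_0_iff proj_smult)
qed

section \<open>Finiteness of the indeterminacy set\<close>

text \<open>A form of elimination: an element \<open>C\<close> of least degree in the ideal of
  \<open>A\<close> and \<open>B\<close> has, by pseudo-division and Gauss's lemma, a primitive part
  dividing both. Coprimality makes this part a unit, so \<open>C\<close> is free of the outermost
  variable.\<close>

lemma coprime_bezout_const:
  fixes A B :: "complex poly poly poly"
  assumes "coprime A B"
  shows "\<exists>u v r. u * A + v * B = [:r:] \<and> r \<noteq> 0"
proof -
  define I where "I = {u * A + v * B | u v. True}"
  have "A \<noteq> 0 \<or> B \<noteq> 0" using assms by auto
  moreover have AB: "A \<in> I" "B \<in> I"
    unfolding I_def
    by (auto intro!: exI[of "\<lambda>u. \<exists>v. A = u * A + v * B" 1] exI[of "\<lambda>v. A = 1 * A + v * B" 0]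
      exI[of "\<lambda>u. \<exists>v. B = u * A + v * B" 0] exI[of "\<lambda>v. B = 0 * A + v * B" 1])
  ultimately have "\<exists>C\<in>I. C \<noteq> 0" by blast
  then obtain C where C: "C \<in> I" "C \<noteq> 0" "\<And>D. D \<in> I \<Longrightarrow> D \<noteq> 0 \<Longrightarrow> degree C \<le> degree D"
    using ex_has_least_nat[of "\<lambda>C. C \<in> I \<and> C \<noteq> 0" _ degree] by blast
  have closed: "p * X + q * Y \<in> I" if XY: "X \<in> I" "Y \<in> I" for p q X Y
  proof -
    obtain u v u' v' where "X = u * A + v * B" "Y = u' * A + v' * B"
      using XY unfolding I_def by blast
    hence "p * X + q * Y = (p * u + q * u') * A + (p * v + q * v') * B"
      by (simp add: algebra_simps)
    thus ?thesis unfolding I_def by blast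
  qed
  \<comment> \<open>Pseudo-division yields divisibility only up to the factor \<open>a\<close>;
    passing to the fraction field of the coefficients removes it, and primitivity brings the
    divisibility back.\<close>
  have dvd: "primitive_part C dvd X" if X: "X \<in> I" for X
  proof -
    define r where "r = pseudo_mod X C"
    obtain a q where aq: "a \<noteq> 0" "smult a X = C * q + r" "r = 0 \<or> degree r < degree C"
      using pseudo_mod[OF C(2), of X] unfolding r_def by blast
    have "r = [:a:] * X + (- q) * C" using aq(2) by (simp add: algebra_simps)
    hence "r \<in> I" using closed[OF X C(1), of "[:a:]" "- q"] by (simp only:)
    hence "r = 0" using C(3)[of r] aq(3) by fastforce
    hence "C dvd smult a X" using aq(2) by simp
    moreover have "primitive_part C dvd C"
      by (metis content_times_primitive_part dvd_smult dvd_refl)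
    ultimately have "primitive_part C dvd smult a X" using dvd_trans by blast
    hence "fract_poly (primitive_part C) dvd fract_poly (smult a X)" by (rule fract_poly_dvd)
    hence "fract_poly (primitive_part C) dvd fract_poly X"
      using aq(1) by (simp add: dvd_smult_iff)
    thus ?thesis by (rule fract_poly_dvdD) (simp add: C(2))
  qed
  have "is_unit (primitive_part C)"
    using assms dvd[OF AB(1)] dvd[OF AB(2)] by (rule coprime_common_divisor)
  hence "degree (primitive_part C) = 0" by (metis is_unit_polyE degree_pCons_0)
  hence "degree C = 0" by simp
  then obtain r where "C = [:r:]" by (meson degree_eq_zeroE)
  moreover obtain u v where "C = u * A + v * B" using C(1) unfolding I_def by blast
  moreover have "r \<noteq> 0" using C(2) \<open>C = [:r:]\<close> by simp
  ultimately show ?thesis by metis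
qed

lemma poly_poly_const_eq: "poly (poly r [:y:]) s = poly (map_poly (\<lambda>p. poly p s) r) (y::complex)"
  by (induction r) (simp_all add: map_poly_pCons)

lemma poly_poly_line: "poly (poly r [:0, a:]) s = poly (poly r [:s * a:]) (s::complex)"
  by (induction r) (simp_all add: algebra_simps)

text \<open>Here \<open>s\<close> is the first coordinate and \<open>s * a\<close> the second, so
  the lines are those through the origin. Fixing one \<open>s\<close> at which the leading
  coefficient survives, every line contained in the zero set of \<open>r\<close> contributes a root
  \<open>s * a\<close> of the one-variable polynomial \<open>?q\<close>, and these are finite in
  number.\<close>

lemma finite_slopes:
  fixes r :: "complex poly poly"
  assumes "r \<noteq> 0"
  shows "finite {a. infinite {s. poly (poly r [:s * a:]) s = 0}}"
proof -
  have inf: "infinite (UNIV - insert 0 {s. poly (lead_coeff r) s = 0})"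
    using assms poly_roots_finite[of "lead_coeff r"] by (simp add: infinite_UNIV_char_0)
  then obtain s where s: "s \<noteq> 0" "poly (lead_coeff r) s \<noteq> 0"
  proof -
    have "UNIV - insert 0 {s. poly (lead_coeff r) s = 0} \<noteq> {}" using inf by (metis finite.emptyI)
    thus ?thesis using that by blast
  qed
  let ?q = "map_poly (\<lambda>p. poly p s) r"
  have "coeff ?q (degree r) \<noteq> 0" using s(2) by (simp add: coeff_map_poly)
  hence "?q \<noteq> 0" by auto
  hence "finite ((\<lambda>y. y / s) ` {y. poly ?q y = 0})" using poly_roots_finite by blast
  moreover have "{a. infinite {s. poly (poly r [:s * a:]) s = 0}} \<subseteq> (\<lambda>y. y / s) ` {y. poly ?q y = 0}"
  proof
    fix a assume "a \<in> {a. infinite {s. poly (poly r [:s * a:]) s = 0}}"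
    hence "infinite {s. poly (poly r [:0, a:]) s = 0}" by (simp add: poly_poly_line)
    hence "poly r [:0, a:] = 0" using poly_roots_finite by blast
    hence "poly ?q (s * a) = 0" by (metis poly_0 poly_poly_const_eq poly_poly_line)
    thus "a \<in> (\<lambda>y. y / s) ` {y. poly ?q y = 0}" using s(1) by (intro image_eqI[of _ _ "s * a"]) auto
  qed
  ultimately show ?thesis using finite_subset by blast
qed

text \<open>Vanishing is recorded at the parameter \<open>t\<close> of a line through the origin
  because having infinitely many zeros there passes, by pigeonhole, to one of the factors of a
  product. Factors of homogeneous polynomials can thus be treated without tracking their
  degrees.\<close>

definition zero_on_line :: "complex poly poly poly \<Rightarrow> complex \<Rightarrow> complex \<Rightarrow> complex \<Rightarrow> complex \<Rightarrow> bool" where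
  "zero_on_line A x y z t \<longleftrightarrow> eval3 A (t * x) (t * y) (t * z) = 0"

text \<open>The combination \<open>[:r:]\<close> of \<open>A\<close> and \<open>B\<close> does not
  involve the third coordinate, so infinitely many common zeros on a line project to infinitely many
  zeros of \<open>r\<close> on a line of slope \<open>y / x\<close>.\<close>

lemma finite_ratios_coprime:
  assumes "coprime A B"
  shows "\<exists>S. finite S \<and> (\<forall>x y z. x \<noteq> 0 \<longrightarrow>
    infinite {t. zero_on_line A x y z t \<and> zero_on_line B x y z t} \<longrightarrow> y / x \<in> S)"
proof -
  obtain u v r where r: "u * A + v * B = [:r:]" "r \<noteq> 0" using coprime_bezout_const[OF assms] by blast
  show ?thesis
  proof (intro exI conjI allI impI)
    show "finite {a. infinite {s. poly (poly r [:s * a:]) s = 0}}" using finite_slopes r(2) by blast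
    fix x y z :: complex
    assume x: "x \<noteq> 0" and inf: "infinite {t. zero_on_line A x y z t \<and> zero_on_line B x y z t}"
    have "(\<lambda>t. t * x) ` {t. zero_on_line A x y z t \<and> zero_on_line B x y z t}
        \<subseteq> {s. poly (poly r [:s * (y / x):]) s = 0}"
    proof (rule image_subsetI)
      fix t assume "t \<in> {t. zero_on_line A x y z t \<and> zero_on_line B x y z t}"
      hence t: "zero_on_line A x y z t" "zero_on_line B x y z t" by simp_all
      have "eval3 [:r:] (t * x) (t * y) (t * z) = 0"
        unfolding r(1)[symmetric] using t by (simp add: zero_on_line_def)
      thus "t * x \<in> {s. poly (poly r [:s * (y / x):]) s = 0}" using x by (simp add: eval3_def)
    qed
    moreover have "inj (\<lambda>t. t * x)" using x by (auto intro: injI)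
    hence "infinite ((\<lambda>t. t * x) ` {t. zero_on_line A x y z t \<and> zero_on_line B x y z t})"
      using inf by (meson finite_imageD inj_on_subset subset_UNIV)
    ultimately show "y / x \<in> {a. infinite {s. poly (poly r [:s * a:]) s = 0}}"
      using infinite_super by blast
  qed
qed

lemma zero_on_line_unit:
  assumes "is_unit A" shows "\<not> zero_on_line A x y z t"
proof -
  obtain K where "1 = A * K" using assms by blast
  hence "eval3 A (t * x) (t * y) (t * z) * eval3 K (t * x) (t * y) (t * z) = 1"
    by (metis eval3_simps(2,3))
  thus ?thesis by (auto simp: zero_on_line_def)
qed

text \<open>With \<open>A = G * A'\<close> and \<open>B = G * B'\<close>, a common zero of the three
  is a common zero of \<open>A'\<close> and \<open>B'\<close> or of \<open>G\<close> and
  \<open>C\<close>; both pairs are coprime.\<close>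

lemma finite_ratios_gcd:
  assumes "is_unit (gcd (gcd A B) C)"
  shows "\<exists>S. finite S \<and> (\<forall>x y z. x \<noteq> 0 \<longrightarrow>
    infinite {t. zero_on_line A x y z t \<and> zero_on_line B x y z t \<and> zero_on_line C x y z t} \<longrightarrow> y / x \<in> S)"
proof (cases "A = 0 \<and> B = 0")
  case True
  hence "is_unit C" using assms by simp
  thus ?thesis by (intro exI[of _ "{}"]) (simp add: zero_on_line_unit)
next
  case False
  define G where "G = gcd A B"
  have G: "coprime G C" using assms by (simp add: G_def coprime_iff_gcd_eq_1)
  obtain A' B' where A': "A = G * A'" "B = G * B'" "coprime A' B'"
  proof -
    have "G \<noteq> 0" using False by (simp add: G_def)
    then obtain a b where "A = a * G" "B = b * G" "coprime a b"
      using gcd_coprime_exists[of A B] unfolding G_def by blast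
    thus ?thesis using that[of a b] by (simp only: mult.commute)
  qed
  obtain S1 where S1: "finite S1" "\<And>x y z. x \<noteq> 0 \<Longrightarrow>
    infinite {t. zero_on_line A' x y z t \<and> zero_on_line B' x y z t} \<Longrightarrow> y / x \<in> S1"
    using finite_ratios_coprime[OF A'(3)] by blast
  obtain S2 where S2: "finite S2" "\<And>x y z. x \<noteq> 0 \<Longrightarrow>
    infinite {t. zero_on_line G x y z t \<and> zero_on_line C x y z t} \<Longrightarrow> y / x \<in> S2"
    using finite_ratios_coprime[OF G] by blast
  show ?thesis
  proof (intro exI[of _ "S1 \<union> S2"] conjI allI impI)
    show "finite (S1 \<union> S2)" using S1 S2 by simp
    fix x y z :: complex
    assume x: "x \<noteq> 0" and inf: "infinite {t. zero_on_line A x y z t \<and> zero_on_line B x y z t \<and> zero_on_line C x y z t}"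
    have "{t. zero_on_line A x y z t \<and> zero_on_line B x y z t \<and> zero_on_line C x y z t} \<subseteq>
        {t. zero_on_line A' x y z t \<and> zero_on_line B' x y z t} \<union> {t. zero_on_line G x y z t \<and> zero_on_line C x y z t}"
      by (auto simp: A' zero_on_line_def)
    hence "infinite {t. zero_on_line A' x y z t \<and> zero_on_line B' x y z t} \<or>
        infinite {t. zero_on_line G x y z t \<and> zero_on_line C x y z t}"
      using inf by (meson finite_UnI infinite_super)
    thus "y / x \<in> S1 \<union> S2" using S1(2)[OF x] S2(2)[OF x] by blast
  qed
qed

text \<open>The gcd of the components, read back as a polynomial in three variables, is a common
  factor and hence a unit by reducedness. A zero \<open>z\<close> of the homogeneous map gives a
  whole line of zeros, as \<open>finite_ratios_gcd\<close> requires.\<close>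

lemma reduced_finite_ratios:
  assumes "reduced H" "distinct [i, j, k]"
  shows "\<exists>S. finite S \<and> (\<forall>z. z $ i \<noteq> 0 \<longrightarrow> self_map H z = 0 \<longrightarrow> z $ j / z $ i \<in> S)"
proof -
  have "\<forall>l. \<exists>A. \<forall>z. eval3 A (z $ i) (z $ j) (z $ k) = poly3_eval (H $ l) z"
    using eval3_of_poly3[OF assms(2)] by blast
  then obtain A where A: "\<And>l z. eval3 (A l) (z $ i) (z $ j) (z $ k) = poly3_eval (H $ l) z" by metis
  define G where "G = gcd (gcd (A 1) (A 2)) (A 3)"
  have dvd: "G dvd A l" for l
  proof -
    have "G dvd A 1" "G dvd A 2" "G dvd A 3"
      unfolding G_def by (meson dvd_trans gcd_dvd1 gcd_dvd2)+
    thus ?thesis using exhaust_3[of l] by auto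
  qed
  then obtain B where B: "\<And>l. A l = G * B l" unfolding dvd_def by metis
  obtain g where g: "\<And>z. poly3_eval g z = eval3 G (z $ i) (z $ j) (z $ k)"
    using poly3_of_eval3[of G i j k] by blast
  obtain b where b: "\<And>l z. poly3_eval (b l) z = eval3 (B l) (z $ i) (z $ j) (z $ k)"
  proof -
    have "\<forall>l. \<exists>P. \<forall>z. poly3_eval P z = eval3 (B l) (z $ i) (z $ j) (z $ k)"
      using poly3_of_eval3 by blast
    thus ?thesis using that by metis
  qed
  have "H $ l = g * b l" for l
    by (rule poly3_eqI) (simp add: A[symmetric] B g b)
  hence "g dvd 1" using assms(1) unfolding reduced_def by (metis dvd_triv_left)
  then obtain q where q: "1 = g * q" by blast
  obtain K where K: "\<And>z. eval3 K (z $ i) (z $ j) (z $ k) = poly3_eval q z"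
    using eval3_of_poly3[OF assms(2)] by blast
  have "G * K - 1 = 0"
  proof (rule eval3_eq_0)
    fix x y w :: complex
    define z where "z = (\<chi> l. if l = i then x else if l = j then y else w)"
    have z: "z $ i = x" "z $ j = y" "z $ k = w" using assms(2) by (auto simp: z_def)
    have "eval3 G x y w * eval3 K x y w = 1"
      using g[of z] K[of z] q unfolding z by (metis poly3_eval_1 poly3_eval_mult)
    thus "eval3 (G * K - 1) x y w = 0" by simp
  qed
  hence "is_unit G" by (metis dvd_triv_left eq_iff_diff_eq_0)
  then obtain S where S: "finite S" "\<And>x y z. x \<noteq> 0 \<Longrightarrow>
    infinite {t. zero_on_line (A 1) x y z t \<and> zero_on_line (A 2) x y z t \<and> zero_on_line (A 3) x y z t} \<Longrightarrow> y / x \<in> S"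
    using finite_ratios_gcd[of "A 1" "A 2" "A 3"] unfolding G_def by blast
  obtain d where d: "\<forall>l. homogeneous d (H $ l)" using assms(1) unfolding reduced_def by blast
  show ?thesis
  proof (intro exI[of _ S] conjI allI impI S(1))
    fix z assume z: "z $ i \<noteq> 0" "self_map H z = 0"
    have "zero_on_line (A l) (z $ i) (z $ j) (z $ k) t" for l t
    proof -
      have "self_map H (t *s z) = 0" using z(2) by (simp add: self_map_smult[OF d])
      hence "poly3_eval (H $ l) (t *s z) = 0" by (simp add: self_map_def vec_eq_iff)
      thus ?thesis using A[of l "t *s z"] by (simp add: zero_on_line_def)
    qed
    hence "infinite {t. zero_on_line (A 1) (z $ i) (z $ j) (z $ k) t \<and>
        zero_on_line (A 2) (z $ i) (z $ j) (z $ k) t \<and> zero_on_line (A 3) (z $ i) (z $ j) (z $ k) t}"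
      by (simp add: infinite_UNIV_char_0)
    thus "z $ j / z $ i \<in> S" by (rule S(2)[OF z(1)])
  qed
qed

lemma reduced_finite_zeros:
  assumes "reduced H"
  shows "finite {p. self_map H (rep_cp2 p) = 0}"
proof -
  have "finite {p. self_map H (rep_cp2 p) = 0 \<and> rep_cp2 p $ i \<noteq> 0}" for i
  proof -
    obtain j k where d: "distinct [i, j, k]"
    proof -
      have "distinct [1,2,3::3]" "distinct [2,1,3::3]" "distinct [3,1,2::3]" by simp_all
      thus ?thesis using that exhaust_3[of i] by metis
    qed
    hence d': "distinct [i, k, j]" by auto
    obtain S where S: "finite S" "\<And>z. z $ i \<noteq> 0 \<Longrightarrow> self_map H z = 0 \<Longrightarrow> z $ j / z $ i \<in> S"
      using reduced_finite_ratios[OF assms d] by blast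
    obtain S' where S': "finite S'" "\<And>z. z $ i \<noteq> 0 \<Longrightarrow> self_map H z = 0 \<Longrightarrow> z $ k / z $ i \<in> S'"
      using reduced_finite_ratios[OF assms d'] by blast
    \<comment> \<open>The point is determined by its two coordinate ratios in the chart
      \<open>i\<close>, each confined to a finite set by one of the two orders of the remaining
      indices.\<close>
    define c where "c = (\<lambda>(a, b). proj (\<chi> l. if l = i then 1 else if l = j then a else b))"
    have "{p. self_map H (rep_cp2 p) = 0 \<and> rep_cp2 p $ i \<noteq> 0} \<subseteq> c ` (S \<times> S')"
    proof clarify
      fix p assume p: "self_map H (rep_cp2 p) = 0" "rep_cp2 p $ i \<noteq> 0"
      let ?z = "rep_cp2 p"
      have "(1 / ?z $ i) *s ?z = (\<chi> l. if l = i then 1 else if l = j then ?z $ j / ?z $ i else ?z $ k / ?z $ i)"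
        unfolding vec_eq_iff
      proof
        fix l
        have "l = i \<or> l = j \<or> l = k" using UNIV_3_distinct[OF d] by blast
        thus "((1 / ?z $ i) *s ?z) $ l = (\<chi> l. if l = i then 1 else if l = j then ?z $ j / ?z $ i else ?z $ k / ?z $ i) $ l"
          using d p(2) by auto
      qed
      hence cp: "c (?z $ j / ?z $ i, ?z $ k / ?z $ i) = p"
        unfolding c_def prod.case using proj_smult[of "1 / ?z $ i" ?z] p(2) by (simp add: proj_rep_cp2)
      have "(?z $ j / ?z $ i, ?z $ k / ?z $ i) \<in> S \<times> S'"
        using S(2)[OF p(2,1)] S'(2)[OF p(2,1)] by simp
      thus "p \<in> c ` (S \<times> S')" by (rule rev_image_eqI) (rule cp[symmetric])
    qed
    thus ?thesis using S(1) S'(1) by (meson finite_SigmaI finite_imageI finite_subset)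
  qed
  hence "finite (\<Union>i. {p. self_map H (rep_cp2 p) = 0 \<and> rep_cp2 p $ i \<noteq> 0})" by simp
  moreover have "{p. self_map H (rep_cp2 p) = 0} \<subseteq> (\<Union>i. {p. self_map H (rep_cp2 p) = 0 \<and> rep_cp2 p $ i \<noteq> 0})"
    using rep_cp2_nonzero by (auto simp: vec_eq_iff)
  ultimately show ?thesis using finite_subset by blast
qed

lemma rational_map_lift_of:
  assumes "rational_map f"
  shows "reduced (lift_of f)" "f = rational_map_of (lift_of f)"
proof -
  have "\<exists>F. reduced F \<and> f = rational_map_of F" using assms unfolding rational_map_def by blast
  from someI_ex[OF this] show "reduced (lift_of f)" "f = rational_map_of (lift_of f)"
    unfolding lift_of_def by blast+
qed

lemma rat_degree_homogeneous:
  assumes "rational_map f"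
  shows "\<forall>i. homogeneous (rat_degree f) (lift_of f $ i)"
proof -
  obtain d where d: "\<forall>i. homogeneous d (lift_of f $ i)"
    using rational_map_lift_of(1)[OF assms] unfolding reduced_def by blast
  obtain i where "lift_of f $ i \<noteq> 0" using reduced_nonzero rational_map_lift_of(1)[OF assms] by blast
  hence "d' = d" if "\<forall>i. homogeneous d' (lift_of f $ i)" for d'
    using that d homogeneous_unique by blast
  with d have "rat_degree f = d" unfolding rat_degree_def by (intro the_equality)
  with d show ?thesis by simp
qed

section \<open>Lifts of the iterates\<close>

locale stable_rational_map =
  fixes f :: "cp2 \<rightharpoonup> cp2" and F :: "poly3^3" and d :: nat
  assumes reduced_F: "reduced F" and f_eq: "f = rational_map_of F" and F_def: "F = lift_of f"
    and homogeneous_F: "\<forall>i. homogeneous d (F $ i)" and d_ge_2: "2 \<le> d"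
    and dom_f: "dominant f" and stable_f: "algebraically_stable f"
begin

definition E :: "nat \<Rightarrow> complex^3 \<Rightarrow> complex^3" where "E n = self_map F ^^ n"

lemma E_0 [simp]: "E 0 z = z" by (simp add: E_def)

lemma E_1: "E 1 = self_map F" by (simp add: E_def)

lemma E_add: "E (m + n) z = E m (E n z)" by (simp add: E_def funpow_add)

lemma E_poly: "\<exists>W. (\<forall>i. homogeneous (d ^ n) (W $ i)) \<and> self_map W = E n"
  unfolding E_def by (rule self_map_iterate[OF homogeneous_F])

lemma E_smult: "E n (t *s z) = t ^ (d ^ n) *s E n z"
  using E_poly[of n] self_map_smult by metis

lemma E_zero [simp]: "E n 0 = 0"
  using E_smult[of n 0 0] d_ge_2 by (simp add: power_0_left)

lemma E_proj: "z \<noteq> 0 \<Longrightarrow> \<exists>c. c \<noteq> 0 \<and> E n (rep_cp2 (proj z)) = c *s E n z"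
  by (metis E_smult power_not_zero rep_cp2_proj)

text \<open>Dominance is used here. If \<open>E n\<close> vanished on the image of \<open>F\<close>,
  its zero set would be Zariski closed and contain \<open>ran f\<close>, hence be the whole plane,
  and \<open>E n\<close> would vanish identically.\<close>

lemma E_not_zero: "\<exists>z. E n z \<noteq> 0"
proof (induction n)
  case 0
  have "E 0 (axis 1 1) \<noteq> 0" by (simp add: axis_eq_0_iff)
  thus ?case by blast
next
  case (Suc n)
  show ?case
  proof (rule ccontr)
    assume "\<not> ?thesis"
    hence *: "E n (self_map F z) = 0" for z
      using E_add[of n 1 z] by (simp add: E_1[simplified])
    obtain W where W: "\<forall>i. homogeneous (d ^ n) (W $ i)" "self_map W = E n" using E_poly by blast
    define C where "C = zero_locus {W $ i | i. True}"
    have C: "p \<in> C \<longleftrightarrow> E n (rep_cp2 p) = 0" for p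
      unfolding C_def W(2)[symmetric] by (auto simp: zero_locus_def self_map_def vec_eq_iff)
    have "zariski_closed C"
      unfolding C_def zariski_closed_def using W(1)
      by (intro exI[of _ "{W $ i | i. True}"] conjI) auto
    moreover have "ran f \<subseteq> C"
    proof
      fix q assume "q \<in> ran f"
      then obtain p where "f p = Some q" by (auto simp: ran_def)
      hence "self_map F (rep_cp2 p) \<noteq> 0" "q = proj (self_map F (rep_cp2 p))"
        by (auto simp: f_eq rational_map_of_def split: if_splits)
      thus "q \<in> C" unfolding C using E_proj[of "self_map F (rep_cp2 p)" n] * by auto
    qed
    ultimately have "C = UNIV" using dom_f unfolding dominant_def zariski_dense_def by blast
    hence 0: "E n (rep_cp2 p) = 0" for p using C by blast
    have "E n z = 0" for z
    proof (cases "z = 0")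
      case False
      thus ?thesis using E_proj[OF False, of n] 0 by (auto simp: smult_eq_0_iff)
    qed simp
    with Suc show False by blast
  qed
qed

definition H :: "nat \<Rightarrow> poly3^3" where "H n = iterate_lift F n"

lemma H_props:
  shows "reduced (H n)" "\<exists>h. h \<noteq> 0 \<and> (\<forall>z. E n z = poly3_eval h z *s self_map (H n) z)"
proof -
  obtain W where W: "\<forall>i. homogeneous (d ^ n) (W $ i)" "self_map W = E n" using E_poly by blast
  obtain z where "self_map W z \<noteq> 0" using E_not_zero W(2) by metis
  then obtain i where "poly3_eval (W $ i) z \<noteq> 0" by (auto simp: self_map_def vec_eq_iff)
  hence "W $ i \<noteq> 0" by auto
  then obtain K h where K: "reduced K" "h \<noteq> 0" "\<forall>i. W $ i = h * K $ i"
    using reduced_factorization[OF W(1)] by blast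
  have "(self_map F ^^ n) z = poly3_eval h z *s self_map K z" for z
    using K(3) W(2) unfolding E_def[symmetric] by (auto simp: self_map_def vec_eq_iff fun_eq_iff)
  hence "\<exists>H. reduced H \<and> (\<exists>h. h \<noteq> 0 \<and> (\<forall>z. (self_map F ^^ n) z = poly3_eval h z *s self_map H z))"
    using K by blast
  from someI_ex[OF this] show "reduced (H n)" "\<exists>h. h \<noteq> 0 \<and> (\<forall>z. E n z = poly3_eval h z *s self_map (H n) z)"
    unfolding H_def iterate_lift_def E_def by blast+
qed

lemma iterate_eq: "iterate f n = rational_map_of (H n)"
  by (simp add: iterate_def H_def F_def[symmetric])

text \<open>Algebraic stability is used here: it makes the factor \<open>h\<close> cancelled from
  \<open>E (Suc n)\<close> zero-free away from the origin. If \<open>h\<close> had another zero, the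
  curve \<open>h = 0\<close> would be a hypersurface on which \<open>F\<close> vanishes after
  \<open>E n\<close>, so that the \<open>n\<close>-th iterate would map it into
  \<open>indet f\<close>.\<close>

lemma E_zero_imp_H_zero:
  assumes "n \<ge> 1" "z \<noteq> 0" "E n z = 0"
  shows "self_map (H n) z = 0"
  using assms
proof (induction n arbitrary: z rule: nat_induct_at_least)
  case base
  obtain h where h: "\<And>z. E 1 z = poly3_eval h z *s self_map (H 1) z"
    using H_props(2) by blast
  have "F $ i = h * H 1 $ i" for i
    using h by (intro poly3_eqI) (simp add: E_1[simplified] self_map_def vec_eq_iff)
  hence "h dvd 1" using reduced_F unfolding reduced_def by (metis dvd_triv_left)
  then obtain k where "1 = h * k" by blast
  hence "poly3_eval h z * poly3_eval k z = 1" by (metis poly3_eval_1 poly3_eval_mult)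
  thus ?case using base h[of z] by (auto simp: smult_eq_0_iff)
next
  case (Suc n)
  obtain h where h: "h \<noteq> 0" "\<And>z. E (Suc n) z = poly3_eval h z *s self_map (H (Suc n)) z"
    using H_props(2) by blast
  obtain W where W: "\<forall>i. homogeneous (d ^ Suc n) (W $ i)" "self_map W = E (Suc n)" using E_poly by blast
  obtain i where i: "H (Suc n) $ i \<noteq> 0" using reduced_nonzero H_props(1) by blast
  have Wi: "W $ i = h * H (Suc n) $ i"
  proof (rule poly3_eqI)
    fix z
    have "self_map W z $ i = E (Suc n) z $ i" using W(2) by simp
    thus "poly3_eval (W $ i) z = poly3_eval (h * H (Suc n) $ i) z"
      unfolding h(2) by (simp add: self_map_def)
  qed
  hence "W $ i \<noteq> 0" using h(1) i by simp
  then obtain a where a: "homogeneous a h"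
    using factor_homogeneous[of "d ^ Suc n" h "H (Suc n) $ i"] W(1) Wi by metis
  have hz: "poly3_eval h w \<noteq> 0" if w: "w \<noteq> 0" for w
  proof
    assume 0: "poly3_eval h w = 0"
    have "a \<noteq> 0"
    proof
      assume "a = 0"
      then obtain k where "1 = h * k" using homogeneous_0_unit[of h] a h(1) by blast
      hence "poly3_eval h w * poly3_eval k w = 1" by (metis poly3_eval_1 poly3_eval_mult)
      thus False using 0 by simp
    qed
    hence "hypersurface (zero_locus {h})"
      unfolding hypersurface_def using a h(1) by (intro exI[of _ h] exI[of _ a]) auto
    \<comment> \<open>Where the iterate is defined, the induction hypothesis gives
      \<open>E n ?r \<noteq> 0\<close>, so \<open>E n ?r\<close> represents the image point
      \<open>q\<close>, and \<open>F\<close> vanishes on it.\<close>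
    moreover have "{q. \<exists>p\<in>zero_locus {h}. iterate f n p = Some q} \<subseteq> indet f"
    proof clarify
      fix p q assume p: "p \<in> zero_locus {h}" "iterate f n p = Some q"
      let ?r = "rep_cp2 p"
      have "poly3_eval h ?r = 0" using p(1) by (simp add: zero_locus_def)
      hence E0: "self_map F (E n ?r) = 0" using h(2)[of ?r] E_add[of 1 n ?r] by (simp add: E_1[simplified])
      have q: "self_map (H n) ?r \<noteq> 0" "q = proj (self_map (H n) ?r)"
        using p(2) by (auto simp: iterate_eq rational_map_of_def split: if_splits)
      obtain k where k: "E n ?r = poly3_eval k ?r *s self_map (H n) ?r" using H_props(2) by blast
      moreover have "E n ?r \<noteq> 0" using Suc.IH[OF rep_cp2_nonzero] q(1) by blast
      ultimately have "poly3_eval k ?r \<noteq> 0" by auto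
      hence "q = proj (E n ?r)" using k q(2) proj_smult by metis
      then obtain c where "rep_cp2 q = c *s E n ?r" using rep_cp2_proj \<open>E n ?r \<noteq> 0\<close> by metis
      hence "self_map F (rep_cp2 q) = 0" using E0 by (simp add: self_map_smult[OF homogeneous_F])
      thus "q \<in> indet f" by (simp add: indet_def f_eq rational_map_of_def domIff)
    qed
    ultimately show False using stable_f Suc.hyps unfolding algebraically_stable_def by blast
  qed
  show ?case using Suc.prems h(2)[of z] hz[of z] by (auto simp: smult_eq_0_iff)
qed

lemma iterate_proj:
  assumes "n \<ge> 1" "z \<noteq> 0"
  shows "iterate f n (proj z) = (if E n z = 0 then None else Some (proj (E n z)))"
proof -
  obtain e where e: "\<forall>i. homogeneous e (H n $ i)" using H_props(1) unfolding reduced_def by blast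
  obtain h where h: "E n z = poly3_eval h z *s self_map (H n) z" using H_props(2) by blast
  show ?thesis
  proof (cases "E n z = 0")
    case True
    thus ?thesis
      using E_zero_imp_H_zero[OF assms] by (simp add: iterate_eq rational_map_of_proj[OF e assms(2)])
  next
    case False
    hence "poly3_eval h z \<noteq> 0" "self_map (H n) z \<noteq> 0" using h by auto
    thus ?thesis using h False
      by (simp add: iterate_eq rational_map_of_proj[OF e assms(2)] proj_smult)
  qed
qed

lemma finite_indet: "finite (indet (iterate f n))"
proof -
  have "indet (iterate f n) = {p. self_map (H n) (rep_cp2 p) = 0}"
    by (auto simp: indet_def iterate_eq rational_map_of_def dom_def)
  thus ?thesis using reduced_finite_zeros[OF H_props(1)] by simp
qed

lemma indet_proj: "n \<ge> 1 \<Longrightarrow> z \<noteq> 0 \<Longrightarrow> proj z \<in> indet (iterate f n) \<longleftrightarrow> E n z = 0"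
  by (auto simp: indet_def dom_def iterate_proj)

lemma indet_mono: "1 \<le> m \<Longrightarrow> m \<le> n \<Longrightarrow> indet (iterate f m) \<subseteq> indet (iterate f n)"
proof
  fix p assume mn: "1 \<le> m" "m \<le> n" and p: "p \<in> indet (iterate f m)"
  hence "E m (rep_cp2 p) = 0" using indet_proj[of m "rep_cp2 p"] rep_cp2_nonzero by (simp add: proj_rep_cp2)
  hence "E n (rep_cp2 p) = 0" using mn E_add[of "n - m" m "rep_cp2 p"] by simp
  thus "p \<in> indet (iterate f n)"
    using mn indet_proj[of n "rep_cp2 p"] rep_cp2_nonzero by (simp add: proj_rep_cp2)
qed

end

lemma stable_rational_mapI:
  assumes "rational_map f" "dominant f" "algebraically_stable f" "2 \<le> rat_degree f"
  shows "stable_rational_map f (lift_of f) (rat_degree f)"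
  using assms rational_map_lift_of[OF assms(1)] rat_degree_homogeneous[OF assms(1)]
  by unfold_locales auto

section \<open>Topology and charts of the projective plane\<close>

lemma proj_surj: obtains z where "z \<noteq> 0" "p = proj z" "norm z = 1"
proof -
  let ?r = "rep_cp2 p"
  let ?z = "complex_of_real (inverse (norm ?r)) *s ?r"
  have "?r \<noteq> 0" by (rule rep_cp2_nonzero)
  hence "norm ?z = 1" by (simp add: norm_smult norm_inverse)
  moreover have "?z \<noteq> 0" using calculation by auto
  moreover have "proj ?z = p"
    using proj_smult[of "complex_of_real (inverse (norm ?r))" ?r] \<open>?r \<noteq> 0\<close> by (simp add: proj_rep_cp2)
  ultimately show ?thesis using that by metis
qed

lemma dist_proj:
  assumes "z \<noteq> 0" "w \<noteq> 0"
  shows "dist (proj z) (proj w) = fubini_study z w"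
proof -
  have "proj_rel (rep_cp2 (proj z)) z" if z: "z \<noteq> 0" for z
  proof -
    obtain c where "c \<noteq> 0" "rep_cp2 (proj z) = c *s z" using rep_cp2_proj[OF z] by blast
    thus ?thesis using z rep_cp2_nonzero unfolding proj_rel_def by blast
  qed
  thus ?thesis unfolding dist_cp2_def using fubini_study_cong assms by simp
qed

lemma tendsto_vec_nth_herm: "((\<lambda>z. herm z w) \<longlongrightarrow> herm z0 w) (at z0 within S)"
  unfolding herm_def by (intro tendsto_intros)

lemma continuous_on_proj: "continuous_on (- {0}) proj"
  unfolding continuous_on_def
proof
  fix z0 :: "complex^3" assume "z0 \<in> - {0}"
  hence z0: "z0 \<noteq> 0" by simp
  let ?f = "\<lambda>z. cmod (herm z z0) / (norm z * norm z0)"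
  have "(?f \<longlongrightarrow> cmod (herm z0 z0) / (norm z0 * norm z0)) (at z0 within - {0})"
    using z0 by (intro tendsto_intros tendsto_vec_nth_herm) auto
  moreover have "cmod (herm z0 z0) / (norm z0 * norm z0) = 1"
    using z0 by (simp add: herm_self power2_eq_square norm_mult)
  ultimately have lim: "(?f \<longlongrightarrow> 1) (at z0 within - {0})" by simp
  have "((\<lambda>z. arccos (?f z)) \<longlongrightarrow> arccos 1) (at z0 within - {0})"
  proof (rule continuous_on_tendsto_compose[OF continuous_on_arccos' lim])
    have "?f z \<in> {-1..1}" if "z \<noteq> 0" for z
      using that z0 herm_cauchy_schwarz[of z z0] by (simp add: divide_le_eq) (smt (verit) divide_nonneg_nonneg mult_nonneg_nonneg norm_ge_zero)
    thus "\<forall>\<^sub>F z in at z0 within - {0}. ?f z \<in> {-1..1}"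
      by (auto simp: eventually_at_filter)
  qed simp
  hence "((\<lambda>z. arccos (?f z)) \<longlongrightarrow> 0) (at z0 within - {0})" by simp
  hence "((\<lambda>z. dist (proj z) (proj z0)) \<longlongrightarrow> 0) (at z0 within - {0})"
    by (rule Lim_transform_eventually)
      (auto simp: eventually_at_filter dist_proj z0 fubini_study_def)
  thus "(proj \<longlongrightarrow> proj z0) (at z0 within - {0})" by (rule tendsto_dist_iff[THEN iffD2])
qed

text \<open>Openness of \<open>proj\<close> in quantitative form. The vector \<open>u\<close> is the
  orthogonal projection of \<open>z0\<close> onto the line of \<open>q\<close>; its distance to
  \<open>z0\<close> is \<open>norm z0\<close> times the sine of the Fubini-Study distance, hence at
  most \<open>norm z0\<close> times that distance.\<close>

lemma lift_near:
  assumes "z0 \<noteq> 0" "\<eta> > 0"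
  shows "\<exists>\<delta>>0. \<forall>q. dist q (proj z0) < \<delta> \<longrightarrow> (\<exists>u. norm (u - z0) < \<eta> \<and> u \<noteq> 0 \<and> proj u = q)"
proof -
  \<comment> \<open>The minimum with \<open>norm z0\<close> keeps \<open>u\<close> from being
    zero.\<close>
  define e where "e = min \<eta> (norm z0) / norm z0"
  have e: "e > 0" "e * norm z0 \<le> \<eta>" "e * norm z0 \<le> norm z0"
    using assms by (auto simp: e_def)
  show ?thesis
  proof (intro exI[of _ e] conjI allI impI e(1))
    fix q assume q: "dist q (proj z0) < e"
    obtain w where w: "w \<noteq> 0" "q = proj w" "norm w = 1" using proj_surj by blast
    define x where "x = complex_of_real (inverse (norm z0)) *s z0"
    have x: "norm x = 1" using assms(1) by (simp add: x_def norm_smult norm_inverse)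
    have z0x: "z0 = complex_of_real (norm z0) *s x"
      using assms(1) by (simp add: x_def flip: of_real_mult)
    define u where "u = complex_of_real (norm z0) *s (herm x w *s w)"
    have "dist q (proj z0) = arccos (cmod (herm x w))"
      using assms(1) w
      by (subst dist_commute) (simp add: dist_proj fubini_study_def x_def herm_smult_left norm_mult norm_inverse divide_inverse mult.commute)
    with q have t: "arccos (cmod (herm x w)) < e" by simp
    have c1: "cmod (herm x w) \<le> 1" using herm_cauchy_schwarz[of x w] x w by simp
    have "norm (x - herm x w *s w) = sqrt (1 - (cmod (herm x w))\<^sup>2)"
      using norm_orth_part[OF x w(3)] by (metis norm_ge_zero real_sqrt_unique)
    also have "\<dots> = sin (arccos (cmod (herm x w)))"
      using c1 by (subst sin_arccos) (auto intro: order_trans[OF _ norm_ge_zero])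
    also have "\<dots> \<le> arccos (cmod (herm x w))"
      using c1 by (intro sin_x_le_x arccos_lbound) (auto intro: order_trans[OF _ norm_ge_zero])
    finally have n: "norm (x - herm x w *s w) < e" using t by simp
    have "u - z0 = complex_of_real (norm z0) *s (herm x w *s w - x)"
      unfolding u_def by (subst (2) z0x) (simp add: vec_eq_iff algebra_simps)
    hence "norm (u - z0) = norm z0 * norm (herm x w *s w - x)"
      by (simp only: norm_smult) simp
    also have "norm (herm x w *s w - x) = norm (x - herm x w *s w)" by (rule norm_minus_commute)
    finally have un: "norm (u - z0) < e * norm z0"
      using n assms(1) by (simp add: mult.commute)
    moreover have u0: "u \<noteq> 0" using un e(3) by auto
    moreover have "proj u = q"
    proof -
      have "u = (complex_of_real (norm z0) * herm x w) *s w" by (simp add: u_def vec_eq_iff)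
      thus ?thesis using u0 w(2) proj_smult by (metis smult_eq_0_iff)
    qed
    ultimately show "\<exists>u. norm (u - z0) < \<eta> \<and> u \<noteq> 0 \<and> proj u = q"
      using e(2) by (intro exI[of _ u]) auto
  qed
qed

lemma compact_UNIV_cp2: "compact (UNIV :: cp2 set)"
proof -
  have "compact (proj ` sphere 0 1)"
    by (rule compact_continuous_image) (auto intro: continuous_on_subset[OF continuous_on_proj])
  moreover have "proj ` sphere 0 1 = UNIV"
    by (metis (mono_tags, lifting) UNIV_eq_I image_eqI mem_sphere_0 proj_surj)
  ultimately show ?thesis by simp
qed

lemma open_cone: "open V \<Longrightarrow> open {z. z \<noteq> 0 \<and> proj z \<in> V}"
  using continuous_open_preimage[OF continuous_on_proj _ , of V]
  by (simp add: vimage_def Int_def open_Compl)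

lemma isCont_from_cone:
  fixes h :: "cp2 \<Rightarrow> 'a::metric_space"
  assumes "z0 \<noteq> 0" "isCont (\<lambda>z. h (proj z)) z0"
  shows "isCont h (proj z0)"
  unfolding continuous_at_eps_delta
proof (intro allI impI)
  fix e :: real assume "e > 0"
  then obtain \<eta> where \<eta>: "\<eta> > 0" "\<And>z. dist z z0 < \<eta> \<Longrightarrow> dist (h (proj z)) (h (proj z0)) < e"
    using assms(2) unfolding continuous_at_eps_delta by blast
  obtain \<delta> where "\<delta> > 0" "\<And>q. dist q (proj z0) < \<delta> \<Longrightarrow> \<exists>u. norm (u - z0) < \<eta> \<and> u \<noteq> 0 \<and> proj u = q"
    using lift_near[OF assms(1) \<eta>(1)] by blast
  thus "\<exists>d>0. \<forall>x'. dist x' (proj z0) < d \<longrightarrow> dist (h x') (h (proj z0)) < e"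
    using \<eta>(2) by (metis dist_norm)
qed

section \<open>Affine charts\<close>

definition chart :: "3 \<Rightarrow> cp2 set" where "chart i = {q. rep_cp2 q $ i \<noteq> 0}"

text \<open>The affine coordinates are kept as a vector with \<open>i\<close>-th entry
  \<open>1\<close>, so all charts share one type. Outside the chart the division by \<open>0\<close>
  gives the zero vector.\<close>

definition affine :: "3 \<Rightarrow> cp2 \<Rightarrow> complex^3" where
  "affine i q = (1 / rep_cp2 q $ i) *s rep_cp2 q"

lemma chart_proj: "z \<noteq> 0 \<Longrightarrow> proj z \<in> chart i \<longleftrightarrow> z $ i \<noteq> 0"
proof -
  assume "z \<noteq> 0"
  then obtain c where "c \<noteq> 0" "rep_cp2 (proj z) = c *s z" using rep_cp2_proj by blast
  thus ?thesis by (simp add: chart_def)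
qed

lemma affine_proj: "z \<noteq> 0 \<Longrightarrow> affine i (proj z) = (1 / z $ i) *s z"
proof -
  assume "z \<noteq> 0"
  then obtain c where "c \<noteq> 0" "rep_cp2 (proj z) = c *s z" using rep_cp2_proj by blast
  thus ?thesis by (simp add: affine_def vec_eq_iff)
qed

lemma affine_nth: "q \<in> chart i \<Longrightarrow> affine i q $ i = 1"
  by (simp add: affine_def chart_def)

lemma affine_nonzero: "q \<in> chart i \<Longrightarrow> affine i q \<noteq> 0"
  using affine_nth[of q i] by auto

lemma proj_affine: "q \<in> chart i \<Longrightarrow> proj (affine i q) = q"
  by (simp add: affine_def chart_def proj_smult proj_rep_cp2)

lemma in_some_chart: "\<exists>i. q \<in> chart i"
  using rep_cp2_nonzero[of q] by (auto simp: chart_def vec_eq_iff)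

lemma open_chart: "open (chart i)"
  unfolding open_contains_ball
proof (rule ballI)
  fix q assume q: "q \<in> chart i"
  let ?r = "rep_cp2 q"
  have "cmod (?r $ i) > 0" using q by (simp add: chart_def)
  then obtain \<delta> where \<delta>: "\<delta> > 0"
    "\<And>p. dist p (proj ?r) < \<delta> \<Longrightarrow> \<exists>u. norm (u - ?r) < cmod (?r $ i) \<and> u \<noteq> 0 \<and> proj u = p"
    using lift_near[OF rep_cp2_nonzero] by blast
  have "p \<in> chart i" if p: "p \<in> ball q \<delta>" for p
  proof -
    obtain u where u: "norm (u - ?r) < cmod (?r $ i)" "u \<noteq> 0" "proj u = p"
      using \<delta>(2)[of p] p by (auto simp: proj_rep_cp2 dist_commute)
    have "cmod ((u - ?r) $ i) \<le> norm (u - ?r)" by (rule Finite_Cartesian_Product.norm_nth_le)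
    hence "u $ i \<noteq> 0" using u(1) by auto
    thus ?thesis using chart_proj u by blast
  qed
  thus "\<exists>e>0. ball q e \<subseteq> chart i" using \<delta>(1) by blast
qed

lemma isCont_smult_inverse:
  assumes "z0 $ i \<noteq> (0::complex)"
  shows "isCont (\<lambda>z::complex^3. (1 / z $ i) *s z) z0"
  unfolding isCont_def
  by (rule vec_tendstoI) (use assms in \<open>auto intro!: tendsto_intros\<close>)

lemma continuous_on_affine: "continuous_on (chart i) (affine i)"
proof (rule continuous_at_imp_continuous_on, rule ballI)
  fix q assume q: "q \<in> chart i"
  let ?r = "rep_cp2 q"
  have r: "?r \<noteq> 0" "?r $ i \<noteq> 0" using rep_cp2_nonzero q by (auto simp: chart_def)
  have "isCont (\<lambda>z. affine i (proj z)) ?r"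
  proof (rule isCont_cong[THEN iffD2])
    show "\<forall>\<^sub>F z in nhds ?r. affine i (proj z) = (1 / z $ i) *s z"
      using t1_space_nhds[OF r(1)] by eventually_elim (rule affine_proj)
  qed (rule isCont_smult_inverse[OF r(2)])
  thus "isCont (affine i) q" using isCont_from_cone[OF r(1)] by (simp add: proj_rep_cp2)
qed

text \<open>Uniform continuity in which only one of the two points has to lie in the compact set:
  later \<open>x\<close> is a value of the limit and \<open>y\<close> a nearby value of an iterate.
  Counterexamples at distance below \<open>1 / Suc n\<close> would accumulate at a point of
  \<open>K\<close>.\<close>

lemma compact_uniform_nbhd:
  fixes \<phi> :: "'a::metric_space \<Rightarrow> 'b::metric_space"
  assumes "compact K" "K \<subseteq> W" "open W" "continuous_on W \<phi>" "e > 0"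
  shows "\<exists>\<delta>>0. \<forall>x\<in>K. \<forall>y. dist x y < \<delta> \<longrightarrow> y \<in> W \<and> dist (\<phi> x) (\<phi> y) < e"
proof (rule ccontr)
  assume neg: "\<not> ?thesis"
  have "\<forall>n. \<exists>x y. x \<in> K \<and> dist x y < 1 / Suc n \<and> \<not> (y \<in> W \<and> dist (\<phi> x) (\<phi> y) < e)"
  proof (intro allI)
    fix n :: nat
    have "1 / real (Suc n) > 0" by simp
    with neg show "\<exists>x y. x \<in> K \<and> dist x y < 1 / Suc n \<and> \<not> (y \<in> W \<and> dist (\<phi> x) (\<phi> y) < e)"
      by blast
  qed
  then obtain x y where xy: "\<And>n. x n \<in> K" "\<And>n. dist (x n) (y n) < 1 / Suc n"
    "\<And>n. \<not> (y n \<in> W \<and> dist (\<phi> (x n)) (\<phi> (y n)) < e)" by metis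
  obtain l r where l: "l \<in> K" "strict_mono r" "(x \<circ> r) \<longlonglongrightarrow> l"
    using assms(1) xy(1) unfolding compact_def by metis
  have "(\<lambda>n. dist (x (r n)) (y (r n))) \<longlonglongrightarrow> 0"
  proof (rule tendsto_sandwich[OF _ _ tendsto_const])
    show "\<forall>\<^sub>F n in sequentially. dist (x (r n)) (y (r n)) \<le> 1 / Suc (r n)"
      using xy(2) by (auto intro!: always_eventually less_imp_le)
    show "(\<lambda>n. 1 / real (Suc (r n))) \<longlonglongrightarrow> 0"
      using LIMSEQ_subseq_LIMSEQ[OF LIMSEQ_Suc[OF lim_1_over_n] l(2)] by (simp add: o_def)
  qed simp
  hence "(y \<circ> r) \<longlonglongrightarrow> l"
    using l(3) unfolding tendsto_dist_iff[where l = l] o_def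
  proof -
    assume a: "(\<lambda>n. dist (x (r n)) (y (r n))) \<longlonglongrightarrow> 0" "(\<lambda>xa. dist (x (r xa)) l) \<longlonglongrightarrow> 0"
    show "(\<lambda>xa. dist (y (r xa)) l) \<longlonglongrightarrow> 0"
    proof (rule tendsto_sandwich[OF _ _ tendsto_const])
      show "(\<lambda>n. dist (x (r n)) (y (r n)) + dist (x (r n)) l) \<longlonglongrightarrow> 0"
        using tendsto_add[OF a] by simp
      show "\<forall>\<^sub>F n in sequentially. dist (y (r n)) l \<le> dist (x (r n)) (y (r n)) + dist (x (r n)) l"
        by (intro always_eventually allI) (metis dist_commute dist_triangle)
    qed simp
  qed
  have lW: "l \<in> W" using l(1) assms(2) by blast
  have c: "isCont \<phi> l" using assms(3,4) lW by (simp add: continuous_on_eq_continuous_at)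
  have "(\<lambda>n. \<phi> (x (r n))) \<longlonglongrightarrow> \<phi> l" "(\<lambda>n. \<phi> (y (r n))) \<longlonglongrightarrow> \<phi> l"
    using isCont_tendsto_compose[OF c] l(3) \<open>(y \<circ> r) \<longlonglongrightarrow> l\<close> by (auto simp: o_def)
  hence "(\<lambda>n. dist (\<phi> (x (r n))) (\<phi> (y (r n)))) \<longlonglongrightarrow> dist (\<phi> l) (\<phi> l)" by (rule tendsto_dist)
  hence "\<forall>\<^sub>F n in sequentially. dist (\<phi> (x (r n))) (\<phi> (y (r n))) < e"
    using assms(5) by (auto dest: order_tendstoD(2))
  moreover have "\<forall>\<^sub>F n in sequentially. y (r n) \<in> W"
    using topological_tendstoD[OF \<open>(y \<circ> r) \<longlonglongrightarrow> l\<close> assms(3) lW] by (simp add: o_def)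
  ultimately have "\<forall>\<^sub>F n in sequentially. False"
    by eventually_elim (use xy(3) in blast)
  thus False by simp
qed

section \<open>Winding numbers\<close>

text \<open>The curve \<open>h\<close> on the circle of radius \<open>\<rho>\<close> has winding number \<open>N\<close> around \<open>0\<close>. In this form it
  is invariant under multiplication by functions with a continuous logarithm.\<close>

definition wind :: "real \<Rightarrow> (complex \<Rightarrow> complex) \<Rightarrow> nat \<Rightarrow> bool" where
  "wind \<rho> h N \<longleftrightarrow> (\<exists>L. continuous_on (sphere 0 \<rho>) L \<and> (\<forall>x\<in>sphere 0 \<rho>. h x = x ^ N * exp (L x)))"

text \<open>The values of \<open>f\<close> lie in the discrete set of integer multiples of
  \<open>2 * pi * \<i>\<close>.\<close>

lemma exp_eq_1_constant:
  fixes f :: "'a::topological_space \<Rightarrow> complex"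
  assumes "connected S" "continuous_on S f" "\<And>x. x \<in> S \<Longrightarrow> exp (f x) = 1"
  shows "f constant_on S"
proof (rule continuous_discrete_range_constant[OF assms(1,2)])
  fix x assume x: "x \<in> S"
  show "\<exists>e>0. \<forall>y. y \<in> S \<and> f y \<noteq> f x \<longrightarrow> e \<le> cmod (f y - f x)"
  proof (intro exI[of _ "2 * pi"] conjI allI impI)
    fix y assume y: "y \<in> S \<and> f y \<noteq> f x"
    have "exp (f y) = exp (f x)" using assms(3) x y by simp
    then obtain n :: int where n: "f y = f x + of_real (2 * of_int n * pi) * \<i>"
      by (auto simp: exp_eq)
    have "n \<noteq> 0" using y n by auto
    hence "1 \<le> \<bar>real_of_int n\<bar>" by linarith
    hence "2 * pi * 1 \<le> 2 * pi * \<bar>real_of_int n\<bar>" by (intro mult_left_mono) auto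
    also have "\<dots> = cmod (f y - f x)" by (simp add: n norm_mult abs_mult)
    finally show "2 * pi \<le> cmod (f y - f x)" by simp
  qed simp
qed

text \<open>If both \<open>N\<close> and a larger \<open>M\<close> occur, then
  \<open>x ^ (M - N)\<close> has a continuous logarithm on the circle; following it once around
  changes it by \<open>2 * pi * \<i> * (M - N)\<close>, which must be zero.\<close>

lemma wind_unique:
  assumes "\<rho> > 0" "wind \<rho> h N" "wind \<rho> h M"
  shows "N = M"
proof -
  have *: "M = N" if "wind \<rho> h N" "wind \<rho> h M" "N \<le> M" for N M
  proof -
    obtain L where L: "continuous_on (sphere 0 \<rho>) L" "\<And>x. x \<in> sphere 0 \<rho> \<Longrightarrow> h x = x ^ N * exp (L x)"
      using \<open>wind \<rho> h N\<close> unfolding wind_def by blast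
    obtain L' where L': "continuous_on (sphere 0 \<rho>) L'" "\<And>x. x \<in> sphere 0 \<rho> \<Longrightarrow> h x = x ^ M * exp (L' x)"
      using \<open>wind \<rho> h M\<close> unfolding wind_def by blast
    define k where "k = M - N"
    define c where "c = (\<lambda>t. complex_of_real \<rho> * cis t)"
    have c: "c t \<in> sphere 0 \<rho>" for t using assms(1) by (simp add: c_def norm_mult)
    have e: "exp (L (c t) - L' (c t)) = c t ^ k" for t
    proof -
      have "c t \<noteq> 0" using c[of t] assms(1) by auto
      have "c t ^ N * exp (L (c t)) = c t ^ N * c t ^ k * exp (L' (c t))"
        using L(2)[OF c] L'(2)[OF c, of t] that(3) by (simp add: k_def flip: power_add)
      hence "exp (L (c t)) = c t ^ k * exp (L' (c t))" using \<open>c t \<noteq> 0\<close> by simp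
      thus ?thesis by (simp add: exp_diff)
    qed
    \<comment> \<open>The subtracted term is a logarithm of \<open>c t ^ k\<close> along the
      parametrized circle, so \<open>exp (\<phi> t) = 1\<close> and \<open>\<phi>\<close> is
      constant. As \<open>c\<close> closes up after \<open>2 * pi\<close>, only the term with
      \<open>t\<close> survives the comparison of the two ends.\<close>
    define \<phi> where "\<phi> t = L (c t) - L' (c t) - (of_nat k * of_real (ln \<rho>) + \<i> * of_nat k * of_real t)" for t
    have "exp (\<phi> t) = 1" for t
    proof -
      have "exp (of_nat k * of_real (ln \<rho>) + \<i> * of_nat k * of_real t) = c t ^ k"
      proof -
        have "exp (of_nat k * of_real (ln \<rho>) + \<i> * of_nat k * of_real t) =
            exp (of_nat k * complex_of_real (ln \<rho>)) * exp (of_nat k * (\<i> * of_real t))"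
          by (simp add: exp_add mult_ac)
        also have "\<dots> = exp (complex_of_real (ln \<rho>)) ^ k * exp (\<i> * of_real t) ^ k"
          by (simp only: exp_of_nat_mult)
        also have "exp (complex_of_real (ln \<rho>)) = of_real \<rho>"
          using assms(1) by (simp add: exp_of_real)
        finally show ?thesis by (simp add: c_def cis_conv_exp power_mult_distrib)
      qed
      moreover have "c t \<noteq> 0" using c[of t] assms(1) by auto
      ultimately show ?thesis using e[of t] by (simp add: \<phi>_def exp_diff)
    qed
    moreover have "continuous_on {0..2*pi} \<phi>"
      unfolding \<phi>_def using c
      by (intro continuous_intros continuous_on_compose2[OF L(1)] continuous_on_compose2[OF L'(1)])
        (auto simp: c_def intro!: continuous_intros)
    ultimately have "\<phi> constant_on {0..2*pi}" by (intro exp_eq_1_constant) auto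
    hence "\<phi> 0 = \<phi> (2 * pi)" unfolding constant_on_def by (metis atLeastAtMost_iff order_refl pi_ge_zero zero_le_mult_iff zero_le_numeral)
    hence "k = 0" by (simp add: \<phi>_def c_def)
    thus "M = N" using that(3) by (simp add: k_def)
  qed
  show ?thesis using * assms(2,3) nat_le_linear by metis
qed

lemma wind_mult_exp:
  assumes "wind \<rho> h N" "continuous_on (sphere 0 \<rho>) g" "\<And>x. x \<in> sphere 0 \<rho> \<Longrightarrow> h' x = h x * exp (g x)"
  shows "wind \<rho> h' N"
proof -
  obtain L where "continuous_on (sphere 0 \<rho>) L" "\<And>x. x \<in> sphere 0 \<rho> \<Longrightarrow> h x = x ^ N * exp (L x)"
    using assms(1) unfolding wind_def by blast
  thus ?thesis unfolding wind_def using assms(2,3)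
    by (intro exI[of _ "\<lambda>x. L x + g x"]) (auto intro!: continuous_intros simp: exp_add)
qed

text \<open>A form of Rouche's theorem: a factor within distance \<open>1\<close> of
  \<open>1\<close> avoids the slit of the principal logarithm.\<close>

lemma wind_mult_near_1:
  assumes "wind \<rho> h N" "continuous_on (sphere 0 \<rho>) c" "\<And>x. x \<in> sphere 0 \<rho> \<Longrightarrow> h' x = h x * c x"
    "\<And>x. x \<in> sphere 0 \<rho> \<Longrightarrow> cmod (c x - 1) < 1"
  shows "wind \<rho> h' N"
proof -
  have c: "c x \<notin> \<real>\<^sub>\<le>\<^sub>0" if "x \<in> sphere 0 \<rho>" for x
  proof
    assume "c x \<in> \<real>\<^sub>\<le>\<^sub>0"
    hence "Re (c x) \<le> 0" by (auto simp: complex_nonpos_Reals_iff)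
    moreover have "\<bar>Re (c x - 1)\<bar> < 1" using assms(4)[OF that] abs_Re_le_cmod[of "c x - 1"] by linarith
    ultimately show False by simp
  qed
  hence "c x \<noteq> 0" if "x \<in> sphere 0 \<rho>" for x using that by force
  thus ?thesis
    using assms(2,3) c
    by (intro wind_mult_exp[OF assms(1), of "\<lambda>x. Ln (c x)"]) (auto intro!: continuous_intros)
qed

lemma wind_const_if_disc:
  assumes "continuous_on (cball 0 \<rho>) h" "\<And>x. x \<in> cball 0 \<rho> \<Longrightarrow> h x \<noteq> 0"
  shows "wind \<rho> h 0"
proof -
  obtain g where "continuous_on (cball 0 \<rho>) g" "\<And>x. x \<in> cball 0 \<rho> \<Longrightarrow> h x = exp (g x)"
    using continuous_logarithm_on_cball[OF assms] by blast
  thus ?thesis unfolding wind_def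
    by (intro exI[of _ g]) (auto intro: continuous_on_subset)
qed

text \<open>Moving \<open>y\<close> along the segment from \<open>y1\<close> to \<open>y0\<close>
  deforms the quotient of the two functions to the constant \<open>1\<close> within the nonzero
  numbers, so the quotient has a continuous logarithm.\<close>

lemma wind_homotopic:
  fixes K :: "complex \<Rightarrow> 'a::real_normed_vector \<Rightarrow> complex"
  assumes "continuous_on (sphere 0 \<rho> \<times> Y) (\<lambda>(x, y). K x y)" "convex Y" "y0 \<in> Y" "y1 \<in> Y"
    "\<And>x y. x \<in> sphere 0 \<rho> \<Longrightarrow> y \<in> Y \<Longrightarrow> K x y \<noteq> 0"
    "wind \<rho> (\<lambda>x. K x y0) N"
  shows "wind \<rho> (\<lambda>x. K x y1) N"
proof -
  define l where "l t = (1 - t) *\<^sub>R y0 + t *\<^sub>R y1" for t :: real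
  have l: "l t \<in> Y" if "t \<in> {0..1}" for t
    unfolding l_def using assms(2-4) that by (auto simp: convex_alt)
  have cK: "continuous_on ({0..1} \<times> sphere 0 \<rho>) (\<lambda>z. K (snd z) (l (1 - fst z)))"
  proof -
    have "continuous_on ({0..1} \<times> sphere 0 \<rho>) (\<lambda>z. (\<lambda>(x, y). K x y) (snd z, l (1 - fst z)))"
    proof (rule continuous_on_compose2[OF assms(1)])
      show "continuous_on ({0..1} \<times> sphere 0 \<rho>) (\<lambda>z. (snd z, l (1 - fst z)))"
        unfolding l_def by (intro continuous_intros)
      show "(\<lambda>z. (snd z, l (1 - fst z))) ` ({0..1} \<times> sphere 0 \<rho>) \<subseteq> sphere 0 \<rho> \<times> Y"
        using l by auto
    qed
    thus ?thesis by simp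
  qed
  have c0: "continuous_on ({0..1::real} \<times> sphere 0 \<rho>) (\<lambda>z. K (snd z) y0)"
  proof -
    have "continuous_on ({0..1::real} \<times> sphere 0 \<rho>) (\<lambda>z. (\<lambda>(x, y). K x y) (snd z, y0))"
      by (rule continuous_on_compose2[OF assms(1)]) (use assms(3) in \<open>auto intro!: continuous_intros\<close>)
    thus ?thesis by simp
  qed
  let ?h = "\<lambda>z. K (snd z) (l (1 - fst z)) / K (snd z) y0"
  have "continuous_on ({0..1} \<times> sphere 0 \<rho>) ?h"
    using assms(3,5) by (intro continuous_on_divide cK c0) auto
  moreover have "?h \<in> {0..1} \<times> sphere 0 \<rho> \<rightarrow> - {0}"
    using assms(3,5) l by auto
  ultimately have cm: "continuous_map (prod_topology (top_of_set {0..1}) (top_of_set (sphere 0 \<rho>)))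
      (top_of_set (- {0})) ?h"
    by (simp only: prod_topology_subtopology_eu continuous_map_subtopology_eu)
  have "homotopic_with_canon (\<lambda>h. True) (sphere 0 \<rho>) (- {0}) (\<lambda>x. K x y1 / K x y0) (\<lambda>x. 1)"
  proof (subst homotopic_with, simp, intro exI[of _ ?h] conjI cm ballI)
    fix x assume "x \<in> topspace (top_of_set (sphere (0::complex) \<rho>))"
    hence "K x y0 \<noteq> 0" using assms(3,5) by simp
    thus "K (snd (0::real, x)) (l (1 - fst (0::real, x))) / K (snd (0::real, x)) y0 = K x y1 / K x y0"
      "K (snd (1::real, x)) (l (1 - fst (1::real, x))) / K (snd (1::real, x)) y0 = 1"
      by (simp_all add: l_def)
  qed simp_all
  then obtain g where g: "continuous_on (sphere 0 \<rho>) g" "\<And>x. x \<in> sphere 0 \<rho> \<Longrightarrow> K x y1 / K x y0 = exp (g x)"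
    using inessential_eq_continuous_logarithm[of "sphere 0 \<rho>" "\<lambda>x. K x y1 / K x y0"] by auto
  have eq: "K x y1 = K x y0 * exp (g x)" if "x \<in> sphere 0 \<rho>" for x
    using g(2)[OF that] assms(3,5) that by (simp add: field_simps)
  show ?thesis by (rule wind_mult_exp[OF assms(6) g(1)]) (rule eq)
qed

text \<open>The zeros in the disc are split off one at a time into the monic factor
  \<open>m\<close>. Each raises the winding number by one, which is the argument principle, and
  contributes a factor of modulus at most \<open>2 * \<rho>\<close> on the disc.\<close>

lemma poly_zero_factor:
  fixes p :: "complex poly"
  assumes "\<rho> > 0" "\<And>x. x \<in> sphere 0 \<rho> \<Longrightarrow> poly p x \<noteq> 0"
  shows "\<exists>m u. p = m * u \<and> lead_coeff m = 1 \<and> (\<forall>x\<in>cball 0 \<rho>. poly u x \<noteq> 0) \<and>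
    wind \<rho> (poly p) (degree m) \<and> (\<forall>x\<in>cball 0 \<rho>. cmod (poly m x) \<le> (2 * \<rho>) ^ degree m)"
  using assms(2)
proof (induction "degree p" arbitrary: p rule: less_induct)
  case less
  show ?case
  proof (cases "\<exists>a\<in>cball 0 \<rho>. poly p a = 0")
    case False
    have "continuous_on (cball 0 \<rho>) (poly p)" by (intro continuous_intros)
    hence "wind \<rho> (poly p) 0" using False by (intro wind_const_if_disc) auto
    with False show ?thesis by (intro exI[of _ 1] exI[of _ p]) auto
  next
    case True
    then obtain a where a: "cmod a \<le> \<rho>" "poly p a = 0" by auto
    hence "cmod a < \<rho>" using less.prems[of a] by (cases "cmod a = \<rho>") auto
    obtain q where q: "p = [:-a, 1:] * q" using a(2) by (metis dvdE poly_eq_0_iff_dvd)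
    have "p \<noteq> 0" using less.prems[of "of_real \<rho>"] assms(1) by auto
    hence "q \<noteq> 0" using q by auto
    hence "degree q < degree p" unfolding q by (subst degree_mult_eq) auto
    moreover have "poly q x \<noteq> 0" if "x \<in> sphere 0 \<rho>" for x
      using less.prems[OF that] q by auto
    ultimately obtain m u where m: "q = m * u" "lead_coeff m = 1" "\<forall>x\<in>cball 0 \<rho>. poly u x \<noteq> 0"
      "wind \<rho> (poly q) (degree m)" "\<forall>x\<in>cball 0 \<rho>. cmod (poly m x) \<le> (2 * \<rho>) ^ degree m"
      using less.hyps[of q] by blast
    have "m \<noteq> 0" using m(2) by auto
    hence deg: "degree ([:-a, 1:] * m) = Suc (degree m)" by (subst degree_mult_eq) auto
    \<comment> \<open>The linear factor \<open>x - a\<close> is compared with \<open>x\<close>: the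
      quotient \<open>1 - a / x\<close> lies within distance \<open>1\<close> of \<open>1\<close> on
      the circle because \<open>a\<close> is inside.\<close>
    have "wind \<rho> (\<lambda>x. x * poly q x) (Suc (degree m))"
      using m(4) unfolding wind_def by (auto simp: mult_ac)
    hence "wind \<rho> (poly p) (Suc (degree m))"
    proof (rule wind_mult_near_1)
      show "continuous_on (sphere 0 \<rho>) (\<lambda>x. 1 - a / x)" using assms(1) by (auto intro!: continuous_intros)
      fix x :: complex assume x: "x \<in> sphere 0 \<rho>"
      hence "x \<noteq> 0" using assms(1) by auto
      thus "poly p x = x * poly q x * (1 - a / x)" by (simp add: q field_simps)
      show "cmod (1 - a / x - 1) < 1" using x \<open>cmod a < \<rho>\<close> assms(1) by (simp add: norm_divide)
    qed
    moreover have "cmod (poly ([:-a, 1:] * m) x) \<le> (2 * \<rho>) ^ Suc (degree m)" if x: "x \<in> cball 0 \<rho>" for x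
    proof -
      have "cmod (x - a) \<le> 2 * \<rho>" using x a(1) norm_triangle_ineq4[of x a] by simp
      hence "cmod (x - a) * cmod (poly m x) \<le> 2 * \<rho> * (2 * \<rho>) ^ degree m"
        using m(5) x assms(1) by (intro mult_mono) auto
      moreover have "poly ([:-a, 1:] * m) x = (x - a) * poly m x" by (simp add: algebra_simps)
      ultimately show ?thesis by (simp only: norm_mult power_Suc)
    qed
    moreover have "lead_coeff ([:-a, 1:] * m) = 1" unfolding lead_coeff_mult using m(2) by simp
    moreover have "p = ([:-a, 1:] * m) * u" by (simp only: q m(1) mult.assoc)
    ultimately show ?thesis using m(3) deg by metis
  qed
qed

text \<open>The reflected polynomial has value \<open>1\<close> at the origin, so the maximum
  principle on the disc of radius \<open>1 / s\<close> gives a boundary point where its modulus is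
  at least \<open>1\<close>; inversion carries this point to the circle of radius
  \<open>s\<close>.\<close>

lemma monic_lower_bound:
  fixes m :: "complex poly"
  assumes "lead_coeff m = 1" "s > 0"
  shows "\<exists>x. cmod x = s \<and> cmod (poly m x) \<ge> s ^ degree m"
proof -
  let ?r = "reflect_poly m"
  have ne: "sphere (0::complex) (1/s) \<noteq> {}" using assms(2) by simp
  have cont: "continuous_on (sphere 0 (1/s)) (\<lambda>z. cmod (poly ?r z))" by (intro continuous_intros)
  obtain y where y: "y \<in> sphere 0 (1/s)" "\<And>z. z \<in> sphere 0 (1/s) \<Longrightarrow> cmod (poly ?r z) \<le> cmod (poly ?r y)"
    using continuous_attains_sup[OF compact_sphere ne cont] by blast
  have "cmod (poly ?r 0) \<le> cmod (poly ?r y)"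
  proof (rule maximum_modulus_frontier[of "poly ?r" "cball 0 (1/s)"])
    show "poly ?r holomorphic_on interior (cball 0 (1/s))" by (intro holomorphic_intros)
    show "continuous_on (closure (cball 0 (1/s))) (poly ?r)" by (intro continuous_intros)
    show "cmod (poly ?r z) \<le> cmod (poly ?r y)" if "z \<in> frontier (cball 0 (1/s))" for z
      using that y(2) by (simp add: frontier_cball)
  qed (use assms in auto)
  hence 1: "1 \<le> cmod (poly ?r y)" using assms(1) by (simp add: poly_0_coeff_0)
  have yn: "cmod y = 1 / s" "y \<noteq> 0" using y(1) assms(2) by auto
  have "poly ?r y = y ^ degree m * poly m (inverse y)" using yn(2) by (rule poly_reflect_poly_nz)
  hence "1 \<le> (1 / s) ^ degree m * cmod (poly m (inverse y))" using 1 yn by (simp add: norm_mult norm_power)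
  hence "s ^ degree m \<le> cmod (poly m (inverse y))" using assms(2) by (simp add: power_divide field_simps)
  thus ?thesis using yn assms(2) by (intro exI[of _ "inverse y"]) (simp add: norm_inverse)
qed

lemma wind_poly_root:
  fixes p :: "complex poly"
  assumes "\<rho> > 0" "\<And>x. x \<in> sphere 0 \<rho> \<Longrightarrow> poly p x \<noteq> 0" "wind \<rho> (poly p) N" "N \<noteq> 0"
  shows "\<exists>x\<in>ball 0 \<rho>. poly p x = 0"
proof (rule ccontr)
  assume no: "\<not> ?thesis"
  have "poly p x \<noteq> 0" if "x \<in> cball 0 \<rho>" for x
    using no assms(2)[of x] that by (cases "cmod x = \<rho>") auto
  hence "wind \<rho> (poly p) 0" by (intro wind_const_if_disc continuous_intros) auto
  thus False using wind_unique[OF assms(1,3)] assms(4) by auto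
qed

section \<open>Convergence of the iterates off a point\<close>

text \<open>Linear independence of \<open>u\<close> and \<open>z\<close>, stated by the 2 by 2
  minors so that openness in \<open>u\<close> is immediate.\<close>

definition indep2 :: "complex^3 \<Rightarrow> complex^3 \<Rightarrow> bool" where
  "indep2 u z \<longleftrightarrow> (\<exists>i j. u $ i * z $ j \<noteq> u $ j * z $ i)"

lemma indep2_smult: "c \<noteq> 0 \<Longrightarrow> indep2 (c *s u) z \<longleftrightarrow> indep2 u z"
  by (auto simp: indep2_def mult.assoc)

lemma indep2_add_smult: "indep2 (c *s z + u) z \<longleftrightarrow> indep2 u z"
  by (simp add: indep2_def algebra_simps)

lemma not_indep2D:
  assumes "\<not> indep2 u z" "z \<noteq> 0"
  shows "\<exists>c. u = c *s z"
proof -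
  obtain j where j: "z $ j \<noteq> 0" using assms(2) by (auto simp: vec_eq_iff)
  have "u = (u $ j / z $ j) *s z"
    using assms(1) j by (auto simp: vec_eq_iff indep2_def field_simps)
  thus ?thesis by blast
qed

lemma indep2_nonzero: "indep2 u z \<Longrightarrow> u \<noteq> 0" by (auto simp: indep2_def)

lemma open_indep2: "open {u. indep2 u z}"
proof -
  have "{u. indep2 u z} = (\<Union>i. \<Union>j. {u. u $ i * z $ j \<noteq> u $ j * z $ i})" by (auto simp: indep2_def)
  moreover have "open {u::complex^3. u $ i * z $ j \<noteq> u $ j * z $ i}" for i j
    by (intro open_Collect_neq continuous_intros)
  ultimately show ?thesis by (simp add: open_UN)
qed

text \<open>In projective terms, a punctured neighbourhood of \<open>proj z0\<close>.\<close>

definition punct :: "complex^3 \<Rightarrow> real \<Rightarrow> (complex^3) set" where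
  "punct z0 \<eta> = ball z0 \<eta> \<inter> {u. indep2 u z0}"

lemma open_punct: "open (punct z0 \<eta>)"
  unfolding punct_def by (intro open_Int open_ball open_indep2)

lemma punct_line:
  assumes "indep2 v z0" "x \<noteq> 0" "cmod x * norm v < \<eta>"
  shows "z0 + x *s v \<in> punct z0 \<eta>"
  using assms indep2_add_smult[of 1 z0 "x *s v"] indep2_smult[OF assms(2)]
  by (simp add: punct_def dist_norm norm_smult)

text \<open>This amounts to linear independence of the three vectors, so \<open>x\<close> and
  \<open>y\<close> in \<open>z + x *s a + y *s b\<close> are affine coordinates near
  \<open>proj z\<close> in which only the origin gives \<open>proj z\<close> itself.\<close>

definition indep3 :: "complex^3 \<Rightarrow> complex^3 \<Rightarrow> complex^3 \<Rightarrow> bool" where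
  "indep3 z a b \<longleftrightarrow> (\<forall>x y. x \<noteq> 0 \<or> y \<noteq> 0 \<longrightarrow> indep2 (x *s a + y *s b) z)"

lemma punct_plane:
  assumes "indep3 z0 a b" "x \<noteq> 0 \<or> y \<noteq> 0" "cmod x * norm a + cmod y * norm b < \<eta>"
  shows "z0 + x *s a + y *s b \<in> punct z0 \<eta>"
proof -
  have "indep2 (x *s a + y *s b) z0" using assms(1,2) by (auto simp: indep3_def)
  hence "indep2 (z0 + x *s a + y *s b) z0" using indep2_add_smult[of 1 z0 "x *s a + y *s b"] by (simp add: add.assoc)
  moreover have "norm (x *s a + y *s b) < \<eta>"
    using norm_triangle_ineq[of "x *s a" "y *s b"] assms(3) by (simp add: norm_smult)
  moreover have "dist z0 (z0 + x *s a + y *s b) = norm (x *s a + y *s b)"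
    by (metis add.assoc add_diff_cancel_left' dist_norm norm_minus_commute)
  ultimately show ?thesis by (simp add: punct_def)
qed

lemma indep3_indep2: "indep3 z a b \<Longrightarrow> indep2 a z"
  unfolding indep3_def by (drule spec[of _ 1], drule spec[of _ 0]) simp

lemma continuous_on_smult_left [continuous_intros]:
  fixes v :: "complex^3"
  assumes "continuous_on S f"
  shows "continuous_on S (\<lambda>x. f x *s v)"
  unfolding vector_scalar_mult_def by (intro continuous_intros assms)

lemma continuous_on_smult [continuous_intros]:
  fixes h :: "'a::topological_space \<Rightarrow> complex^3"
  assumes "continuous_on S f" "continuous_on S h"
  shows "continuous_on S (\<lambda>x. f x *s h x)"
  unfolding vector_scalar_mult_def by (intro continuous_intros assms)

context stable_rational_map
begin

section \<open>Projected iterates and their limits along complex lines\<close>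

lemma E_line_poly: "\<exists>p. \<forall>x. E n (u + x *s v) $ i = poly p x"
proof -
  obtain W where W: "self_map W = E n" using E_poly by blast
  let ?p = "\<Sum>m\<in>Poly_Mapping.keys (W $ i). [:Poly_Mapping.lookup (W $ i) m:] *
    (\<Prod>j\<in>UNIV. [:u $ j, v $ j:] ^ Poly_Mapping.lookup m j)"
  have "self_map W (u + x *s v) $ i = poly ?p x" for x
    by (simp add: self_map_def poly3_eval_def poly_sum poly_prod)
  thus ?thesis unfolding W by blast
qed

lemma continuous_on_E [continuous_intros]:
  assumes "continuous_on S h"
  shows "continuous_on S (\<lambda>x. E n (h x))"
proof -
  obtain W where W: "self_map W = E n" using E_poly by blast
  have "continuous_on S (\<lambda>x. self_map W (h x))"
    unfolding self_map_def poly3_eval_def by (intro continuous_intros assms)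
  thus ?thesis unfolding W .
qed

lemma E_growth: "\<exists>C>0. \<forall>z. norm (E n z) \<le> C * norm z ^ (d ^ n)"
proof -
  have "compact (E n ` sphere 0 1)" by (intro compact_continuous_image continuous_intros compact_sphere)
  then obtain C where C: "C > 0" "\<And>z. z \<in> sphere 0 1 \<Longrightarrow> norm (E n z) \<le> C"
    using compact_imp_bounded bounded_pos by (metis imageI)
  have "norm (E n z) \<le> C * norm z ^ (d ^ n)" for z
  proof (cases "z = 0")
    case True
    thus ?thesis using C(1) by simp
  next
    case False
    define w where "w = complex_of_real (inverse (norm z)) *s z"
    have w: "w \<in> sphere 0 1" using False by (simp add: w_def norm_smult norm_inverse)
    have "z = complex_of_real (norm z) *s w" using False by (simp add: w_def flip: of_real_mult)
    hence "norm (E n z) = norm z ^ (d ^ n) * norm (E n w)"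
      using E_smult[of n "complex_of_real (norm z)" w] by (simp add: norm_smult norm_power)
    also have "\<dots> \<le> norm z ^ (d ^ n) * C" by (intro mult_left_mono C(2)[OF w]) simp
    finally show ?thesis by (simp add: mult.commute)
  qed
  thus ?thesis using C(1) by blast
qed

text \<open>Locally uniform convergence near, but not at, the point \<open>proj z0\<close>. The
  limit is a function of vectors, ready to be evaluated along discs, and only continuity is
  demanded; its holomorphy along lines is derived. The clause \<open>E (n k) u \<noteq> 0\<close>
  says that late iterates are defined on \<open>K\<close>.\<close>

definition converges :: "complex^3 \<Rightarrow> real \<Rightarrow> (nat \<Rightarrow> nat) \<Rightarrow> (complex^3 \<Rightarrow> cp2) \<Rightarrow> bool" where
  "converges z0 \<eta> n g \<longleftrightarrow> 0 < \<eta> \<and> z0 \<noteq> 0 \<and> continuous_on (punct z0 \<eta>) g \<and>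
    (\<forall>K e. compact K \<longrightarrow> K \<subseteq> punct z0 \<eta> \<longrightarrow> 0 < e \<longrightarrow>
      (\<forall>\<^sub>F k in sequentially. \<forall>u\<in>K. E (n k) u \<noteq> 0 \<and> dist (proj (E (n k) u)) (g u) < e))"

lemma converges_subseq:
  assumes "converges z0 \<eta> n g" "strict_mono s"
  shows "converges z0 \<eta> (n \<circ> s) g"
  unfolding converges_def
proof (intro conjI allI impI)
  fix K and e :: real assume "compact K" "K \<subseteq> punct z0 \<eta>" "0 < e"
  hence "\<forall>\<^sub>F k in sequentially. \<forall>u\<in>K. E (n k) u \<noteq> 0 \<and> dist (proj (E (n k) u)) (g u) < e"
    using assms(1) unfolding converges_def by blast
  from eventually_subseq[OF assms(2) this]
  show "\<forall>\<^sub>F k in sequentially. \<forall>u\<in>K. E ((n \<circ> s) k) u \<noteq> 0 \<and> dist (proj (E ((n \<circ> s) k) u)) (g u) < e"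
    by simp
qed (use assms(1) in \<open>auto simp: converges_def\<close>)

text \<open>The compact set of limit values has a neighbourhood inside the chart on which
  \<open>affine i\<close> varies little, and late iterates take their values in it.\<close>

lemma converges_affine:
  assumes "converges z0 \<eta> n g" "compact K" "K \<subseteq> punct z0 \<eta>" "g ` K \<subseteq> chart i" "0 < e"
  shows "\<forall>\<^sub>F k in sequentially. \<forall>u\<in>K. E (n k) u $ i \<noteq> 0 \<and>
    dist ((1 / E (n k) u $ i) *s E (n k) u) (affine i (g u)) < e"
proof -
  have "compact (g ` K)"
    using assms(1-3) by (intro compact_continuous_image) (auto simp: converges_def intro: continuous_on_subset)
  then obtain \<delta> where \<delta>: "\<delta> > 0"
    "\<And>x y. x \<in> g ` K \<Longrightarrow> dist x y < \<delta> \<Longrightarrow> y \<in> chart i \<and> dist (affine i x) (affine i y) < e"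
    using compact_uniform_nbhd[OF _ assms(4) open_chart continuous_on_affine assms(5)] by blast
  have "\<forall>\<^sub>F k in sequentially. \<forall>u\<in>K. E (n k) u \<noteq> 0 \<and> dist (proj (E (n k) u)) (g u) < \<delta>"
    using assms(1-3) \<delta>(1) unfolding converges_def by blast
  thus ?thesis
  proof eventually_elim
    case (elim k)
    show ?case
    proof
      fix u assume u: "u \<in> K"
      have nz: "E (n k) u \<noteq> 0" using elim u by blast
      have "proj (E (n k) u) \<in> chart i \<and> dist (affine i (g u)) (affine i (proj (E (n k) u))) < e"
        using \<delta>(2)[of "g u" "proj (E (n k) u)"] elim u by (simp add: dist_commute)
      thus "E (n k) u $ i \<noteq> 0 \<and> dist ((1 / E (n k) u $ i) *s E (n k) u) (affine i (g u)) < e"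
        using nz by (simp add: chart_proj affine_proj dist_commute)
    qed
  qed
qed

lemma holomorphic_on_E_line:
  "(\<lambda>x. E n (u + x *s v) $ i) holomorphic_on S"
proof -
  obtain p where "\<And>x. E n (u + x *s v) $ i = poly p x" using E_line_poly by blast
  thus ?thesis by (simp add: holomorphic_intros)
qed

text \<open>Inside one chart the limit is a uniform limit of quotients of polynomials on closed
  discs, so Weierstrass's theorem applies.\<close>

lemma holomorphic_affine_limit:
  assumes "converges z0 \<eta> n g" "open S"
    "\<And>x. x \<in> S \<Longrightarrow> u + x *s v \<in> punct z0 \<eta> \<and> g (u + x *s v) \<in> chart i"
  shows "(\<lambda>x. affine i (g (u + x *s v)) $ j) holomorphic_on S"
proof -
  have "\<exists>T. open T \<and> x0 \<in> T \<and> (\<lambda>x. affine i (g (u + x *s v)) $ j) holomorphic_on T" if x0: "x0 \<in> S" for x0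
  proof -
    obtain r where r: "r > 0" "cball x0 r \<subseteq> S" using assms(2) x0 open_contains_cball by blast
    let ?K = "(\<lambda>x. u + x *s v) ` cball x0 r"
    have K: "compact ?K" by (intro compact_continuous_image continuous_intros compact_cball)
    have K2: "?K \<subseteq> punct z0 \<eta>" "g ` ?K \<subseteq> chart i" using assms(3) r(2) by auto
    note ev = converges_affine[OF assms(1) K K2]
    let ?f = "\<lambda>k x. E (n k) (u + x *s v) $ j / E (n k) (u + x *s v) $ i"
    have "uniform_limit (cball x0 r) ?f (\<lambda>x. affine i (g (u + x *s v)) $ j) sequentially"
    proof (rule uniform_limitI)
      fix e :: real assume "e > 0"
      from ev[OF this] show "\<forall>\<^sub>F k in sequentially. \<forall>x\<in>cball x0 r.
          dist (?f k x) (affine i (g (u + x *s v)) $ j) < e"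
      proof eventually_elim
        case (elim k)
        show ?case
        proof
          fix x assume "x \<in> cball x0 r"
          hence "dist ((1 / E (n k) (u + x *s v) $ i) *s E (n k) (u + x *s v)) (affine i (g (u + x *s v))) < e"
            using elim by blast
          hence "dist (((1 / E (n k) (u + x *s v) $ i) *s E (n k) (u + x *s v)) $ j) (affine i (g (u + x *s v)) $ j) < e"
            using dist_vec_nth_le order_le_less_trans by blast
          thus "dist (?f k x) (affine i (g (u + x *s v)) $ j) < e" by simp
        qed
      qed
    qed
    moreover have "\<forall>\<^sub>F k in sequentially. continuous_on (cball x0 r) (?f k) \<and> ?f k holomorphic_on ball x0 r"
      using ev[OF zero_less_one]
    proof eventually_elim
      case (elim k)
      hence "?f k holomorphic_on cball x0 r"
        by (intro holomorphic_on_divide holomorphic_on_E_line) auto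
      thus ?case by (auto intro: holomorphic_on_imp_continuous_on elim: holomorphic_on_subset)
    qed
    ultimately have "(\<lambda>x. affine i (g (u + x *s v)) $ j) holomorphic_on ball x0 r"
      using holomorphic_uniform_limit[of x0 r ?f sequentially "\<lambda>x. affine i (g (u + x *s v)) $ j"] by auto
    thus ?thesis using r(1) by (intro exI[of _ "ball x0 r"]) auto
  qed
  hence "(\<lambda>x. affine i (g (u + x *s v)) $ j) field_differentiable at x0 within S" if "x0 \<in> S" for x0
    using holomorphic_on_imp_differentiable_at field_differentiable_at_within that by blast
  thus ?thesis unfolding holomorphic_on_def by blast
qed

text \<open>The identity theorem across changing charts. In a chart \<open>j\<close> containing the
  value of \<open>g\<close>, leaving chart \<open>i\<close> means a zero of a holomorphic
  coordinate, so it happens near a point either everywhere or at most at that point. The two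
  alternatives \<open>A\<close> and \<open>B\<close> are open and disjoint, and connectedness
  together with \<open>x0\<close> excludes the first.\<close>

lemma chart_zeros_isolated:
  assumes conv: "converges z0 \<eta> n g" and S: "open S" "connected S"
    and line: "\<And>x. x \<in> S \<Longrightarrow> u + x *s v \<in> punct z0 \<eta>"
    and x0: "x0 \<in> S" "g (u + x0 *s v) \<in> chart i" and x1: "x1 \<in> S"
  shows "\<exists>r>0. \<forall>x\<in>ball x1 r - {x1}. x \<in> S \<and> g (u + x *s v) \<in> chart i"
proof -
  define Z where "Z = {x \<in> S. g (u + x *s v) \<notin> chart i}"
  define A where "A = {x. \<exists>r>0. ball x r \<subseteq> Z}"
  define B where "B = {x. \<exists>r>0. ball x r \<subseteq> S \<and> (ball x r - {x}) \<inter> Z = {}}"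
  have cont: "continuous_on S (\<lambda>x. g (u + x *s v))"
  proof (rule continuous_on_compose2[of "punct z0 \<eta>" g S "\<lambda>x. u + x *s v"])
    show "continuous_on S (\<lambda>x. u + x *s v)" by (intro continuous_intros)
  qed (use conv line in \<open>auto simp: converges_def\<close>)
  have AB: "x \<in> A \<or> x \<in> B" if x: "x \<in> S" for x
  proof -
    obtain j where j: "g (u + x *s v) \<in> chart j" using in_some_chart by blast
    have "open (S \<inter> (\<lambda>x. g (u + x *s v)) -` chart j)"
      using continuous_open_preimage[OF cont S(1) open_chart] .
    then obtain r where r: "r > 0" "ball x r \<subseteq> S \<inter> (\<lambda>x. g (u + x *s v)) -` chart j"
      using x j unfolding open_contains_ball by blast
    define h where "h x = affine j (g (u + x *s v)) $ i" for x
    have hol: "h holomorphic_on ball x r"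
      unfolding h_def by (rule holomorphic_affine_limit[OF conv]) (use r(2) line in auto)
    have hZ: "h y = 0 \<longleftrightarrow> y \<in> Z" if "y \<in> ball x r" for y
      using that r(2) by (auto simp: h_def Z_def affine_def chart_def)
    show ?thesis
    proof (cases "\<exists>y\<in>ball x r. h y \<noteq> 0")
      case False
      thus ?thesis using hZ r(1) unfolding A_def by blast
    next
      case True
      then obtain y where y: "y \<in> ball x r" "h y \<noteq> 0" by blast
      show ?thesis
      proof (cases "h x = 0")
        case True
        obtain s where s: "s > 0" "ball x s \<subseteq> ball x r" "\<And>w. w \<in> ball x s - {x} \<Longrightarrow> h w \<noteq> 0"
          using isolated_zeros[OF hol open_ball connected_ball _ True y] r(1) by auto
        have "x \<in> B" unfolding B_def
          using s hZ r(2) by (intro CollectI exI[of _ s]) blast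
        thus ?thesis ..
      next
        case False
        have "continuous_on (ball x r) h" using hol by (rule holomorphic_on_imp_continuous_on)
        hence "open {y \<in> ball x r. h y \<noteq> 0}"
          using continuous_open_preimage[of "ball x r" h "- {0}"] by (simp add: vimage_def Int_def open_Compl)
        moreover have "x \<in> {y \<in> ball x r. h y \<noteq> 0}" using False r(1) by simp
        ultimately obtain s where "s > 0" "ball x s \<subseteq> {y \<in> ball x r. h y \<noteq> 0}"
          unfolding open_contains_ball by blast
        hence "x \<in> B" unfolding B_def
          using hZ r(2) by (intro CollectI exI[of _ s]) blast
        thus ?thesis ..
      qed
    qed
  qed
  have opA: "open A"
    unfolding open_contains_ball
  proof
    fix x assume "x \<in> A"
    then obtain r where r: "r > 0" "ball x r \<subseteq> Z" unfolding A_def by blast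
    have "ball x r \<subseteq> A"
    proof
      fix y assume y: "y \<in> ball x r"
      then obtain s where "s > 0" "ball y s \<subseteq> ball x r" by (rule openE[OF open_ball])
      thus "y \<in> A" unfolding A_def using r(2) by blast
    qed
    thus "\<exists>e>0. ball x e \<subseteq> A" using r(1) by blast
  qed
  have opB: "open B"
    unfolding open_contains_ball
  proof
    fix x assume "x \<in> B"
    then obtain r where r: "r > 0" "ball x r \<subseteq> S" "(ball x r - {x}) \<inter> Z = {}" unfolding B_def by blast
    have "ball x r \<subseteq> B"
    proof
      fix y assume y: "y \<in> ball x r"
      show "y \<in> B"
      proof (cases "y = x")
        case True thus ?thesis using \<open>x \<in> B\<close> by simp
      next
        case False
        hence "y \<in> ball x r - {x}" using y by simp
        moreover have "open (ball x r - {x})" by (intro open_Diff) auto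
        ultimately obtain s where "s > 0" "ball y s \<subseteq> ball x r - {x}" using open_contains_ball by metis
        thus "y \<in> B" unfolding B_def using r by blast
      qed
    qed
    thus "\<exists>e>0. ball x e \<subseteq> B" using r(1) by blast
  qed
  have disj: "A \<inter> B \<inter> S = {}"
  proof -
    have False if x: "x \<in> A" "x \<in> B" for x
    proof -
      obtain r s where rs: "r > 0" "ball x r \<subseteq> Z" "s > 0" "(ball x s - {x}) \<inter> Z = {}"
        using x unfolding A_def B_def by blast
      have "x + of_real (min r s / 2) \<in> ball x r" "x + of_real (min r s / 2) \<in> ball x s - {x}"
        using rs(1,3) by (auto simp: dist_norm)
      thus False using rs by blast
    qed
    thus ?thesis by blast
  qed
  have "x0 \<notin> A"
  proof
    assume "x0 \<in> A"
    then obtain r where "r > 0" "ball x0 r \<subseteq> Z" unfolding A_def by blast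
    hence "x0 \<in> Z" using centre_in_ball by blast
    thus False using x0 by (simp add: Z_def)
  qed
  hence "B \<inter> S \<noteq> {}" using AB x0 by blast
  hence "A \<inter> S = {}" using connectedD[OF S(2) opA opB disj] AB by blast
  hence "x1 \<in> B" using AB x1 by blast
  thus ?thesis unfolding B_def Z_def by blast
qed

lemma circle_in_chart:
  assumes conv: "converges z0 \<eta> n g" and v: "indep2 v z0"
    and R: "0 < R1" "R1 < R2" "R2 * norm v < \<eta>"
  shows "\<exists>\<rho> i. R1 < \<rho> \<and> \<rho> < R2 \<and> (\<forall>x. cmod x = \<rho> \<longrightarrow> g (z0 + x *s v) \<in> chart i)"
proof -
  have nv: "norm v > 0" using indep2_nonzero[OF v] by simp
  define R where "R = \<eta> / norm v"
  have R2: "R2 < R" using R nv by (simp add: R_def field_simps)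
  define S where "S = ball (0::complex) R - {0}"
  have S: "open S" "connected S"
    unfolding S_def by (auto intro!: open_Diff connected_punctured_ball)
  have line: "z0 + x *s v \<in> punct z0 \<eta>" if "x \<in> S" for x
    using that nv by (intro punct_line v) (auto simp: S_def R_def field_simps)
  obtain i where i: "g (z0 + of_real R1 *s v) \<in> chart i" using in_some_chart by blast
  have x0: "of_real R1 \<in> S" using R R2 by (simp add: S_def)
  \<comment> \<open>Only isolated points of the closed annulus leave the chart, so there are
    finitely many, and some radius misses all their moduli.\<close>
  define Z where "Z = {x \<in> cball 0 R2 - ball 0 R1. g (z0 + x *s v) \<notin> chart i}"
  have comp: "compact (cball (0::complex) R2 - ball 0 R1)" by (intro compact_diff) auto
  have sub: "cball 0 R2 - ball 0 R1 \<subseteq> S" using R R2 by (auto simp: S_def)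
  have "finite Z"
  proof (rule ccontr)
    assume "infinite Z"
    then obtain x1 where x1: "x1 \<in> cball 0 R2 - ball 0 R1" "x1 islimpt Z"
      using comp unfolding compact_eq_Bolzano_Weierstrass by (metis (no_types, lifting) Z_def mem_Collect_eq subsetI)
    obtain r where r: "r > 0" "\<And>x. x \<in> ball x1 r - {x1} \<Longrightarrow> g (z0 + x *s v) \<in> chart i"
      using chart_zeros_isolated[OF conv S line x0 i] x1(1) sub by blast
    obtain x where "x \<in> Z" "x \<in> ball x1 r" "x \<noteq> x1"
      using x1(2) r(1) unfolding islimpt_def by (metis centre_in_ball open_ball)
    thus False using r(2)[of x] by (auto simp: Z_def)
  qed
  hence "infinite ({R1<..<R2} - cmod ` Z)"
    using R(2) by (intro Diff_infinite_finite) (auto simp: infinite_Ioo)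
  then obtain \<rho> where "\<rho> \<in> {R1<..<R2} - cmod ` Z" using infinite_imp_nonempty by blast
  thus ?thesis by (intro exI[of _ \<rho>] exI[of _ i]) (auto simp: Z_def)
qed

end

section \<open>Stability of winding numbers under projective convergence\<close>

lemma herm_nonzero_if_close:
  assumes "a \<noteq> 0" "b \<noteq> 0" "dist (proj a) (proj b) < pi / 2"
  shows "herm a b \<noteq> 0"
proof
  assume "herm a b = 0"
  thus False using assms by (simp add: dist_proj fubini_study_def)
qed

lemma continuous_on_herm [continuous_intros]:
  assumes "continuous_on S f" "continuous_on S h"
  shows "continuous_on S (\<lambda>x. herm (f x) (h x))"
  unfolding herm_def by (intro continuous_intros assms)

lemma herm_ratio_near_1:
  assumes "norm (A - B) < norm B"
  shows "cmod (herm A B / of_real ((norm B)\<^sup>2) - 1) < 1"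
proof -
  have B: "norm B > 0" using assms norm_ge_zero[of "A - B"] by linarith
  have "herm A B / of_real ((norm B)\<^sup>2) - 1 = herm (A - B) B / of_real ((norm B)\<^sup>2)"
    using B by (simp add: herm_diff_left herm_self diff_divide_distrib)
  hence "cmod (herm A B / of_real ((norm B)\<^sup>2) - 1) = cmod (herm (A - B) B) / (norm B)\<^sup>2"
    by (simp add: norm_divide norm_power)
  also have "\<dots> \<le> norm (A - B) * norm B / (norm B)\<^sup>2"
    by (intro divide_right_mono herm_cauchy_schwarz) simp
  also have "\<dots> = norm (A - B) / norm B" using B by (simp add: power2_eq_square)
  also have "\<dots> < 1" using assms B by simp
  finally show ?thesis .
qed

context stable_rational_map
begin

lemma poly_line:
  obtains p where "\<And>x. E n (u + x *s v) $ i = poly p x"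
  using E_line_poly by blast

lemma E_line_wind:
  assumes "\<rho> > 0" "\<And>x. cmod x = \<rho> \<Longrightarrow> E n (u + x *s v) $ i \<noteq> 0"
  shows "\<exists>N. wind \<rho> (\<lambda>x. E n (u + x *s v) $ i) N"
proof -
  obtain p where p: "\<And>x. E n (u + x *s v) $ i = poly p x" using poly_line by blast
  have "poly p x \<noteq> 0" if "x \<in> sphere 0 \<rho>" for x using assms(2)[of x] that by (simp add: p)
  from poly_zero_factor[OF assms(1) this] show ?thesis by (auto simp: p)
qed

text \<open>By closeness the two lifts are nowhere orthogonal on the disc, so their Hermitian
  product has a continuous logarithm there. On the circle this product is
  \<open>a x $ i * cnj (b x $ i)\<close> times the product of the normalized vectors, which is close
  to a positive number; hence the two \<open>i\<close>-th components differ on the circle by a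
  factor near \<open>1\<close> and an exponential.\<close>

lemma wind_transfer_disc:
  assumes \<rho>: "\<rho> > 0" and nz: "\<And>x. cmod x \<le> \<rho> \<Longrightarrow> E k (u + x *s v) \<noteq> 0 \<and> E m (u + x *s v) \<noteq> 0 \<and>
      dist (proj (E k (u + x *s v))) (proj (E m (u + x *s v))) < pi / 2"
    and circ: "\<And>x. cmod x = \<rho> \<Longrightarrow> E k (u + x *s v) $ i \<noteq> 0 \<and> E m (u + x *s v) $ i \<noteq> 0 \<and>
      dist ((1 / E k (u + x *s v) $ i) *s E k (u + x *s v)) ((1 / E m (u + x *s v) $ i) *s E m (u + x *s v)) < 1"
    and w: "wind \<rho> (\<lambda>x. E k (u + x *s v) $ i) N"
  shows "wind \<rho> (\<lambda>x. E m (u + x *s v) $ i) N"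
proof -
  define a b where "a x = E k (u + x *s v)" and "b x = E m (u + x *s v)" for x
  have cab: "continuous_on S a" "continuous_on S b" for S
    unfolding a_def b_def by (intro continuous_intros)+
  have "continuous_on (cball 0 \<rho>) (\<lambda>x. herm (a x) (b x))" by (intro continuous_intros cab)
  moreover have "herm (a x) (b x) \<noteq> 0" if "x \<in> cball 0 \<rho>" for x
    using nz[of x] that unfolding a_def b_def by (intro herm_nonzero_if_close) auto
  ultimately obtain L where L: "continuous_on (cball 0 \<rho>) L" "\<And>x. x \<in> cball 0 \<rho> \<Longrightarrow> herm (a x) (b x) = exp (L x)"
    using continuous_logarithm_on_cball[of 0 \<rho> "\<lambda>x. herm (a x) (b x)"] by blast
  have b0: "b x \<noteq> 0" if "cmod x = \<rho>" for x using nz[of x] that by (simp add: b_def)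
  \<comment> \<open>A logarithm of \<open>(norm (b x))\<^sup>2\<close> divided by the Hermitian
    product. The square is also \<open>b x $ i * cnj (b x $ i)\<close> times the squared norm of
    \<open>B x\<close>, which makes the conjugate factors cancel.\<close>
  define l where "l x = of_real (ln ((norm (b x))\<^sup>2)) - L x" for x
  have cl: "continuous_on (sphere 0 \<rho>) l"
    unfolding l_def using b0
    by (intro continuous_intros cab continuous_on_subset[OF L(1)]) auto
  define A B where "A x = (1 / a x $ i) *s a x" and "B x = (1 / b x $ i) *s b x" for x
  define c where "c x = herm (A x) (B x) / of_real ((norm (B x))\<^sup>2)" for x
  have abi: "a x $ i \<noteq> 0" "b x $ i \<noteq> 0" "dist (A x) (B x) < 1" if "cmod x = \<rho>" for x
    using circ[OF that] by (simp_all add: a_def b_def A_def B_def)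
  have Bn: "norm (B x) \<ge> 1" if "cmod x = \<rho>" for x
  proof -
    have "B x $ i = 1" using abi(2)[OF that] by (simp add: B_def)
    thus ?thesis using Finite_Cartesian_Product.norm_nth_le[of "B x" i] by simp
  qed
  have c1: "cmod (c x - 1) < 1" if "x \<in> sphere 0 \<rho>" for x
    unfolding c_def
  proof (rule herm_ratio_near_1)
    show "norm (A x - B x) < norm (B x)"
      using abi(3)[of x] Bn[of x] that by (simp add: dist_norm)
  qed
  have ccont: "continuous_on (sphere 0 \<rho>) c"
  proof -
    have "norm (B x) \<noteq> 0" if "x \<in> sphere 0 \<rho>" for x using Bn[of x] that by auto
    thus ?thesis unfolding c_def using abi(1,2) unfolding A_def B_def
      by (intro continuous_intros cab) auto
  qed
  have e: "b x $ i = (a x $ i * c x) * exp (l x)" if x: "x \<in> sphere 0 \<rho>" for x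
  proof -
    have nb: "norm (b x) > 0" using b0[of x] x by simp
    have 1: "exp (l x) * herm (a x) (b x) = of_real ((norm (b x))\<^sup>2)"
      using L(2)[of x] x nb by (simp add: l_def exp_diff exp_of_real)
    have 2: "a x $ i * (cnj (b x $ i) * herm (A x) (B x)) = herm (a x) (b x)"
      using abi(1,2)[of x] x by (simp add: A_def B_def herm_smult_left herm_smult_right)
    have 3: "b x $ i * (cnj (b x $ i) * of_real ((norm (B x))\<^sup>2)) = of_real ((norm (b x))\<^sup>2)"
    proof -
      have "norm (b x) = cmod (b x $ i) * norm (B x)"
        using abi(2)[of x] x by (simp add: B_def norm_smult norm_divide)
      hence "complex_of_real ((norm (b x))\<^sup>2) = of_real ((cmod (b x $ i))\<^sup>2) * of_real ((norm (B x))\<^sup>2)"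
        by (simp add: power_mult_distrib)
      thus ?thesis by (simp only: complex_norm_square mult.assoc)
    qed
    have "cnj (b x $ i) * (a x $ i * herm (A x) (B x) * exp (l x)) =
        exp (l x) * (a x $ i * (cnj (b x $ i) * herm (A x) (B x)))" by (simp only: mult_ac)
    also have "\<dots> = cnj (b x $ i) * (b x $ i * of_real ((norm (B x))\<^sup>2))"
      unfolding 2 1 3[symmetric] by (simp only: mult_ac)
    finally have "a x $ i * herm (A x) (B x) * exp (l x) = b x $ i * of_real ((norm (B x))\<^sup>2)"
      using abi(2)[of x] x by simp
    moreover have "complex_of_real ((norm (B x))\<^sup>2) \<noteq> 0" using Bn[of x] x by auto
    ultimately show ?thesis by (simp add: c_def field_simps)
  qed
  have "wind \<rho> (\<lambda>x. a x $ i * c x) N"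
    by (rule wind_mult_near_1[OF _ ccont, of "\<lambda>x. a x $ i"]) (use w c1 in \<open>auto simp: a_def\<close>)
  hence "wind \<rho> (\<lambda>x. b x $ i) N"
    by (rule wind_mult_exp[OF _ cl]) (rule e)
  thus ?thesis by (simp add: b_def)
qed

lemma circle_tube:
  assumes conv: "converges z0 \<eta> n g" and ind: "indep3 z0 a b" and \<rho>: "0 < \<rho>" "\<rho> * norm a < \<eta>"
    and ch: "\<And>x. cmod x = \<rho> \<Longrightarrow> g (z0 + x *s a) \<in> chart i"
  shows "\<exists>\<epsilon>>0. \<rho> * norm a + \<epsilon> * norm b < \<eta> \<and>
    (\<forall>x y. cmod x = \<rho> \<longrightarrow> cmod y \<le> \<epsilon> \<longrightarrow> g (z0 + x *s a + y *s b) \<in> chart i)"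
proof -
  have ia: "indep2 a z0" using indep3_indep2[OF ind] .
  let ?K = "(\<lambda>x. z0 + x *s a) ` sphere 0 \<rho>"
  define W where "W = punct z0 \<eta> \<inter> g -` chart i"
  have W: "open W" unfolding W_def
    using conv by (intro continuous_open_preimage open_punct open_chart) (auto simp: converges_def)
  have "compact ?K" by (intro compact_continuous_image continuous_intros compact_sphere)
  moreover have "?K \<subseteq> W"
    unfolding W_def using \<rho> ch by (auto intro!: punct_line[OF ia])
  ultimately obtain \<delta> where \<delta>: "\<delta> > 0" "\<And>x y. x \<in> ?K \<Longrightarrow> dist x y < \<delta> \<Longrightarrow> y \<in> W"
    using compact_uniform_nbhd[of ?K W "\<lambda>x. x" 1] W by (auto simp del: image_iff)
  define \<epsilon> where "\<epsilon> = min (\<delta> / 2) ((\<eta> - \<rho> * norm a) / 2) / (norm b + 1)"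
  have \<epsilon>0: "\<epsilon> > 0" using \<delta>(1) \<rho>(2) by (auto simp: \<epsilon>_def intro!: divide_pos_pos add_nonneg_pos)
  have "\<epsilon> * norm b \<le> \<epsilon> * (norm b + 1)" using \<epsilon>0 by simp
  also have "\<epsilon> * (norm b + 1) = min (\<delta> / 2) ((\<eta> - \<rho> * norm a) / 2)"
    by (simp add: \<epsilon>_def add_nonneg_eq_0_iff)
  finally have \<epsilon>b: "\<epsilon> * norm b \<le> \<delta> / 2" "\<epsilon> * norm b \<le> (\<eta> - \<rho> * norm a) / 2" by auto
  show ?thesis
  proof (intro exI[of _ \<epsilon>] conjI allI impI \<epsilon>0)
    have "A + B < \<eta>" if "B \<le> (\<eta> - A) / 2" "A < \<eta>" for A B :: real using that by (simp add: field_simps)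
    thus "\<rho> * norm a + \<epsilon> * norm b < \<eta>" using \<epsilon>b(2) \<rho>(2) by blast
    fix x y :: complex assume xy: "cmod x = \<rho>" "cmod y \<le> \<epsilon>"
    have "norm (y *s b) \<le> \<epsilon> * norm b" using xy(2) by (simp add: norm_smult mult_right_mono)
    hence "norm (y *s b) < \<delta>" using \<epsilon>b(1) \<delta>(1) by linarith
    hence "dist (z0 + x *s a) (z0 + x *s a + y *s b) < \<delta>"
      by (simp add: dist_norm)
    hence "z0 + x *s a + y *s b \<in> W" using xy(1) by (intro \<delta>(2)[of "z0 + x *s a"]) auto
    thus "g (z0 + x *s a + y *s b) \<in> chart i" by (simp add: W_def)
  qed
qed

text \<open>On the disc through \<open>z0\<close> nothing is known at the centre. The disc
  \<open>\<Delta>\<close>, shifted by \<open>\<epsilon>\<close> in the direction \<open>b\<close>,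
  avoids the point; there the iterates are uniformly close, so their winding numbers agree, and the
  tube \<open>T\<close> of circles carries this back to the unshifted disc. The bound
  \<open>e0\<close> keeps the shift inside the region of the last clause, where component
  \<open>i\<close> of late iterates is zero-free on \<open>\<Delta>\<close> and \<open>N\<close> is
  therefore \<open>0\<close>.\<close>

lemma eventually_wind:
  assumes conv: "converges z0 \<eta> n g" and ind: "indep3 z0 a b" and \<rho>: "0 < \<rho>" "\<rho> * norm a < \<eta>"
    and ch: "\<And>x. cmod x = \<rho> \<Longrightarrow> g (z0 + x *s a) \<in> chart i" and e0: "0 < e0"
  shows "\<exists>N. (\<forall>\<^sub>F k in sequentially. (\<forall>x. cmod x = \<rho> \<longrightarrow> E (n k) (z0 + x *s a) $ i \<noteq> 0) \<and>
      wind \<rho> (\<lambda>x. E (n k) (z0 + x *s a) $ i) N) \<and>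
    ((\<forall>x y. cmod x \<le> \<rho> \<longrightarrow> cmod y \<le> e0 \<longrightarrow> x \<noteq> 0 \<or> y \<noteq> 0 \<longrightarrow>
      g (z0 + x *s a + y *s b) \<in> chart i) \<longrightarrow> N = 0)"
proof -
  obtain \<epsilon>' where \<epsilon>': "\<epsilon>' > 0" "\<rho> * norm a + \<epsilon>' * norm b < \<eta>"
    "\<And>x y. cmod x = \<rho> \<Longrightarrow> cmod y \<le> \<epsilon>' \<Longrightarrow> g (z0 + x *s a + y *s b) \<in> chart i"
    using circle_tube[OF conv ind \<rho> ch] by blast
  define \<epsilon> where "\<epsilon> = min \<epsilon>' e0"
  have "\<epsilon> * norm b \<le> \<epsilon>' * norm b" unfolding \<epsilon>_def by (intro mult_right_mono) auto
  hence \<epsilon>: "\<epsilon> > 0" "\<rho> * norm a + \<epsilon> * norm b < \<eta>"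
    "\<And>x y. cmod x = \<rho> \<Longrightarrow> cmod y \<le> \<epsilon> \<Longrightarrow> g (z0 + x *s a + y *s b) \<in> chart i"
    using \<epsilon>' e0 by (auto simp: \<epsilon>_def)
  let ?y = "complex_of_real \<epsilon>"
  define T where "T = (\<lambda>(x, y). z0 + x *s a + y *s b) ` (sphere 0 \<rho> \<times> cball 0 \<epsilon>)"
  define \<Delta> where "\<Delta> = (\<lambda>x. (z0 + ?y *s b) + x *s a) ` cball 0 \<rho>"
  have cT: "compact T" unfolding T_def
    by (intro compact_continuous_image compact_Times compact_sphere compact_cball)
      (auto simp: case_prod_beta intro!: continuous_intros)
  have c\<Delta>: "compact \<Delta>" unfolding \<Delta>_def
    by (intro compact_continuous_image continuous_intros compact_cball)
  have inP: "z0 + x *s a + y *s b \<in> punct z0 \<eta>" if "cmod x \<le> \<rho>" "cmod y \<le> \<epsilon>" "x \<noteq> 0 \<or> y \<noteq> 0" for x y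
  proof (rule punct_plane[OF ind that(3)])
    have "cmod x * norm a \<le> \<rho> * norm a" "cmod y * norm b \<le> \<epsilon> * norm b"
      using that by (auto intro!: mult_right_mono)
    thus "cmod x * norm a + cmod y * norm b < \<eta>" using \<epsilon>(2) by linarith
  qed
  have TP: "T \<subseteq> punct z0 \<eta>" unfolding T_def using \<rho>(1) by (auto intro!: inP)
  have "\<Delta> \<subseteq> punct z0 \<eta>" unfolding \<Delta>_def
  proof
    fix u assume "u \<in> (\<lambda>x. (z0 + ?y *s b) + x *s a) ` cball 0 \<rho>"
    then obtain x where "cmod x \<le> \<rho>" "u = z0 + x *s a + ?y *s b" by (auto simp: algebra_simps)
    thus "u \<in> punct z0 \<eta>" using \<epsilon>(1) inP[of x ?y] by simp
  qed
  note \<Delta>P = this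
  have gT: "g ` T \<subseteq> chart i" unfolding T_def using \<epsilon>(3) by auto
  have ev1: "\<forall>\<^sub>F k in sequentially. \<forall>u\<in>T. E (n k) u $ i \<noteq> 0 \<and>
      dist ((1 / E (n k) u $ i) *s E (n k) u) (affine i (g u)) < 1 / 2"
    by (rule converges_affine[OF conv cT TP gT]) simp
  \<comment> \<open>Distance below \<open>pi / 4\<close> to the limit for each of two iterates makes
    them less than \<open>pi / 2\<close> apart, hence not orthogonal.\<close>
  have ev2: "\<forall>\<^sub>F k in sequentially. \<forall>u\<in>\<Delta>. E (n k) u \<noteq> 0 \<and> dist (proj (E (n k) u)) (g u) < pi / 4"
  proof -
    have "0 < pi / 4" by simp
    thus ?thesis using conv c\<Delta> \<Delta>P unfolding converges_def by blast
  qed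
  have "\<forall>\<^sub>F k in sequentially. (\<forall>u\<in>T. E (n k) u $ i \<noteq> 0 \<and>
      dist ((1 / E (n k) u $ i) *s E (n k) u) (affine i (g u)) < 1 / 2) \<and>
      (\<forall>u\<in>\<Delta>. E (n k) u \<noteq> 0 \<and> dist (proj (E (n k) u)) (g u) < pi / 4)"
    using ev1 ev2 by (rule eventually_conj)
  then obtain k0 where k0: "\<And>k u. k \<ge> k0 \<Longrightarrow> u \<in> T \<Longrightarrow> E (n k) u $ i \<noteq> 0 \<and>
      dist ((1 / E (n k) u $ i) *s E (n k) u) (affine i (g u)) < 1 / 2"
    "\<And>k u. k \<ge> k0 \<Longrightarrow> u \<in> \<Delta> \<Longrightarrow> E (n k) u \<noteq> 0 \<and> dist (proj (E (n k) u)) (g u) < pi / 4"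
    unfolding eventually_sequentially by blast
  have swap: "z0 + ?y *s b + x *s a = z0 + x *s a + ?y *s b" for x by (simp add: algebra_simps)
  have circT: "z0 + x *s a + y *s b \<in> T" if "cmod x = \<rho>" "cmod y \<le> \<epsilon>" for x y
    unfolding T_def using that by (intro image_eqI[of _ _ "(x, y)"]) auto
  have disc\<Delta>: "(z0 + ?y *s b) + x *s a \<in> \<Delta>" if "cmod x \<le> \<rho>" for x
    unfolding \<Delta>_def using that by (intro imageI) simp
  have nz: "E (n k) ((z0 + ?y *s b) + x *s a) $ i \<noteq> 0" if "k \<ge> k0" "cmod x = \<rho>" for k x
    using k0(1)[OF that(1) circT[OF that(2), of ?y]] \<epsilon>(1) by (simp add: swap)
  obtain N where N: "wind \<rho> (\<lambda>x. E (n k0) ((z0 + ?y *s b) + x *s a) $ i) N"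
    using E_line_wind[OF \<rho>(1)] nz[OF order_refl] by blast
  have wy: "wind \<rho> (\<lambda>x. E (n k) ((z0 + ?y *s b) + x *s a) $ i) N" if k: "k \<ge> k0" for k
  proof (rule wind_transfer_disc[OF \<rho>(1) _ _ N])
    fix x :: complex assume x: "cmod x \<le> \<rho>"
    let ?u = "(z0 + ?y *s b) + x *s a"
    have "dist (proj (E (n k0) ?u)) (proj (E (n k) ?u)) < pi / 4 + pi / 4"
      using k0(2)[OF order_refl disc\<Delta>[OF x]] k0(2)[OF k disc\<Delta>[OF x]]
        dist_triangle2[of "proj (E (n k0) ?u)" "proj (E (n k) ?u)" "g ?u"] by linarith
    thus "E (n k0) ?u \<noteq> 0 \<and> E (n k) ?u \<noteq> 0 \<and> dist (proj (E (n k0) ?u)) (proj (E (n k) ?u)) < pi / 2"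
      using k0(2)[OF order_refl disc\<Delta>[OF x]] k0(2)[OF k disc\<Delta>[OF x]] by auto
  next
    fix x :: complex assume x: "cmod x = \<rho>"
    let ?u = "(z0 + ?y *s b) + x *s a"
    have u: "?u \<in> T" unfolding swap using circT[OF x, of ?y] \<epsilon>(1) by simp
    show "E (n k0) ?u $ i \<noteq> 0 \<and> E (n k) ?u $ i \<noteq> 0 \<and>
      dist ((1 / E (n k0) ?u $ i) *s E (n k0) ?u) ((1 / E (n k) ?u $ i) *s E (n k) ?u) < 1"
      using k0(1)[OF order_refl u] k0(1)[OF k u]
        dist_triangle2[of "(1 / E (n k0) ?u $ i) *s E (n k0) ?u" "(1 / E (n k) ?u $ i) *s E (n k) ?u" "affine i (g ?u)"]
      by auto
  qed
  have w0: "wind \<rho> (\<lambda>x. E (n k) (z0 + x *s a) $ i) N" if k: "k \<ge> k0" for k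
  proof -
    have "wind \<rho> (\<lambda>x. E (n k) (z0 + x *s a + 0 *s b) $ i) N"
    proof (rule wind_homotopic[where K = "\<lambda>x y. E (n k) (z0 + x *s a + y *s b) $ i" and Y = "cball 0 \<epsilon>" and ?y0.0 = ?y])
      show "continuous_on (sphere 0 \<rho> \<times> cball 0 \<epsilon>) (\<lambda>(x, y). E (n k) (z0 + x *s a + y *s b) $ i)"
        unfolding case_prod_beta by (intro continuous_intros)
      show "wind \<rho> (\<lambda>x. E (n k) (z0 + x *s a + ?y *s b) $ i) N"
        using wy[OF k] by (simp only: swap)
      show "E (n k) (z0 + x *s a + y *s b) $ i \<noteq> 0" if "x \<in> sphere 0 \<rho>" "y \<in> cball 0 \<epsilon>" for x y
        using k0(1)[OF k circT[of x y]] that by simp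
    qed (use \<epsilon>(1) in auto)
    thus ?thesis by simp
  qed
  have "N = 0" if all: "\<forall>x y. cmod x \<le> \<rho> \<longrightarrow> cmod y \<le> e0 \<longrightarrow> x \<noteq> 0 \<or> y \<noteq> 0 \<longrightarrow>
      g (z0 + x *s a + y *s b) \<in> chart i"
  proof -
    have "g ((z0 + ?y *s b) + x *s a) \<in> chart i" if "cmod x \<le> \<rho>" for x
    proof -
      have "cmod ?y \<le> e0" "?y \<noteq> 0" using \<epsilon>(1) by (auto simp: \<epsilon>_def)
      thus ?thesis using all that unfolding swap by blast
    qed
    hence "g ` \<Delta> \<subseteq> chart i" unfolding \<Delta>_def by auto
    from converges_affine[OF conv c\<Delta> \<Delta>P this zero_less_one]
    obtain k1 where k1: "\<And>k u. k \<ge> k1 \<Longrightarrow> u \<in> \<Delta> \<Longrightarrow> E (n k) u $ i \<noteq> 0"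
      unfolding eventually_sequentially by blast
    let ?k = "max k0 k1"
    have "wind \<rho> (\<lambda>x. E (n ?k) ((z0 + ?y *s b) + x *s a) $ i) 0"
      using k1[of ?k] disc\<Delta> by (intro wind_const_if_disc continuous_intros) auto
    thus "N = 0" using wind_unique[OF \<rho>(1) wy[of ?k]] by simp
  qed
  moreover have "\<forall>\<^sub>F k in sequentially. (\<forall>x. cmod x = \<rho> \<longrightarrow> E (n k) (z0 + x *s a) $ i \<noteq> 0) \<and>
      wind \<rho> (\<lambda>x. E (n k) (z0 + x *s a) $ i) N"
    unfolding eventually_sequentially
  proof (intro exI[of _ k0] allI impI conjI w0)
    fix k x assume "k0 \<le> k" "cmod x = \<rho>"
    thus "E (n k) (z0 + x *s a) $ i \<noteq> 0" using k0(1)[of k "z0 + x *s a"] circT[of x 0] \<epsilon>(1) by simp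
  qed
  ultimately show ?thesis by blast
qed

end

section \<open>Rescaled iterates on discs\<close>

lemma Montel_finite:
  fixes F :: "'j::finite \<Rightarrow> nat \<Rightarrow> complex \<Rightarrow> complex"
  assumes S: "open S" and hol: "\<And>j k. F j k holomorphic_on S" and bd: "\<And>j k x. x \<in> S \<Longrightarrow> cmod (F j k x) \<le> C"
  shows "\<exists>r q. strict_mono (r :: nat \<Rightarrow> nat) \<and> (\<forall>j. q j holomorphic_on S \<and>
    (\<forall>K. compact K \<longrightarrow> K \<subseteq> S \<longrightarrow> uniform_limit K (\<lambda>k. F j (r k)) (q j) sequentially))"
proof -
  have "\<exists>r q. strict_mono (r :: nat \<Rightarrow> nat) \<and> (\<forall>j\<in>J. q j holomorphic_on S \<and>
    (\<forall>K. compact K \<longrightarrow> K \<subseteq> S \<longrightarrow> uniform_limit K (\<lambda>k. F j (r k)) (q j) sequentially))" for J :: "'j set"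
    using finite[of J]
  proof (induction J rule: finite_induct)
    case empty
    show ?case by (intro exI[of _ id]) (simp add: strict_mono_def)
  next
    case (insert j J)
    then obtain r q where r: "strict_mono (r :: nat \<Rightarrow> nat)" and q: "\<And>j. j \<in> J \<Longrightarrow> q j holomorphic_on S"
      "\<And>j K. j \<in> J \<Longrightarrow> compact K \<Longrightarrow> K \<subseteq> S \<Longrightarrow> uniform_limit K (\<lambda>k. F j (r k)) (q j) sequentially"
      by blast
    define \<H> where "\<H> = {h. h holomorphic_on S \<and> (\<forall>x\<in>S. cmod (h x) \<le> C)}"
    have 1: "h holomorphic_on S" if "h \<in> \<H>" for h using that by (simp add: \<H>_def)
    have 2: "\<exists>B. \<forall>h\<in>\<H>. \<forall>z\<in>K. cmod (h z) \<le> B" if "compact K" "K \<subseteq> S" for K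
      using that by (auto simp: \<H>_def)
    have 3: "range (\<lambda>k. F j (r k)) \<subseteq> \<H>" using hol bd by (auto simp: \<H>_def)
    obtain g t where g: "g holomorphic_on S" and t: "strict_mono (t :: nat \<Rightarrow> nat)"
      and lim: "\<And>K. compact K \<Longrightarrow> K \<subseteq> S \<Longrightarrow> uniform_limit K ((\<lambda>k. F j (r k)) \<circ> t) g sequentially"
      using Montel[OF S 1 2 3] by metis
    show ?case
    proof (intro exI[of _ "r \<circ> t"] exI[of _ "q(j := g)"] conjI ballI allI impI)
      show "strict_mono (r \<circ> t)" using r t by (rule strict_mono_o)
      fix l assume l: "l \<in> insert j J"
      show "(q(j := g)) l holomorphic_on S" using l g q(1) by auto
      fix K assume K: "compact K" "K \<subseteq> S"
      show "uniform_limit K (\<lambda>k. F l ((r \<circ> t) k)) ((q(j := g)) l) sequentially"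
      proof (cases "l = j")
        case True
        thus ?thesis using lim[OF K] by (simp add: o_def)
      next
        case False
        hence "uniform_limit K (\<lambda>k. F l (r k)) (q l) sequentially" using q(2) l K by blast
        hence "uniform_limit K (\<lambda>k. F l (r (t k))) (q l) sequentially"
          using filterlim_compose[OF _ filterlim_subseq[OF t]] by blast
        thus ?thesis using False by simp
      qed
    qed
  qed
  from this[of UNIV] show ?thesis by simp
qed

lemma norm_vec3_le: "norm (w::complex^3) \<le> 3 * B" if "\<And>j. cmod (w $ j) \<le> B"
proof -
  have "norm w \<le> (\<Sum>j\<in>UNIV. norm (w $ j))" unfolding norm_vec_def by (rule L2_set_le_sum) simp
  also have "\<dots> \<le> (\<Sum>j\<in>(UNIV::3 set). B)" by (intro sum_mono that)
  finally show ?thesis by simp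
qed

lemma max_modulus_disc:
  assumes "\<rho> > 0" "f holomorphic_on cball 0 \<rho>" "\<And>x. cmod x = \<rho> \<Longrightarrow> cmod (f x) \<le> B" "cmod y \<le> \<rho>"
  shows "cmod (f y) \<le> B"
proof (rule maximum_modulus_frontier[of f "cball 0 \<rho>"])
  show "f holomorphic_on interior (cball 0 \<rho>)" using assms(2) by (rule holomorphic_on_subset) auto
  show "continuous_on (closure (cball 0 \<rho>)) f" using assms(2) by (simp add: holomorphic_on_imp_continuous_on)
  show "cmod (f z) \<le> B" if "z \<in> frontier (cball 0 \<rho>)" for z using that assms(1,3) by (simp add: frontier_cball)
qed (use assms in auto)

context stable_rational_map
begin

lemma holomorphic_on_E_comp:
  assumes "\<And>j. (\<lambda>x. Q x $ j) holomorphic_on S"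
  shows "(\<lambda>x. E n (Q x) $ i) holomorphic_on S"
proof -
  obtain W where W: "self_map W = E n" using E_poly by blast
  have "(\<lambda>x. self_map W (Q x) $ i) holomorphic_on S"
    unfolding self_map_def poly3_eval_def vec_lambda_beta by (intro holomorphic_intros assms)
  thus ?thesis unfolding W .
qed

text \<open>A one-variable Weierstrass preparation of the \<open>i\<close>-th component along a disc: \<open>m\<close> carries its \<open>N\<close>
  zeros in the disc and \<open>w\<close> its zero-free part, by which the whole map can be rescaled.\<close>

definition normal_form :: "complex^3 \<Rightarrow> complex^3 \<Rightarrow> 3 \<Rightarrow> real \<Rightarrow> nat \<Rightarrow> real \<Rightarrow> nat \<Rightarrow> complex poly \<Rightarrow> complex poly \<Rightarrow> bool" where
  "normal_form z0 v i \<rho> N C n m w \<longleftrightarrow> lead_coeff m = 1 \<and> degree m = N \<and> (\<forall>x\<in>cball 0 \<rho>. poly w x \<noteq> 0) \<and>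
    (\<forall>x. E n (z0 + x *s v) $ i = poly m x * poly w x) \<and>
    (\<forall>x\<in>cball 0 \<rho>. norm (E n (z0 + x *s v)) \<le> C * cmod (poly w x))"

text \<open>Component \<open>i\<close> is zero-free on the circle, so its zeros in the disc can be
  split off as a monic \<open>m\<close>, whose degree is the winding number and thus eventually
  constant. On the circle every component is at most a constant times component \<open>i\<close>,
  and the maximum principle for the quotient by the zero-free \<open>w\<close> extends the bound
  inward.\<close>

lemma eventually_normal_form:
  assumes conv: "converges z0 \<eta> n g" and ind: "indep3 z0 v b" and \<rho>: "0 < \<rho>" "\<rho> * norm v < \<eta>"
    and ch: "\<And>x. cmod x = \<rho> \<Longrightarrow> g (z0 + x *s v) \<in> chart i" and e0: "0 < e0"
  shows "\<exists>N C. 0 < C \<and> (\<forall>\<^sub>F k in sequentially. \<exists>m w. normal_form z0 v i \<rho> N C (n k) m w) \<and>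
    ((\<forall>x y. cmod x \<le> \<rho> \<longrightarrow> cmod y \<le> e0 \<longrightarrow> x \<noteq> 0 \<or> y \<noteq> 0 \<longrightarrow>
      g (z0 + x *s v + y *s b) \<in> chart i) \<longrightarrow> N = 0)"
proof -
  obtain N where N: "\<forall>\<^sub>F k in sequentially. (\<forall>x. cmod x = \<rho> \<longrightarrow> E (n k) (z0 + x *s v) $ i \<noteq> 0) \<and>
      wind \<rho> (\<lambda>x. E (n k) (z0 + x *s v) $ i) N" "(\<forall>x y. cmod x \<le> \<rho> \<longrightarrow> cmod y \<le> e0 \<longrightarrow> x \<noteq> 0 \<or> y \<noteq> 0 \<longrightarrow>
      g (z0 + x *s v + y *s b) \<in> chart i) \<longrightarrow> N = 0"
    using eventually_wind[OF conv ind \<rho> ch e0] by blast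
  let ?K = "(\<lambda>x. z0 + x *s v) ` sphere 0 \<rho>"
  have K: "compact ?K" by (intro compact_continuous_image continuous_intros compact_sphere)
  have KP: "?K \<subseteq> punct z0 \<eta>" using \<rho> by (auto intro!: punct_line[OF indep3_indep2[OF ind]])
  have gK: "g ` ?K \<subseteq> chart i" using ch by auto
  have "continuous_on ?K (\<lambda>u. affine i (g u))"
    by (rule continuous_on_compose2[OF continuous_on_affine _ gK])
      (use conv KP in \<open>auto simp: converges_def intro: continuous_on_subset\<close>)
  hence "bounded ((\<lambda>u. affine i (g u)) ` ?K)" using K compact_continuous_image compact_imp_bounded by blast
  then obtain C0 where C0: "C0 > 0" "\<And>u. u \<in> ?K \<Longrightarrow> norm (affine i (g u)) \<le> C0"
    unfolding bounded_pos by auto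
  \<comment> \<open>\<open>C0 + 1\<close> bounds the normalized iterates on the circle,
    \<open>(2 * \<rho>) ^ N\<close> bounds \<open>m\<close>, and \<open>3\<close> passes from
    components to the norm.\<close>
  define C where "C = 3 * ((C0 + 1) * (2 * \<rho>) ^ N)"
  have Cpos: "C > 0" using C0(1) \<rho>(1) by (simp add: C_def)
  have "\<forall>\<^sub>F k in sequentially. \<exists>m w. normal_form z0 v i \<rho> N C (n k) m w"
    using N(1) converges_affine[OF conv K KP gK zero_less_one]
  proof eventually_elim
    case (elim k)
    obtain p where p: "\<And>x. E (n k) (z0 + x *s v) $ i = poly p x" using poly_line by blast
    have pn: "poly p x \<noteq> 0" if "x \<in> sphere 0 \<rho>" for x using elim(1) that by (simp add: p)
    obtain m w where mw: "p = m * w" "lead_coeff m = 1" "\<forall>x\<in>cball 0 \<rho>. poly w x \<noteq> 0"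
      "wind \<rho> (poly p) (degree m)" "\<forall>x\<in>cball 0 \<rho>. cmod (poly m x) \<le> (2 * \<rho>) ^ degree m"
      using poly_zero_factor[OF \<rho>(1) pn] by blast
    have "wind \<rho> (poly p) N" using elim(1) by (simp add: p)
    hence deg: "degree m = N" using wind_unique[OF \<rho>(1) mw(4)] by simp
    have bound: "cmod (E (n k) (z0 + x *s v) $ j) \<le> ((C0 + 1) * (2 * \<rho>) ^ N) * cmod (poly w x)"
      if x: "x \<in> cball 0 \<rho>" for x j
    proof -
      let ?f = "\<lambda>x. E (n k) (z0 + x *s v) $ j / poly w x"
      have "cmod (?f x) \<le> (C0 + 1) * (2 * \<rho>) ^ N"
      proof (rule max_modulus_disc[OF \<rho>(1), where f = ?f and y = x])
        show "?f holomorphic_on cball 0 \<rho>"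
          using mw(3) by (intro holomorphic_on_divide holomorphic_on_E_line holomorphic_intros) auto
        fix y :: complex assume y: "cmod y = \<rho>"
        let ?e = "E (n k) (z0 + y *s v)"
        have ei: "?e $ i \<noteq> 0" "dist ((1 / ?e $ i) *s ?e) (affine i (g (z0 + y *s v))) < 1"
          using elim(2) y by auto
        have "norm ((1 / ?e $ i) *s ?e) \<le> norm (affine i (g (z0 + y *s v))) + dist ((1 / ?e $ i) *s ?e) (affine i (g (z0 + y *s v)))"
          unfolding dist_norm by (metis norm_triangle_sub)
        also have "\<dots> \<le> C0 + 1"
        proof -
          have "z0 + y *s v \<in> ?K" using y by (intro imageI) simp
          from C0(2)[OF this] show ?thesis using ei(2) by linarith
        qed
        finally have "norm ?e \<le> (C0 + 1) * cmod (?e $ i)" using ei(1) by (simp add: norm_smult norm_divide field_simps)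
        moreover have "cmod (?e $ j) \<le> norm ?e" by (rule Finite_Cartesian_Product.norm_nth_le)
        ultimately have "cmod (?e $ j) \<le> (C0 + 1) * cmod (?e $ i)" by linarith
        also have "cmod (?e $ i) = cmod (poly m y) * cmod (poly w y)" by (simp add: p mw(1) norm_mult)
        also have "(C0 + 1) * (cmod (poly m y) * cmod (poly w y)) \<le> (C0 + 1) * ((2 * \<rho>) ^ N * cmod (poly w y))"
          using mw(5) y deg C0(1) by (intro mult_left_mono mult_right_mono) auto
        finally have "cmod (?e $ j) \<le> (C0 + 1) * (2 * \<rho>) ^ N * cmod (poly w y)" by (simp only: mult.assoc)
        moreover have "poly w y \<noteq> 0" using mw(3) y by simp
        ultimately show "cmod (?f y) \<le> (C0 + 1) * (2 * \<rho>) ^ N" by (simp add: norm_divide divide_le_eq)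
      qed (use x in simp)
      moreover have "poly w x \<noteq> 0" using mw(3) x by blast
      ultimately show ?thesis by (simp add: norm_divide divide_le_eq)
    qed
    have "norm (E (n k) (z0 + x *s v)) \<le> C * cmod (poly w x)" if "x \<in> cball 0 \<rho>" for x
      using norm_vec3_le[OF bound[OF that]] by (simp add: C_def mult.assoc)
    thus ?case using mw(2,3) deg p mw(1) unfolding normal_form_def
      by (intro exI[of _ m] exI[of _ w]) auto
  qed
  thus ?thesis using Cpos N(2) by blast
qed

text \<open>After division by the zero-free \<open>w\<close>, the map is bounded and on every small circle it reaches a
  value bounded below by a fixed power of the radius. Only one constant \<open>M\<close> is used for all the bounds so
  that it can be chosen uniformly in the iterate.\<close>

definition vanishing_order_le :: "complex^3 \<Rightarrow> complex^3 \<Rightarrow> nat \<Rightarrow> nat \<Rightarrow> bool" where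
  "vanishing_order_le z0 v M n \<longleftrightarrow> (\<exists>w. (\<forall>x\<in>cball 0 (1 / M). poly w x \<noteq> 0 \<and> norm (E n (z0 + x *s v)) \<le> M * cmod (poly w x)) \<and>
    (\<forall>s. 0 < s \<and> s \<le> 1 / M \<longrightarrow> (\<exists>x. cmod x = s \<and> (s / M) ^ M * cmod (poly w x) \<le> norm (E n (z0 + x *s v)))))"

text \<open>The lower bound comes from the monic factor, which reaches \<open>s ^ N\<close> on the
  circle of radius \<open>s\<close>; as \<open>s \<le> 1\<close> and \<open>N \<le> M\<close>, this
  is at least \<open>(s / M) ^ M\<close>.\<close>

lemma normal_form_imp_vanishing_order_le:
  assumes "normal_form z0 v i \<rho> N C n m w" "0 < \<rho>" "real M \<ge> C" "M \<ge> N" "M \<ge> 1" "real M \<ge> 1 / \<rho>"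
  shows "vanishing_order_le z0 v M n"
  unfolding vanishing_order_le_def
proof (intro exI[of _ w] conjI ballI allI impI)
  have "1 / real M \<le> \<rho>" using assms by (simp add: field_simps)
  fix x :: complex assume "x \<in> cball 0 (1 / real M)"
  hence x: "x \<in> cball 0 \<rho>" using \<open>1 / real M \<le> \<rho>\<close> by auto
  thus "poly w x \<noteq> 0" using assms(1) unfolding normal_form_def by blast
  have "norm (E n (z0 + x *s v)) \<le> C * cmod (poly w x)" using assms(1) x unfolding normal_form_def by blast
  also have "\<dots> \<le> M * cmod (poly w x)" using assms(3) by (intro mult_right_mono) auto
  finally show "norm (E n (z0 + x *s v)) \<le> M * cmod (poly w x)" .
next
  fix s :: real assume s: "0 < s \<and> s \<le> 1 / M"
  have m: "lead_coeff m = 1" "degree m = N" using assms(1) unfolding normal_form_def by auto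
  obtain x where x: "cmod x = s" "cmod (poly m x) \<ge> s ^ N"
    using monic_lower_bound[OF m(1), of s] s m(2) by auto
  have "1 / real M \<le> 1" using assms(5) by simp
  hence s1: "s \<le> 1" using s by linarith
  have "s / M \<le> s" using s assms(5) by (simp add: field_simps)
  hence "(s / M) ^ M \<le> s ^ M" using s by (intro power_mono) auto
  also have "\<dots> \<le> s ^ N" using s s1 assms(4) by (intro power_decreasing) auto
  also have "\<dots> \<le> cmod (poly m x)" by (rule x(2))
  finally have "(s / M) ^ M * cmod (poly w x) \<le> cmod (poly m x) * cmod (poly w x)" by (intro mult_right_mono) auto
  also have "\<dots> = cmod (E n (z0 + x *s v) $ i)" using assms(1) by (simp add: normal_form_def norm_mult)
  also have "\<dots> \<le> norm (E n (z0 + x *s v))" by (rule Finite_Cartesian_Product.norm_nth_le)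
  finally show "\<exists>x. cmod x = s \<and> (s / M) ^ M * cmod (poly w x) \<le> norm (E n (z0 + x *s v))" using x(1) by blast
qed

text \<open>The form in which weak normality is used. The radius and the limit may depend on the
  subsequence.\<close>

definition all_subseq_converge :: "complex^3 \<Rightarrow> bool" where
  "all_subseq_converge z0 \<longleftrightarrow> (\<forall>r :: nat \<Rightarrow> nat. strict_mono r \<longrightarrow> (\<exists>(s :: nat \<Rightarrow> nat) \<eta> g. strict_mono s \<and> converges z0 \<eta> (r \<circ> s) g))"

lemma circle_in_chart_centered:
  assumes conv: "converges z0 \<eta> n g" and ind: "indep3 z0 v b"
  obtains \<rho> i where "0 < \<rho>" "\<rho> * norm v < \<eta>" "\<And>x. cmod x = \<rho> \<Longrightarrow> g (z0 + x *s v) \<in> chart i"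
proof -
  have v: "indep2 v z0" using indep3_indep2[OF ind] .
  have nv: "norm v > 0" using indep2_nonzero[OF v] by simp
  have \<eta>: "\<eta> > 0" using conv by (simp add: converges_def)
  define R where "R = \<eta> / (2 * norm v)"
  have R: "R > 0" "R * norm v < \<eta>" using nv \<eta> by (simp_all add: R_def)
  obtain \<rho> i where "R / 2 < \<rho>" "\<rho> < R" "\<And>x. cmod x = \<rho> \<Longrightarrow> g (z0 + x *s v) \<in> chart i"
    using circle_in_chart[OF conv v, of "R / 2" R] R by auto
  moreover have "\<rho> * norm v < \<eta>"
    using R(2) mult_right_mono[of \<rho> R "norm v"] calculation(2) by auto
  ultimately show ?thesis using that[of \<rho> i] R(1) by auto
qed

text \<open>By contradiction: a sequence of iterates violating the bound for larger and larger \<open>M\<close> has a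
  convergent subsequence, to which the normal form applies with fixed constants.\<close>

lemma eventually_vanishing_order_le:
  assumes nrm: "all_subseq_converge z0" and ind: "indep3 z0 v b"
  shows "\<exists>M\<ge>1. \<exists>n0. \<forall>n\<ge>n0. vanishing_order_le z0 v M n"
proof (rule ccontr)
  assume "\<not> ?thesis"
  hence *: "\<exists>n\<ge>n0. \<not> vanishing_order_le z0 v (Suc k) n" for k n0 by force
  have "\<exists>r::nat \<Rightarrow> nat. \<forall>k. \<not> vanishing_order_le z0 v (Suc k) (r k) \<and> r k < r (Suc k)"
    by (rule dependent_nat_choice) (use * Suc_le_eq in blast)+
  then obtain r :: "nat \<Rightarrow> nat" where r: "\<And>k. \<not> vanishing_order_le z0 v (Suc k) (r k)" "\<And>k. r k < r (Suc k)" by blast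
  have "strict_mono r" using r(2) by (simp add: strict_mono_Suc_iff)
  then obtain s \<eta> g where s: "strict_mono s" and conv: "converges z0 \<eta> (r \<circ> s) g"
    using nrm unfolding all_subseq_converge_def by blast
  obtain \<rho> i where \<rho>: "0 < \<rho>" "\<rho> * norm v < \<eta>" "\<And>x. cmod x = \<rho> \<Longrightarrow> g (z0 + x *s v) \<in> chart i"
    using circle_in_chart_centered[OF conv ind] by blast
  obtain N C where NC: "0 < C" "\<forall>\<^sub>F k in sequentially. \<exists>m w. normal_form z0 v i \<rho> N C ((r \<circ> s) k) m w"
    using eventually_normal_form[OF conv ind \<rho> zero_less_one] by blast
  obtain M0 :: nat where M0: "real M0 \<ge> C + N + 1 / \<rho>" using real_arch_simple by blast
  have "\<forall>\<^sub>F k in sequentially. k \<ge> M0" by (rule eventually_ge_at_top)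
  with NC(2) have "\<forall>\<^sub>F k in sequentially. False"
  proof eventually_elim
    case (elim k)
    then obtain m w where nf: "normal_form z0 v i \<rho> N C (r (s k)) m w" by auto
    have "s k \<ge> k" using s by (rule seq_suble)
    hence "Suc (s k) \<ge> M0" using elim(2) by simp
    hence big: "real (Suc (s k)) \<ge> C + N + 1 / \<rho>" using M0 by linarith
    have "1 / \<rho> > 0" using \<rho>(1) by simp
    have "vanishing_order_le z0 v (Suc (s k)) (r (s k))"
      by (rule normal_form_imp_vanishing_order_le[OF nf \<rho>(1)]) (use big NC(1) \<open>1 / \<rho> > 0\<close> in linarith)+
    thus False using r(1) by blast
  qed
  thus False by simp
qed

text \<open>The zero-free factors \<open>w k\<close> come from normal forms, and the convergence
  includes the centre \<open>x = 0\<close>, where \<open>Q\<close> may vanish. The last clause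
  excludes the zero limit, which would carry no projective information.\<close>

definition blowup_limit :: "complex^3 \<Rightarrow> complex^3 \<Rightarrow> real \<Rightarrow> (nat \<Rightarrow> nat) \<Rightarrow> (nat \<Rightarrow> complex poly) \<Rightarrow> (complex \<Rightarrow> complex^3) \<Rightarrow> bool" where
  "blowup_limit z0 v \<rho> n w Q \<longleftrightarrow> (\<forall>j. (\<lambda>x. Q x $ j) holomorphic_on ball 0 \<rho>) \<and>
    (\<forall>k. \<forall>x\<in>ball 0 \<rho>. poly (w k) x \<noteq> 0) \<and>
    (\<forall>K. compact K \<longrightarrow> K \<subseteq> ball 0 \<rho> \<longrightarrow>
      uniform_limit K (\<lambda>k x. (1 / poly (w k) x) *s E (n k) (z0 + x *s v)) Q sequentially) \<and>
    (\<exists>x\<in>ball 0 \<rho>. Q x \<noteq> 0)"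

lemma uniform_limit_vec3:
  fixes V :: "nat \<Rightarrow> 'a \<Rightarrow> complex^3"
  assumes "\<And>j. uniform_limit K (\<lambda>k x. V k x $ j) (\<lambda>x. Q x $ j) sequentially"
  shows "uniform_limit K V Q sequentially"
proof (rule uniform_limitI)
  fix e :: real assume e: "e > 0"
  have "\<forall>\<^sub>F k in sequentially. \<forall>j\<in>UNIV. \<forall>x\<in>K. dist (V k x $ j) (Q x $ j) < e / 6"
    by (rule eventually_ball_finite) (use uniform_limitD[OF assms, of "e / 6"] e in auto)
  thus "\<forall>\<^sub>F k in sequentially. \<forall>x\<in>K. dist (V k x) (Q x) < e"
  proof eventually_elim
    case (elim k)
    show ?case
    proof
      fix x assume "x \<in> K"
      hence "dist (V k x $ j) (Q x $ j) < e / 6" for j using elim by blast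
      hence "cmod ((V k x - Q x) $ j) \<le> e / 6" for j by (simp add: dist_norm less_imp_le)
      from norm_vec3_le[OF this] show "dist (V k x) (Q x) < e" using e by (simp add: dist_norm)
    qed
  qed
qed

text \<open>The bound \<open>C\<close> makes Montel's theorem applicable. The limit is not
  identically zero because the \<open>i\<close>-th rescaled component is the monic polynomial
  \<open>m k\<close>, which is at least \<open>s ^ N\<close> somewhere on the circle of radius
  \<open>s\<close>; for \<open>N = 0\<close> it is the constant \<open>1\<close>.\<close>

lemma exists_blowup_limit:
  assumes ev: "\<forall>\<^sub>F k in sequentially. \<exists>m w. normal_form z0 v i \<rho> N C (n k) m w" and \<rho>: "0 < \<rho>"
  shows "\<exists>s w Q. strict_mono s \<and> blowup_limit z0 v \<rho> (n \<circ> s) w Q \<and> (N = 0 \<longrightarrow> Q 0 \<noteq> 0)"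
proof -
  obtain k1 where "\<forall>k\<ge>k1. \<exists>m w. normal_form z0 v i \<rho> N C (n k) m w"
    using ev unfolding eventually_sequentially by blast
  \<comment> \<open>The shift by \<open>k1\<close> discards the finitely many iterates not known to
    have a normal form.\<close>
  hence "\<forall>k. \<exists>m w. normal_form z0 v i \<rho> N C (n (k + k1)) m w" by simp
  then obtain m w where nf: "\<And>k. normal_form z0 v i \<rho> N C (n (k + k1)) (m k) (w k)" by metis
  have w: "poly (w k) x \<noteq> 0" if "x \<in> ball 0 \<rho>" for k x
    using nf[of k] that unfolding normal_form_def by auto
  define F where "F j k x = E (n (k + k1)) (z0 + x *s v) $ j / poly (w k) x" for j :: 3 and k x
  have holF: "F j k holomorphic_on ball 0 \<rho>" for j k
    unfolding F_def using w by (intro holomorphic_on_divide holomorphic_on_E_line holomorphic_intros) auto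
  have bdF: "cmod (F j k x) \<le> C" if x: "x \<in> ball 0 \<rho>" for j k x
  proof -
    have "cmod (E (n (k + k1)) (z0 + x *s v) $ j) \<le> norm (E (n (k + k1)) (z0 + x *s v))"
      by (rule Finite_Cartesian_Product.norm_nth_le)
    also have "\<dots> \<le> C * cmod (poly (w k) x)" using nf[of k] x unfolding normal_form_def by auto
    finally show ?thesis using w[OF x] by (simp add: F_def norm_divide divide_le_eq)
  qed
  obtain r q where rq: "strict_mono (r :: nat \<Rightarrow> nat)" "\<forall>j. q j holomorphic_on ball 0 \<rho> \<and>
    (\<forall>K. compact K \<longrightarrow> K \<subseteq> ball 0 \<rho> \<longrightarrow> uniform_limit K (\<lambda>k. F j (r k)) (q j) sequentially)"
  proof -
    have "\<exists>r q. strict_mono (r :: nat \<Rightarrow> nat) \<and> (\<forall>j. q j holomorphic_on ball 0 \<rho> \<and>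
      (\<forall>K. compact K \<longrightarrow> K \<subseteq> ball 0 \<rho> \<longrightarrow> uniform_limit K (\<lambda>k. F j (r k)) (q j) sequentially))"
      by (rule Montel_finite[OF open_ball holF]) (rule bdF)
    thus ?thesis using that by (elim exE conjE)
  qed
  note r = rq(1)
  have q: "q j holomorphic_on ball 0 \<rho>"
    "compact K \<Longrightarrow> K \<subseteq> ball 0 \<rho> \<Longrightarrow> uniform_limit K (\<lambda>k. F j (r k)) (q j) sequentially" for j K
    using rq(2) by auto
  define Q where "Q x = (\<chi> j. q j x)" for x
  have Fi: "F i k x = poly (m k) x" if "x \<in> ball 0 \<rho>" for k x
    using nf[of k] w[OF that, of k] by (simp add: F_def normal_form_def)
  have "strict_mono (\<lambda>k. r k + k1)" using r by (simp add: strict_mono_def)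
  moreover have "blowup_limit z0 v \<rho> (n \<circ> (\<lambda>k. r k + k1)) (\<lambda>k. w (r k)) Q"
    unfolding blowup_limit_def
  proof (intro conjI allI impI ballI)
    show "(\<lambda>x. Q x $ j) holomorphic_on ball 0 \<rho>" for j using q(1) by (simp add: Q_def)
    show "poly (w (r k)) x \<noteq> 0" if "x \<in> ball 0 \<rho>" for k x using w that by blast
    show "uniform_limit K (\<lambda>k x. (1 / poly (w (r k)) x) *s E ((n \<circ> (\<lambda>k. r k + k1)) k) (z0 + x *s v)) Q sequentially"
      if "compact K" "K \<subseteq> ball 0 \<rho>" for K
      by (rule uniform_limit_vec3) (use q(2)[OF that] in \<open>simp add: Q_def F_def[abs_def]\<close>)
    show "\<exists>x\<in>ball 0 \<rho>. Q x \<noteq> 0"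
    proof (rule ccontr)
      assume "\<not> ?thesis"
      hence Q0: "q i x = 0" if "x \<in> ball 0 \<rho>" for x using that by (auto simp: Q_def vec_eq_iff)
      define s where "s = \<rho> / 2"
      have s: "s > 0" "sphere 0 s \<subseteq> ball 0 \<rho>" using \<rho> by (auto simp: s_def)
      have "\<forall>\<^sub>F k in sequentially. \<forall>x\<in>sphere 0 s. dist (F i (r k) x) (q i x) < s ^ N"
        using uniform_limitD[OF q(2)[OF compact_sphere s(2)], of "s ^ N"] s(1) by simp
      then obtain k where k: "\<And>x. x \<in> sphere 0 s \<Longrightarrow> dist (F i (r k) x) (q i x) < s ^ N"
        unfolding eventually_sequentially by blast
      obtain x where x: "cmod x = s" "s ^ degree (m (r k)) \<le> cmod (poly (m (r k)) x)"
        using monic_lower_bound[OF _ s(1), of "m (r k)"] nf[of "r k"] unfolding normal_form_def by blast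
      have xs: "x \<in> sphere 0 s" using x(1) by simp
      hence "x \<in> ball 0 \<rho>" using s(2) by blast
      hence "cmod (poly (m (r k)) x) < s ^ N" using k[OF xs] Q0 Fi by simp
      thus False using x(2) nf[of "r k"] unfolding normal_form_def by auto
    qed
  qed
  moreover have "Q 0 \<noteq> 0" if "N = 0"
  proof -
    have "m k = 1" for k
    proof -
      have d: "degree (m k) = 0" and l: "lead_coeff (m k) = 1"
        using nf[of k] that unfolding normal_form_def by auto
      obtain a where "m k = [:a:]" using d by (rule degree_eq_zeroE)
      thus ?thesis using l by (simp add: one_pCons)
    qed
    hence "F i k 0 = 1" for k using Fi[of 0 k] \<rho> by simp
    moreover have "(\<lambda>k. F i (r k) 0) \<longlonglongrightarrow> q i 0"
      using q(2)[of "{0}" i] \<rho> by simp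
    ultimately have "q i 0 = 1" by (simp add: LIMSEQ_const_iff)
    thus ?thesis by (auto simp: Q_def vec_eq_iff intro!: exI[of _ i])
  qed
  ultimately show ?thesis by blast
qed

end

section \<open>No blow-up at an isolated point\<close>

text \<open>Two vectors do not span a space of dimension three.\<close>

lemma indep3_exists:
  assumes "indep2 a z"
  shows "\<exists>b. indep3 z a b"
proof -
  have "card {z, a} < vec.dim (UNIV :: (complex^3) set)"
  proof -
    have "card {z, a} \<le> 2" by (simp add: card_insert_if)
    thus ?thesis by (simp add: vec.dim_UNIV card_cart_basis)
  qed
  moreover have "vec.dim (vec.span {z, a}) \<le> card {z, a}"
    by (intro vec.dim_le_card) (auto simp: vec.span_superset)
  ultimately have "vec.span {z, a} \<noteq> UNIV" by (metis leD)
  then obtain b where b: "b \<notin> vec.span {z, a}" by blast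
  have "indep3 z a b"
    unfolding indep3_def
  proof (intro allI impI, rule ccontr)
    fix x y :: complex assume xy: "x \<noteq> 0 \<or> y \<noteq> 0" and n: "\<not> indep2 (x *s a + y *s b) z"
    have "z \<noteq> 0" using assms by (auto simp: indep2_def)
    from not_indep2D[OF n this] obtain c where c: "x *s a + y *s b = c *s z" by blast
    show False
    proof (cases "y = 0")
      case True
      hence "a = (c / x) *s z" using c xy by (auto simp: vec_eq_iff field_simps)
      thus False using assms by (auto simp: indep2_def)
    next
      case False
      hence "b = (c / y) *s z + (- x / y) *s a"
        using c by (simp add: vec_eq_iff field_simps)
      thus False using b
        by (metis insertCI vec.span_add vec.span_base vec.span_scale)
    qed
  qed
  thus ?thesis by blast
qed

lemma holomorphic_zero_linear_bound:
  assumes "f holomorphic_on ball 0 \<rho>" "0 < \<rho>" "f 0 = (0::complex)"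
  shows "\<exists>C>0. \<exists>r>0. \<forall>x. cmod x < r \<longrightarrow> cmod (f x) \<le> C * cmod x"
proof -
  have "f field_differentiable at 0"
    using assms holomorphic_on_imp_differentiable_at open_ball centre_in_ball by blast
  then obtain D where "(f has_field_derivative D) (at 0)" unfolding field_differentiable_def by blast
  hence "((\<lambda>x. f x / x) \<longlongrightarrow> D) (at 0)" using assms(3) by (simp add: has_field_derivative_iff)
  hence "\<forall>\<^sub>F x in at 0. dist (f x / x) D < 1" using tendstoD zero_less_one by blast
  then obtain r where r: "r > 0" "\<And>x. x \<noteq> 0 \<Longrightarrow> dist x 0 < r \<Longrightarrow> dist (f x / x) D < 1"
    unfolding eventually_at by blast
  have "cmod (f x) \<le> (cmod D + 1) * cmod x" if x: "cmod x < r" for x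
  proof (cases "x = 0")
    case False
    hence "dist (f x / x) D < 1" using r(2) x by simp
    hence "cmod (f x / x) \<le> cmod D + 1" using norm_triangle_sub[of "f x / x" D] by (simp add: dist_norm)
    thus ?thesis using False by (simp add: norm_divide divide_le_eq)
  qed (use assms(3) in simp)
  moreover have "cmod D + 1 > 0" using norm_ge_zero[of D] by linarith
  ultimately show ?thesis using r(1) by blast
qed

context stable_rational_map
begin

lemma blowup_limit_nth:
  assumes "blowup_limit z0 v \<rho> n w Q" "x \<in> ball 0 \<rho>"
  shows "(\<lambda>k. (1 / poly (w k) x) *s E (n k) (z0 + x *s v)) \<longlonglongrightarrow> Q x"
proof -
  have "uniform_limit {x} (\<lambda>k x. (1 / poly (w k) x) *s E (n k) (z0 + x *s v)) Q sequentially"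
    using assms unfolding blowup_limit_def by (auto simp del: uniform_limit_singleton)
  thus ?thesis by simp
qed

text \<open>Scaling by \<open>w k\<close> does not change projective points, so both descriptions of
  the limit agree wherever \<open>Q\<close> is nonzero.\<close>

lemma blowup_limit_proj:
  assumes "blowup_limit z0 v \<rho> n w Q" "converges z0 \<eta> n g" "x \<in> ball 0 \<rho>" "Q x \<noteq> 0" "z0 + x *s v \<in> punct z0 \<eta>"
  shows "g (z0 + x *s v) = proj (Q x)"
proof -
  let ?u = "z0 + x *s v"
  have lim: "(\<lambda>k. (1 / poly (w k) x) *s E (n k) ?u) \<longlonglongrightarrow> Q x" by (rule blowup_limit_nth[OF assms(1,3)])
  have ev: "\<forall>\<^sub>F k in sequentially. E (n k) ?u \<noteq> 0 \<and> dist (proj (E (n k) ?u)) (g ?u) < e" if "e > 0" for e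
    using assms(2,5) that unfolding converges_def by (auto dest!: spec[of _ "{?u}"])
  have w: "poly (w k) x \<noteq> 0" for k using assms(1,3) unfolding blowup_limit_def by blast
  have "(\<lambda>k. proj ((1 / poly (w k) x) *s E (n k) ?u)) \<longlonglongrightarrow> proj (Q x)"
  proof (rule continuous_on_tendsto_compose[OF continuous_on_proj lim])
    show "\<forall>\<^sub>F k in sequentially. (1 / poly (w k) x) *s E (n k) ?u \<in> - {0}"
      using ev[OF zero_less_one] by eventually_elim (use w in \<open>simp add: smult_eq_0_iff\<close>)
  qed (use assms(4) in simp)
  moreover have "proj ((1 / poly (w k) x) *s E (n k) ?u) = proj (E (n k) ?u)" for k
    using w[of k] by (intro proj_smult) simp
  ultimately have 1: "(\<lambda>k. proj (E (n k) ?u)) \<longlonglongrightarrow> proj (Q x)" by simp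
  have "(\<lambda>k. proj (E (n k) ?u)) \<longlonglongrightarrow> g ?u"
  proof (rule tendstoI)
    fix e :: real assume "e > 0"
    from ev[OF this] show "\<forall>\<^sub>F k in sequentially. dist (proj (E (n k) ?u)) (g ?u) < e"
      by eventually_elim simp
  qed
  with 1 show ?thesis using LIMSEQ_unique by blast
qed

text \<open>If the rescaled iterates \<open>E (n k) / w k\<close> tend to a disc through the origin, then composing with
  \<open>E j\<close> multiplies the order of vanishing there by \<open>d ^ j\<close>; as the order stays bounded by \<open>M\<close> along all
  iterates, the limit disc must lie in the indeterminacy cone of \<open>E j\<close> once \<open>d ^ j > M\<close>.\<close>

lemma blowup_in_indeterminacy:
  assumes bl: "blowup_limit z0 v \<rho> n w Q" and \<rho>: "0 < \<rho>" and n: "strict_mono n" and Q0: "Q 0 = 0"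
    and vanishing_order_le: "M \<ge> 1" "\<And>l. l \<ge> n0 \<Longrightarrow> vanishing_order_le z0 v M l"
  shows "\<exists>j. \<forall>x\<in>ball 0 \<rho>. E j (Q x) = 0"
proof (rule ccontr)
  assume no: "\<not> ?thesis"
  \<comment> \<open>Any \<open>j\<close> with \<open>d ^ j > M\<close> serves;
    \<open>2 ^ M > M\<close> makes \<open>M\<close> such an exponent.\<close>
  define j where "j = M"
  define D where "D = d ^ j"
  have "M < 2 ^ M" by (rule less_exp)
  also have "(2::nat) ^ M \<le> d ^ M" using d_ge_2 by (rule power_mono) simp
  finally have DM: "D \<ge> Suc M" by (simp add: D_def j_def)
  have holQ: "(\<lambda>x. Q x $ l) holomorphic_on ball 0 \<rho>" for l using bl unfolding blowup_limit_def by blast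
  have wnz: "poly (w k) x \<noteq> 0" if "x \<in> ball 0 \<rho>" for k x using bl that unfolding blowup_limit_def by blast
  define V where "V k x = (1 / poly (w k) x) *s E (n k) (z0 + x *s v)" for k x
  have unif: "uniform_limit K V Q sequentially" if "compact K" "K \<subseteq> ball 0 \<rho>" for K
    using bl that unfolding blowup_limit_def V_def by blast
  have contQ: "continuous_on (ball 0 \<rho>) Q"
  proof -
    have "continuous_on (ball 0 \<rho>) (\<lambda>x. \<chi> j. Q x $ j)"
      by (intro continuous_intros holomorphic_on_imp_continuous_on[OF holQ])
    thus ?thesis by simp
  qed
  obtain x1 where x1: "x1 \<in> ball 0 \<rho>" "E j (Q x1) \<noteq> 0" using no by blast
  then obtain l where l: "E j (Q x1) $ l \<noteq> 0" by (auto simp: vec_eq_iff)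
  define h where "h x = E j (Q x) $ l" for x
  have holh: "h holomorphic_on ball 0 \<rho>" unfolding h_def by (rule holomorphic_on_E_comp[OF holQ])
  have h0: "h 0 = 0" by (simp add: h_def Q0)
  have hx1: "h x1 \<noteq> 0" using l by (simp add: h_def)
  have in0: "0 \<in> ball (0::complex) \<rho>" using \<rho> by simp
  obtain r where r: "0 < r" "ball (0::complex) r \<subseteq> ball 0 \<rho>" "\<And>x. x \<in> ball 0 r - {0} \<Longrightarrow> h x \<noteq> 0"
    by (rule isolated_zeros[OF holh open_ball connected_ball in0 h0 x1(1) hx1], rule that)
  \<comment> \<open>On the circle of radius \<open>\<rho>'\<close> the composed limit is nonzero
    since the zeros of \<open>h\<close> are isolated, and \<open>1 / M\<close> is the radius up to
    which the order bound speaks.\<close>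
  define \<rho>' where "\<rho>' = min r (1 / M) / 2"
  have \<rho>': "0 < \<rho>'" "\<rho>' < r" "\<rho>' \<le> 1 / M" using r(1) vanishing_order_le(1) by (auto simp: \<rho>'_def min_def field_simps)
  have sub: "sphere (0::complex) \<rho>' \<subseteq> ball 0 \<rho>" "cball (0::complex) \<rho>' \<subseteq> ball 0 \<rho>"
  proof -
    have "cball (0::complex) \<rho>' \<subseteq> ball 0 r" using \<rho>'(2) by auto
    thus c: "cball (0::complex) \<rho>' \<subseteq> ball 0 \<rho>" using r(2) by blast
    have "sphere (0::complex) \<rho>' \<subseteq> cball 0 \<rho>'" by auto
    thus "sphere (0::complex) \<rho>' \<subseteq> ball 0 \<rho>" using c by blast
  qed
  have cQs: "compact (Q ` sphere 0 \<rho>')"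
    by (intro compact_continuous_image continuous_on_subset[OF contQ sub(1)] compact_sphere)
  obtain c where c: "c > 0" "\<And>x. x \<in> sphere 0 \<rho>' \<Longrightarrow> 2 * c \<le> norm (E j (Q x))"
  proof -
    have cont: "continuous_on (sphere 0 \<rho>') (\<lambda>x. norm (E j (Q x)))"
      by (intro continuous_intros continuous_on_subset[OF contQ sub(1)])
    have ne: "sphere (0::complex) \<rho>' \<noteq> {}" using \<rho>'(1) by simp
    obtain y where y: "y \<in> sphere 0 \<rho>'" "\<And>x. x \<in> sphere 0 \<rho>' \<Longrightarrow> norm (E j (Q y)) \<le> norm (E j (Q x))"
      using continuous_attains_inf[OF compact_sphere ne cont] by blast
    have "y \<in> ball 0 r - {0}" using y(1) \<rho>' by auto
    hence "E j (Q y) \<noteq> 0" using r(3)[of y] by (auto simp: h_def)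
    thus ?thesis using that[of "norm (E j (Q y)) / 2"] y(2) by simp
  qed
  obtain \<delta> where \<delta>: "\<delta> > 0" "\<And>x y. x \<in> Q ` sphere 0 \<rho>' \<Longrightarrow> dist x y < \<delta> \<Longrightarrow> dist (E j x) (E j y) < c"
    using compact_uniform_nbhd[OF cQs subset_UNIV open_UNIV continuous_on_E[OF continuous_on_id, of UNIV j] c(1)]
    by blast
  have ev1: "\<forall>\<^sub>F k in sequentially. \<forall>x\<in>sphere 0 \<rho>'. dist (V k x) (Q x) < \<delta>"
    by (rule uniform_limitD[OF unif[OF compact_sphere sub(1)] \<delta>(1)])
  have "\<exists>C>0. \<exists>r>0. \<forall>x. cmod x < r \<longrightarrow> cmod (Q x $ l) \<le> C * cmod x" for l
    by (rule holomorphic_zero_linear_bound[OF holQ \<rho>]) (simp add: Q0)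
  then obtain Cq rq where Cq: "\<And>l. Cq l > 0" "\<And>l. rq l > (0::real)" "\<And>l x. cmod x < rq l \<Longrightarrow> cmod (Q x $ l) \<le> Cq l * cmod x"
    by metis
  define C where "C = (\<Sum>l\<in>UNIV. Cq l)"
  define r0 where "r0 = Min (range rq)"
  have r0: "r0 > 0" "r0 \<le> rq l" for l using Cq(2) by (auto simp: r0_def)
  have CqC: "Cq l \<le> C" for l unfolding C_def using Cq(1) by (intro member_le_sum) (auto intro: less_imp_le)
  have Cpos: "C > 0" using CqC Cq(1) less_le_trans by blast
  have Qlin: "norm (Q x) \<le> 3 * (C * cmod x)" if "cmod x < r0" for x
  proof (rule norm_vec3_le)
    fix l
    have "cmod (Q x $ l) \<le> Cq l * cmod x" using Cq(3) that r0(2)[of l] by auto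
    also have "\<dots> \<le> C * cmod x" using CqC by (intro mult_right_mono) auto
    finally show "cmod (Q x $ l) \<le> C * cmod x" .
  qed
  obtain Cj where Cj: "Cj > 0" "\<And>z. norm (E j z) \<le> Cj * norm z ^ D"
    using E_growth[of j] unfolding D_def by blast
  \<comment> \<open>\<open>3 * C\<close> bounds the growth of \<open>Q\<close> at the origin, and
    \<open>1\<close> absorbs the distance from \<open>V k\<close> to \<open>Q\<close>, which is
    chosen below the radius \<open>s\<close>.\<close>
  define A where "A = 3 * C + 1"
  have A: "A > 0" using Cpos by (simp add: A_def)
  \<comment> \<open>The index \<open>k\<close> depends on \<open>s\<close>. The power
    \<open>poly (w k) x ^ D\<close> and the normalization \<open>w'\<close> of the composed iterate
    have the quotient \<open>f\<close>, which is bounded on the outer circle because the composed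
    limit is bounded below there, hence bounded inside. On the circle of radius \<open>s\<close> the
    order bound then gives a lower estimate of order \<open>M\<close> against an upper one of order
    \<open>D\<close>.\<close>
  have main: "(s / M) ^ M \<le> M / c * (Cj * (A * s) ^ D)" if s: "0 < s" "s < r0" "s < \<rho>'" for s
  proof -
    have "sphere (0::complex) s \<subseteq> cball 0 \<rho>'" using s(3) by auto
    hence subs: "sphere (0::complex) s \<subseteq> ball 0 \<rho>" using sub(2) by blast
    have ev2: "\<forall>\<^sub>F k in sequentially. \<forall>x\<in>sphere 0 s. dist (V k x) (Q x) < s"
      by (rule uniform_limitD[OF unif[OF compact_sphere subs] s(1)])
    have ev3: "\<forall>\<^sub>F k in sequentially. k \<ge> n0" by (rule eventually_ge_at_top)
    obtain k where k: "\<And>x. x \<in> sphere 0 \<rho>' \<Longrightarrow> dist (V k x) (Q x) < \<delta>"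
      "\<And>x. x \<in> sphere 0 s \<Longrightarrow> dist (V k x) (Q x) < s" "k \<ge> n0"
      using eventually_conj[OF ev1 eventually_conj[OF ev2 ev3]] unfolding eventually_sequentially by blast
    have "n k \<ge> k" using n by (rule seq_suble)
    hence "vanishing_order_le z0 v M (j + n k)" using k(3) by (intro vanishing_order_le(2)) simp
    then obtain w' where w': "\<And>x. x \<in> cball 0 (1 / M) \<Longrightarrow> poly w' x \<noteq> 0 \<and> norm (E (j + n k) (z0 + x *s v)) \<le> M * cmod (poly w' x)"
      "\<And>s. 0 < s \<Longrightarrow> s \<le> 1 / M \<Longrightarrow> \<exists>x. cmod x = s \<and> (s / M) ^ M * cmod (poly w' x) \<le> norm (E (j + n k) (z0 + x *s v))"
      unfolding vanishing_order_le_def by blast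
    have EV: "norm (E (j + n k) (z0 + x *s v)) = cmod (poly (w k) x) ^ D * norm (E j (V k x))" if "x \<in> ball 0 \<rho>" for x
    proof -
      have "E (n k) (z0 + x *s v) = poly (w k) x *s V k x" using wnz[OF that] by (simp add: V_def)
      thus ?thesis by (simp add: E_add E_smult norm_smult norm_power D_def)
    qed
    define f where "f x = poly (w k) x ^ D / poly w' x" for x
    have w'c: "poly w' x \<noteq> 0" if "x \<in> cball 0 \<rho>'" for x using w'(1) that \<rho>'(3) by auto
    have fb: "cmod (f y) \<le> M / c" if "cmod y \<le> \<rho>'" for y
    proof (rule max_modulus_disc[OF \<rho>'(1), where f = f and y = y])
      show "f holomorphic_on cball 0 \<rho>'" unfolding f_def using w'c by (intro holomorphic_intros) auto
      fix x :: complex assume x: "cmod x = \<rho>'"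
      have xs1: "x \<in> sphere 0 \<rho>'" "x \<in> cball 0 (1 / M)" using x \<rho>'(3) by auto
      have "x \<in> ball 0 \<rho>" using xs1(1) sub(1) by blast
      note xs = xs1(1) this xs1(2)
      have "dist (E j (Q x)) (E j (V k x)) < c" using \<delta>(2)[of "Q x" "V k x"] k(1)[OF xs(1)] xs(1) by (simp add: dist_commute)
      hence "c \<le> norm (E j (V k x))" using c(2)[OF xs(1)] norm_triangle_ineq2[of "E j (Q x)" "E j (V k x)"] by (simp add: dist_norm)
      hence "cmod (poly (w k) x) ^ D * c \<le> cmod (poly (w k) x) ^ D * norm (E j (V k x))" by (intro mult_left_mono) auto
      also have "\<dots> \<le> M * cmod (poly w' x)" using w'(1)[OF xs(3)] EV[OF xs(2)] by simp
      finally have "cmod (poly (w k) x) ^ D * c \<le> M * cmod (poly w' x)" .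
      thus "cmod (f x) \<le> M / c"
        using c(1) w'(1)[OF xs(3)] by (simp add: f_def norm_divide norm_power field_simps)
    qed (rule that)
    obtain x where x: "cmod x = s" "(s / M) ^ M * cmod (poly w' x) \<le> norm (E (j + n k) (z0 + x *s v))"
      using w'(2)[OF s(1)] s(3) \<rho>'(3) by auto
    have xs: "x \<in> sphere 0 s" "cmod x \<le> \<rho>'" using x(1) s(3) by auto
    hence xb: "x \<in> ball 0 \<rho>" using subs by blast
    have "norm (V k x) \<le> norm (Q x) + dist (V k x) (Q x)"
      unfolding dist_norm by (metis norm_triangle_sub)
    also have "\<dots> \<le> 3 * (C * s) + s" using Qlin[of x] k(2)[OF xs(1)] x(1) s(2) by simp
    also have "\<dots> = A * s" by (simp add: A_def algebra_simps)
    finally have Vn: "norm (V k x) \<le> A * s" .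
    have nw: "cmod (poly w' x) > 0" using w'c[of x] xs(2) by simp
    have "(s / M) ^ M * cmod (poly w' x) \<le> cmod (poly (w k) x) ^ D * norm (E j (V k x))"
      using x(2) EV[OF xb] by simp
    also have "\<dots> \<le> cmod (poly (w k) x) ^ D * (Cj * (A * s) ^ D)"
    proof (rule mult_left_mono)
      have "norm (E j (V k x)) \<le> Cj * norm (V k x) ^ D" by (rule Cj(2))
      also have "\<dots> \<le> Cj * (A * s) ^ D" using Cj(1) Vn by (intro mult_left_mono power_mono) auto
      finally show "norm (E j (V k x)) \<le> Cj * (A * s) ^ D" .
    qed simp
    also have "cmod (poly (w k) x) ^ D = cmod (f x) * cmod (poly w' x)"
      using nw by (simp add: f_def norm_divide norm_power)
    finally have "(s / M) ^ M * cmod (poly w' x) \<le> (cmod (f x) * (Cj * (A * s) ^ D)) * cmod (poly w' x)"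
      by (simp only: mult_ac)
    hence "(s / M) ^ M \<le> cmod (f x) * (Cj * (A * s) ^ D)" using nw by (simp only: mult_le_cancel_right_pos)
    also have "\<dots> \<le> M / c * (Cj * (A * s) ^ D)"
      using fb[OF xs(2)] Cj(1) A s(1) by (intro mult_right_mono) auto
    finally show ?thesis .
  qed
  define B where "B = M / c * (Cj * A ^ D) * M ^ M"
  have B: "B > 0" using vanishing_order_le(1) c(1) Cj(1) A by (simp add: B_def)
  \<comment> \<open>Small enough that \<open>s * B < 1\<close>; with \<open>D \<ge> Suc M\<close>
    the two estimates then contradict each other.\<close>
  define m where "m = min (min r0 \<rho>') (min 1 (1 / B))"
  have m: "m > 0" "m \<le> r0" "m \<le> \<rho>'" "m \<le> 1" "m \<le> 1 / B"
    using r0(1) \<rho>'(1) B by (auto simp: m_def)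
  have "m * B \<le> 1" using m(5) B by (simp add: pos_le_divide_eq)
  define s where "s = m / 2"
  have s: "0 < s" "s < r0" "s < \<rho>'" "s \<le> 1" "s * B < 1"
    using m \<open>m * B \<le> 1\<close> by (auto simp: s_def)
  have "s ^ M = (s / M) ^ M * M ^ M" using vanishing_order_le(1) by (simp add: power_divide)
  also have "\<dots> \<le> M / c * (Cj * (A * s) ^ D) * M ^ M" by (intro mult_right_mono main[OF s(1-3)]) simp
  also have "\<dots> = B * s ^ D" by (simp add: B_def power_mult_distrib)
  also have "\<dots> \<le> B * s ^ Suc M" using DM s B by (intro mult_left_mono power_decreasing) auto
  also have "\<dots> = (s * B) * s ^ M" by simp
  also have "\<dots> < 1 * s ^ M" using s by (intro mult_strict_right_mono) auto
  finally show False by simp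
qed

end

text \<open>In the frame \<open>z\<close>, \<open>a\<close>, \<open>b\<close>, a vector near
  \<open>z\<close> has first coordinate near \<open>1\<close>; dividing by it gives the affine
  coordinates \<open>x\<close> and \<open>y\<close>.\<close>

lemma indep3_coordinates:
  assumes ind: "indep3 z a b" and z: "z \<noteq> 0" and \<epsilon>: "0 < \<epsilon>"
  shows "\<exists>\<delta>>0. \<forall>u\<in>ball z \<delta>. \<exists>\<alpha> x y. \<alpha> \<noteq> 0 \<and> cmod x \<le> \<epsilon> \<and> cmod y \<le> \<epsilon> \<and> u = \<alpha> *s (z + x *s a + y *s b)"
proof -
  define L where "L t = t $ 1 *s z + t $ 2 *s a + t $ 3 *s b" for t :: "complex^3"
  have lin: "linear L"
    by (rule linearI) (simp_all add: L_def vec_eq_iff algebra_simps scaleR_add_right)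
  have "inj L"
  proof (rule linear_injective_0[OF lin, THEN iffD2], intro allI impI)
    fix t assume t: "L t = 0"
    have "t $ 2 = 0 \<and> t $ 3 = 0"
    proof (rule ccontr)
      assume "\<not> ?thesis"
      hence "indep2 (t $ 2 *s a + t $ 3 *s b) z" using ind unfolding indep3_def by blast
      moreover have "t $ 2 *s a + t $ 3 *s b = (- t $ 1) *s z"
        using t by (simp add: L_def vec_eq_iff eq_neg_iff_add_eq_0 algebra_simps)
      ultimately show False by (auto simp: indep2_def)
    qed
    moreover from this have "t $ 1 = 0" using t z by (simp add: L_def smult_eq_0_iff)
    ultimately show "t = 0" by (simp add: vec_eq_iff forall_3)
  qed
  then obtain G where G: "linear G" "\<And>t. G (L t) = t" "\<And>u. L (G u) = u"
    using linear_injective_isomorphism[OF lin] by auto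
  have Gz: "G z = axis 1 1"
  proof -
    have "L (axis 1 1) = z" by (simp add: L_def axis_def vec_eq_iff)
    thus ?thesis using G(2) by metis
  qed
  have cont: "continuous (at z) G" using G(1) by (simp add: linear_continuous_at linear_conv_bounded_linear)
  \<comment> \<open>The first coordinate has modulus at least \<open>1 / 2\<close>, and a numerator
    below \<open>\<epsilon> / 2\<close> then gives a quotient of at most
    \<open>\<epsilon>\<close>.\<close>
  define e where "e = min (1 / 2) (\<epsilon> / 2)"
  have e: "e > 0" "e \<le> 1 / 2" "e \<le> \<epsilon> / 2" using \<epsilon> by (auto simp: e_def)
  obtain \<delta> where \<delta>: "\<delta> > 0" "\<And>u. dist u z < \<delta> \<Longrightarrow> dist (G u) (axis 1 1) < e"
    using cont e(1) unfolding continuous_at_eps_delta Gz by blast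
  show ?thesis
  proof (intro exI[of _ \<delta>] conjI ballI \<delta>(1))
    fix u assume "u \<in> ball z \<delta>"
    hence d: "dist (G u) (axis 1 1) < e" using \<delta>(2) by (simp add: dist_commute)
    have nth: "cmod (G u $ j - axis 1 1 $ j) < e" for j
      using order_le_less_trans[OF dist_vec_nth_le d, of j] by (simp add: dist_norm)
    have 1: "cmod (G u $ 1 - 1) < e" "cmod (G u $ 2) < e" "cmod (G u $ 3) < e"
      using nth[of 1] nth[of 2] nth[of 3] by (simp_all add: axis_def)
    have "1 \<le> cmod (G u $ 1) + cmod (G u $ 1 - 1)"
      using norm_triangle_ineq4[of "G u $ 1" "G u $ 1 - 1"] by simp
    hence g1: "cmod (G u $ 1) \<ge> 1 / 2" using 1(1) e(2) by linarith
    hence g10: "G u $ 1 \<noteq> 0" by auto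
    have small: "cmod (c / G u $ 1) \<le> \<epsilon>" if "cmod c < e" for c
    proof -
      have "cmod c \<le> \<epsilon> * (1 / 2)" using that e(3) by simp
      also have "\<dots> \<le> \<epsilon> * cmod (G u $ 1)" using g1 \<epsilon> by (intro mult_left_mono) auto
      finally show ?thesis using g10 by (simp add: norm_divide divide_le_eq)
    qed
    have "u = G u $ 1 *s z + G u $ 2 *s a + G u $ 3 *s b" using G(3)[of u] by (simp add: L_def)
    also have "\<dots> = G u $ 1 *s (z + (G u $ 2 / G u $ 1) *s a + (G u $ 3 / G u $ 1) *s b)"
      using g10 by (simp add: vec_eq_iff field_simps)
    finally show "\<exists>\<alpha> x y. \<alpha> \<noteq> 0 \<and> cmod x \<le> \<epsilon> \<and> cmod y \<le> \<epsilon> \<and> u = \<alpha> *s (z + x *s a + y *s b)"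
      using g10 small[OF 1(2)] small[OF 1(3)] by blast
  qed
qed

context stable_rational_map
begin

lemma finite_E_zeros: "finite {q. E j (rep_cp2 q) = 0}"
proof (cases "j = 0")
  case True
  thus ?thesis by (simp add: rep_cp2_nonzero)
next
  case False
  have "{q. E j (rep_cp2 q) = 0} = indet (iterate f j)"
    using False indet_proj[of j "rep_cp2 _"] rep_cp2_nonzero by (auto simp: proj_rep_cp2)
  thus ?thesis using finite_indet by simp
qed

text \<open>Where \<open>Q x\<close> is nonzero it represents \<open>g (z0 + x *s v)\<close>, which
  therefore lies in the finite, hence closed, set of zeros of \<open>E j\<close>. At
  \<open>x = 1\<close> the vector \<open>Q x\<close> may vanish; since the zeros of a nontrivial
  component are isolated, continuity of \<open>g\<close> reaches that point.\<close>

lemma blowup_limit_in_zeros: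
  assumes bl: "blowup_limit z0 v \<rho> n w Q" and conv: "converges z0 \<eta> n g" and v: "indep2 v z0"
    and \<rho>: "1 < \<rho>" "\<rho> * norm v < \<eta>" and zero: "\<And>x. x \<in> ball 0 \<rho> \<Longrightarrow> E j (Q x) = 0"
  shows "E j (rep_cp2 (g (z0 + v))) = 0"
proof -
  define Z where "Z = {q. E j (rep_cp2 q) = 0}"
  have clZ: "closed Z" unfolding Z_def by (rule finite_imp_closed[OF finite_E_zeros])
  have holQ: "(\<lambda>x. Q x $ l) holomorphic_on ball 0 \<rho>" for l using bl unfolding blowup_limit_def by blast
  obtain x1 where x1: "x1 \<in> ball 0 \<rho>" "Q x1 \<noteq> 0" using bl unfolding blowup_limit_def by blast
  then obtain l where l: "Q x1 $ l \<noteq> 0" by (auto simp: vec_eq_iff)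
  have punct: "z0 + x *s v \<in> punct z0 \<eta>" if "x \<noteq> 0" "x \<in> ball 0 \<rho>" for x
  proof (rule punct_line[OF v that(1)])
    have "cmod x * norm v \<le> \<rho> * norm v" using that(2) by (intro mult_right_mono) auto
    thus "cmod x * norm v < \<eta>" using \<rho>(2) by linarith
  qed
  have inZ: "g (z0 + x *s v) \<in> Z" if x: "x \<noteq> 0" "x \<in> ball 0 \<rho>" "Q x $ l \<noteq> 0" for x
  proof -
    have "Q x \<noteq> 0" using x(3) by auto
    from blowup_limit_proj[OF bl conv x(2) this punct[OF x(1,2)]] E_proj[OF this, of j] zero[OF x(2)]
    show ?thesis by (auto simp: Z_def)
  qed
  have one: "1 \<in> ball (0::complex) \<rho>" using \<rho>(1) by simp
  have "g (z0 + 1 *s v) \<in> Z"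
  proof (cases "Q 1 $ l = 0")
    case False
    thus ?thesis using inZ[of 1] one by simp
  next
    case True
    obtain r where r: "0 < r" "ball (1::complex) r \<subseteq> ball 0 \<rho>" "\<And>x. x \<in> ball 1 r - {1} \<Longrightarrow> Q x $ l \<noteq> 0"
      by (rule isolated_zeros[OF holQ open_ball connected_ball one True x1(1) l], rule that)
    have "isCont g (z0 + 1 *s v)"
      using conv punct[OF _ one] open_punct unfolding converges_def
      by (auto simp: continuous_on_eq_continuous_at)
    moreover have "isCont (\<lambda>x. z0 + x *s v) 1"
    proof -
      have "continuous_on UNIV (\<lambda>x. z0 + x *s v)" by (intro continuous_intros)
      thus ?thesis by (simp add: continuous_on_eq_continuous_at)
    qed
    ultimately have "isCont (\<lambda>x. g (z0 + x *s v)) 1" by (rule isCont_o2[rotated])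
    hence lim: "((\<lambda>x. g (z0 + x *s v)) \<longlongrightarrow> g (z0 + 1 *s v)) (at 1)" by (simp only: isCont_def)
    have "\<forall>\<^sub>F x in at 1. x \<in> ball 1 (min r 1) - {1::complex}"
      using r(1) by (auto simp: eventually_at dist_commute intro!: exI[of _ "min r 1"])
    hence "\<forall>\<^sub>F x in at 1. g (z0 + x *s v) \<in> Z"
    proof eventually_elim
      case (elim x)
      hence "x \<noteq> 0" by auto
      moreover have "x \<in> ball 1 r - {1}" using elim by auto
      ultimately show ?case using inZ[of x] r(2,3) by blast
    qed
    thus ?thesis using Lim_in_closed_set[OF clZ _ _ lim] by simp
  qed
  thus ?thesis by (simp add: Z_def)
qed

text \<open>If all limit discs pass through the origin, they lie in the cones over the indeterminacy sets of the
  iterates. These are countably many points, so \<open>g\<close> is constant on a punctured plane, which is connected. A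
  chart around that value gives the normal form with \<open>N = 0\<close>, whose limit does not vanish at the centre.\<close>

lemma exists_nonvanishing_limit:
  assumes acs: "all_subseq_converge z0" and conv: "converges z0 \<eta> n g" and n: "strict_mono n"
  shows "\<exists>v \<rho> s w Q. indep2 v z0 \<and> 0 < \<rho> \<and> \<rho> * norm v < \<eta> \<and> strict_mono s \<and>
    blowup_limit z0 v \<rho> (n \<circ> s) w Q \<and> Q 0 \<noteq> 0"
proof (rule ccontr)
  assume neg: "\<not> ?thesis"
  have \<eta>: "0 < \<eta>" "z0 \<noteq> 0" using conv by (auto simp: converges_def)
  \<comment> \<open>Requiring \<open>3 * norm v < \<eta>\<close> leaves room for a circle of radius
    between \<open>2\<close> and \<open>3\<close>, so that \<open>z0 + v\<close>, at parameter
    \<open>1\<close>, lies inside the disc of the limit.\<close>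
  have inI: "\<exists>j. E j (rep_cp2 (g (z0 + v))) = 0" if v: "indep2 v z0" "3 * norm v < \<eta>" for v
  proof -
    obtain \<rho> i where \<rho>: "2 < \<rho>" "\<rho> < 3" and ch: "\<And>x. cmod x = \<rho> \<Longrightarrow> g (z0 + x *s v) \<in> chart i"
      using circle_in_chart[OF conv v(1), of 2 3] v(2) by auto
    have "\<rho> * norm v \<le> 3 * norm v" using \<rho> by (intro mult_right_mono) auto
    hence \<rho>v: "\<rho> * norm v < \<eta>" using v(2) by linarith
    have \<rho>0: "0 < \<rho>" "1 < \<rho>" using \<rho> by auto
    obtain b where b: "indep3 z0 v b" using indep3_exists[OF v(1)] by blast
    obtain N C where "\<forall>\<^sub>F k in sequentially. \<exists>m w. normal_form z0 v i \<rho> N C (n k) m w"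
      using eventually_normal_form[OF conv b \<rho>0(1) \<rho>v ch zero_less_one] by blast
    from exists_blowup_limit[OF this \<rho>0(1)]
    obtain s w Q where s: "strict_mono s" and bl: "blowup_limit z0 v \<rho> (n \<circ> s) w Q" by blast
    have Q0: "Q 0 = 0" using neg v(1) \<rho>0(1) \<rho>v s bl by blast
    obtain M n0 where M: "M \<ge> 1" "\<And>l. l \<ge> n0 \<Longrightarrow> vanishing_order_le z0 v M l" using eventually_vanishing_order_le[OF acs b] by blast
    obtain j where "\<And>x. x \<in> ball 0 \<rho> \<Longrightarrow> E j (Q x) = 0"
      using blowup_in_indeterminacy[OF bl \<rho>0(1) strict_mono_o[OF n s] Q0 M] by blast
    from blowup_limit_in_zeros[OF bl converges_subseq[OF conv s] v(1) \<rho>0(2) \<rho>v this]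
    show ?thesis by blast
  qed
  obtain i0 where i0: "z0 $ i0 \<noteq> 0" using \<eta>(2) by (auto simp: vec_eq_iff)
  obtain k where k: "k \<noteq> i0" using that[of 1] that[of 2] by (cases "i0 = 1") auto
  have "indep2 (axis k 1) z0"
    unfolding indep2_def by (rule exI[of _ k], rule exI[of _ i0]) (use i0 k in \<open>simp add: axis_def\<close>)
  then obtain a where a: "indep2 a z0" by blast
  then obtain b where ab: "indep3 z0 a b" using indep3_exists by blast
  define t where "t = norm a + norm b + 1"
  define R where "R = \<eta> / (3 * t)"
  have nab: "t > 0" by (simp add: t_def add_nonneg_pos)
  have R: "R > 0" using \<eta>(1) nab by (simp add: R_def)
  define S where "S = ball (0::complex \<times> complex) R - {0}"
  have S: "connected S" unfolding S_def by (rule connected_punctured_ball) simp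
  have small: "3 * norm (x *s a + y *s b) < \<eta>" if "(x, y) \<in> ball 0 R" for x y
  proof -
    have xy: "cmod x \<le> R" "cmod y \<le> R"
      using that norm_fst_le[of x y] norm_snd_le[of y x] by auto
    have "norm (x *s a + y *s b) \<le> cmod x * norm a + cmod y * norm b"
      using norm_triangle_ineq[of "x *s a" "y *s b"] by (simp add: norm_smult)
    also have "\<dots> \<le> R * norm a + R * norm b" using xy by (intro add_mono mult_right_mono) auto
    also have "\<dots> < R * t" using R by (simp add: t_def algebra_simps)
    also have "\<dots> = \<eta> / 3" using nab by (simp add: R_def)
    finally show ?thesis by simp
  qed
  define \<phi> where "\<phi> = (\<lambda>(x, y). g (z0 + x *s a + y *s b))"
  have inP: "z0 + x *s a + y *s b \<in> punct z0 \<eta>" if "(x, y) \<in> S" for x y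
  proof -
    have xy: "x \<noteq> 0 \<or> y \<noteq> 0" "(x, y) \<in> ball 0 R" using that by (auto simp: S_def zero_prod_def)
    hence "indep2 (x *s a + y *s b) z0" using ab unfolding indep3_def by blast
    moreover have "norm (x *s a + y *s b) < \<eta>"
      using small[OF xy(2)] norm_ge_zero[of "x *s a + y *s b"] by linarith
    ultimately show ?thesis
      using punct_line[of "x *s a + y *s b" z0 1 \<eta>] by (simp add: add.assoc)
  qed
  have cont: "continuous_on S \<phi>"
    unfolding \<phi>_def case_prod_beta
  proof (rule continuous_on_compose2[of "punct z0 \<eta>" g S "\<lambda>p. z0 + fst p *s a + snd p *s b"])
    show "continuous_on (punct z0 \<eta>) g" using conv by (simp add: converges_def)
    show "continuous_on S (\<lambda>p. z0 + fst p *s a + snd p *s b)" by (intro continuous_intros)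
  qed (use inP in auto)
  have "\<phi> ` S \<subseteq> (\<Union>j. {q. E j (rep_cp2 q) = 0})"
  proof clarify
    fix x y assume "(x, y) \<in> S"
    hence xy: "x \<noteq> 0 \<or> y \<noteq> 0" "(x, y) \<in> ball 0 R" by (auto simp: S_def zero_prod_def)
    hence "indep2 (x *s a + y *s b) z0" using ab unfolding indep3_def by blast
    from inI[OF this small[OF xy(2)]]
    show "\<phi> (x, y) \<in> (\<Union>j. {q. E j (rep_cp2 q) = 0})" by (simp add: \<phi>_def add.assoc)
  qed
  moreover have "countable (\<Union>j. {q. E j (rep_cp2 q) = 0})"
    by (rule countable_UN[OF countableI_type countable_finite[OF finite_E_zeros]])
  ultimately have "countable (\<phi> ` S)" using countable_subset by blast
  \<comment> \<open>A connected set with two points in a metric space is uncountable, so the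
    continuous image of the connected \<open>S\<close> is a single point.\<close>
  hence const: "\<phi> p = \<phi> p'" if "p \<in> S" "p' \<in> S" for p p'
    using connected_uncountable[OF connected_continuous_image[OF cont S], of "\<phi> p" "\<phi> p'"] that by blast
  define \<rho> where "\<rho> = R / 3"
  have \<rho>: "0 < \<rho>" using R by (simp add: \<rho>_def)
  have inS: "(x, y) \<in> S" if "cmod x \<le> \<rho>" "cmod y \<le> \<rho>" "x \<noteq> 0 \<or> y \<noteq> 0" for x y
  proof -
    have "norm (x, y) \<le> cmod x + cmod y" by (rule norm_Pair_le)
    also have "\<dots> < R" using that \<rho> by (simp add: \<rho>_def)
    finally have "(x, y) \<in> ball 0 R" by (simp only: mem_ball_0)
    moreover have "(x, y) \<noteq> 0" using that(3) by (auto simp: zero_prod_def)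
    ultimately show ?thesis by (simp only: S_def Diff_iff singleton_iff simp_thms)
  qed
  have r1: "(of_real \<rho>, 0) \<in> S" using \<rho> by (intro inS) auto
  obtain i where i: "\<phi> (of_real \<rho>, 0) \<in> chart i" using in_some_chart by blast
  have chi: "g (z0 + x *s a + y *s b) \<in> chart i" if "cmod x \<le> \<rho>" "cmod y \<le> \<rho>" "x \<noteq> 0 \<or> y \<noteq> 0" for x y
    using const[OF inS[OF that] r1] i by (simp add: \<phi>_def)
  have chc: "g (z0 + x *s a) \<in> chart i" if "cmod x = \<rho>" for x
    using chi[of x 0] that \<rho> by auto
  have "(of_real \<rho>, 0) \<in> ball (0::complex \<times> complex) R" using r1 by (simp add: S_def)
  from small[OF this] have "3 * (\<rho> * norm a) < \<eta>" using \<rho> by (simp add: norm_smult)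
  moreover have "0 \<le> \<rho> * norm a" using \<rho> by simp
  ultimately have \<rho>a: "\<rho> * norm a < \<eta>" by linarith
  obtain N C where NC: "\<forall>\<^sub>F k in sequentially. \<exists>m w. normal_form z0 a i \<rho> N C (n k) m w" "N = 0"
    using eventually_normal_form[OF conv ab \<rho> \<rho>a chc \<rho>] chi by blast
  obtain s w Q where "strict_mono s" "blowup_limit z0 a \<rho> (n \<circ> s) w Q" "Q 0 \<noteq> 0"
    using exists_blowup_limit[OF NC(1) \<rho>] NC(2) by blast
  thus False using neg a \<rho> \<rho>a by blast
qed

text \<open>Since \<open>Q 0 $ i\<close> is nonzero, component \<open>i\<close> of late iterates has
  no zero on a small disc through \<open>z0\<close>; its winding number \<open>0\<close> is carried
  along the tube to every parallel disc, so the component is zero-free on a bidisc. There the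
  normalized components are holomorphic along each disc, and their differences are controlled by the
  boundary circles, where convergence is known.\<close>

lemma uniformly_Cauchy_near:
  assumes conv: "converges z0 \<eta> n g" and v: "indep2 v z0" and ind: "indep3 z0 v b"
    and \<rho>: "0 < \<rho>" "\<rho> * norm v < \<eta>" and bl: "blowup_limit z0 v \<rho> n w Q" and Q0: "Q 0 \<noteq> 0"
  shows "\<exists>i \<epsilon>. 0 < \<epsilon> \<and> (\<forall>e>0. \<exists>k0. \<forall>k\<ge>k0. \<forall>m\<ge>k0. \<forall>x y. cmod x \<le> \<epsilon> \<longrightarrow> cmod y \<le> \<epsilon> \<longrightarrow>
    (let u = z0 + x *s v + y *s b in E (n k) u $ i \<noteq> 0 \<and> E (n m) u $ i \<noteq> 0 \<and>
      dist ((1 / E (n k) u $ i) *s E (n k) u) ((1 / E (n m) u $ i) *s E (n m) u) < e))"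
proof -
  obtain i where i: "Q 0 $ i \<noteq> 0" using Q0 by (auto simp: vec_eq_iff)
  have holQ: "(\<lambda>x. Q x $ i) holomorphic_on ball 0 \<rho>" using bl unfolding blowup_limit_def by blast
  have wnz: "poly (w k) x \<noteq> 0" if "x \<in> ball 0 \<rho>" for k x using bl that unfolding blowup_limit_def by blast
  have in0: "0 \<in> ball (0::complex) \<rho>" using \<rho>(1) by simp
  \<comment> \<open>One third is lost to the variation of \<open>Q\<close> near \<open>0\<close> and
    one third to the distance of the iterates from \<open>Q\<close>; the remaining third keeps the
    component nonzero.\<close>
  define c where "c = cmod (Q 0 $ i) / 3"
  have c: "c > 0" using i by (simp add: c_def)
  have "isCont (\<lambda>x. Q x $ i) 0"
    using holomorphic_on_imp_continuous_on[OF holQ] in0 by (simp add: continuous_on_eq_continuous_at)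
  then obtain r' where r': "r' > 0" "\<And>x. dist x 0 < r' \<Longrightarrow> dist (Q x $ i) (Q 0 $ i) < c"
    using c unfolding continuous_at_eps_delta by blast
  define r where "r = min r' \<rho> / 2"
  have r: "0 < r" "r < r'" "r < \<rho>" using r'(1) \<rho>(1) by (auto simp: r_def)
  have Qc: "2 * c \<le> cmod (Q x $ i)" if "cmod x \<le> r" for x
  proof -
    have "cmod (Q x $ i - Q 0 $ i) < c" using r'(2)[of x] that r(2) by (simp add: dist_norm)
    moreover have "cmod (Q 0 $ i) = 3 * c" by (simp add: c_def)
    ultimately show ?thesis using norm_triangle_ineq2[of "Q 0 $ i" "Q 0 $ i - Q x $ i"]
      by (simp add: norm_minus_commute)
  qed
  have sub: "cball (0::complex) r \<subseteq> ball 0 \<rho>" using r(3) by auto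
  have "r * norm v \<le> \<rho> * norm v" using r(3) by (intro mult_right_mono) auto
  hence rv: "r * norm v < \<eta>" using \<rho>(2) by linarith
  have ch: "g (z0 + x *s v) \<in> chart i" if x: "cmod x = r" for x
  proof -
    have xb: "x \<in> ball 0 \<rho>" using x r(3) by simp
    have Qx: "Q x $ i \<noteq> 0" using Qc[of x] x c by auto
    hence Qn: "Q x \<noteq> 0" by auto
    have "z0 + x *s v \<in> punct z0 \<eta>" using x r(1) rv by (intro punct_line[OF v]) auto
    from blowup_limit_proj[OF bl conv xb Qn this] show ?thesis using chart_proj[OF Qn] Qx by simp
  qed
  obtain \<epsilon>' where \<epsilon>': "\<epsilon>' > 0" "r * norm v + \<epsilon>' * norm b < \<eta>"
    "\<And>x y. cmod x = r \<Longrightarrow> cmod y \<le> \<epsilon>' \<Longrightarrow> g (z0 + x *s v + y *s b) \<in> chart i"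
    using circle_tube[OF conv ind r(1) rv ch] by blast
  define T where "T = (\<lambda>(x, y). z0 + x *s v + y *s b) ` (sphere 0 r \<times> cball 0 \<epsilon>')"
  have cT: "compact T" unfolding T_def
    by (intro compact_continuous_image compact_Times compact_sphere compact_cball)
      (auto simp: case_prod_beta intro!: continuous_intros)
  have inT: "z0 + x *s v + y *s b \<in> T" if "cmod x = r" "cmod y \<le> \<epsilon>'" for x y
    unfolding T_def using that by (intro image_eqI[of _ _ "(x, y)"]) auto
  have TP: "T \<subseteq> punct z0 \<eta>"
  proof
    fix u assume "u \<in> T"
    then obtain x y where xy: "cmod x = r" "cmod y \<le> \<epsilon>'" "u = z0 + x *s v + y *s b"
      unfolding T_def by auto
    have "cmod y * norm b \<le> \<epsilon>' * norm b" using xy(2) by (intro mult_right_mono) auto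
    thus "u \<in> punct z0 \<eta>" unfolding xy(3) using xy(1) r(1) \<epsilon>'(2) by (intro punct_plane[OF ind]) auto
  qed
  have gT: "g ` T \<subseteq> chart i" unfolding T_def using \<epsilon>'(3) by auto
  have "uniform_limit K (\<lambda>k x. (1 / poly (w k) x) *s E (n k) (z0 + x *s v)) Q sequentially"
    if "compact K" "K \<subseteq> ball 0 \<rho>" for K using bl that unfolding blowup_limit_def by blast
  from this[OF compact_cball sub]
  have "uniform_limit (cball 0 r) (\<lambda>k x. (1 / poly (w k) x) *s E (n k) (z0 + x *s v)) Q sequentially" .
  from uniform_limitD[OF this c] have ev0: "\<forall>\<^sub>F k in sequentially. \<forall>x\<in>cball 0 r. E (n k) (z0 + x *s v) $ i \<noteq> 0"
  proof eventually_elim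
    case (elim k)
    show ?case
    proof
      fix x :: complex assume x: "x \<in> cball 0 r"
      show "E (n k) (z0 + x *s v) $ i \<noteq> 0"
      proof
        assume "E (n k) (z0 + x *s v) $ i = 0"
        hence "dist 0 (Q x $ i) < c"
          using order_le_less_trans[OF dist_vec_nth_le elim[rule_format, OF x], of i] by simp
        thus False using Qc[of x] x c by simp
      qed
    qed
  qed
  have nz: "E (n k) (z0 + x *s v + y *s b) $ i \<noteq> 0"
    if z: "\<forall>x\<in>cball 0 r. E (n k) (z0 + x *s v) $ i \<noteq> 0" and t: "\<forall>u\<in>T. E (n k) u $ i \<noteq> 0"
      and xy: "cmod x \<le> r" "cmod y \<le> \<epsilon>'" for k x y
  proof -
    have "wind r (\<lambda>x. E (n k) (z0 + x *s v + 0 *s b) $ i) 0"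
      using z by (intro wind_const_if_disc continuous_intros) auto
    have wy: "wind r (\<lambda>x. E (n k) (z0 + x *s v + y *s b) $ i) 0"
    proof (rule wind_homotopic[where K = "\<lambda>x y. E (n k) (z0 + x *s v + y *s b) $ i" and Y = "cball 0 \<epsilon>'" and ?y0.0 = 0])
      show "continuous_on (sphere 0 r \<times> cball 0 \<epsilon>') (\<lambda>(x, y). E (n k) (z0 + x *s v + y *s b) $ i)"
        unfolding case_prod_beta by (intro continuous_intros)
      show "E (n k) (z0 + x *s v + y *s b) $ i \<noteq> 0" if "x \<in> sphere 0 r" "y \<in> cball 0 \<epsilon>'" for x y
        using t inT[of x y] that by simp
      show "wind r (\<lambda>x. E (n k) (z0 + x *s v + 0 *s b) $ i) 0" by fact
    qed (use \<epsilon>'(1) xy(2) in auto)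
    have sw: "z0 + x *s v + y *s b = (z0 + y *s b) + x *s v" for x by (simp add: algebra_simps)
    obtain p where "\<And>x. E (n k) ((z0 + y *s b) + x *s v) $ i = poly p x" using poly_line by blast
    hence p: "E (n k) (z0 + x *s v + y *s b) $ i = poly p x" for x by (simp only: sw)
    have wp: "wind r (poly p) 0" using wy by (simp only: p)
    have ps: "poly p x \<noteq> 0" if "x \<in> sphere 0 r" for x
      using t inT[of x y] that xy(2) by (simp flip: p)
    obtain m u where mu: "p = m * u" "lead_coeff m = 1" "\<forall>x\<in>cball 0 r. poly u x \<noteq> 0" "wind r (poly p) (degree m)"
      using poly_zero_factor[OF r(1) ps] by blast
    have "degree m = 0" using wind_unique[OF r(1) mu(4) wp] .
    then obtain a where "m = [:a:]" by (rule degree_eq_zeroE)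
    hence "poly p x = poly u x" using mu(1,2) by simp
    hence "poly p x \<noteq> 0" using mu(3) xy(1) by simp
    thus ?thesis by (simp flip: p)
  qed
  show ?thesis
  proof (intro exI[of _ i] exI[of _ "min r \<epsilon>'"] conjI allI impI)
    show "0 < min r \<epsilon>'" using r(1) \<epsilon>'(1) by simp
    fix e :: real assume e: "0 < e"
    have "\<forall>\<^sub>F k in sequentially. (\<forall>x\<in>cball 0 r. E (n k) (z0 + x *s v) $ i \<noteq> 0) \<and>
        (\<forall>u\<in>T. E (n k) u $ i \<noteq> 0 \<and> dist ((1 / E (n k) u $ i) *s E (n k) u) (affine i (g u)) < e / 12)"
      using eventually_conj[OF ev0 converges_affine[OF conv cT TP gT, of "e / 12"]] e by simp
    \<comment> \<open>The tolerance \<open>e / 12\<close> puts two iterates within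
      \<open>e / 6\<close> of each other on the circles, and three components then give at most
      \<open>e / 2\<close>.\<close>
    then obtain k0 where k0: "\<And>k. k \<ge> k0 \<Longrightarrow> \<forall>x\<in>cball 0 r. E (n k) (z0 + x *s v) $ i \<noteq> 0"
      "\<And>k u. k \<ge> k0 \<Longrightarrow> u \<in> T \<Longrightarrow> E (n k) u $ i \<noteq> 0 \<and> dist ((1 / E (n k) u $ i) *s E (n k) u) (affine i (g u)) < e / 12"
      unfolding eventually_sequentially by blast
    show "\<exists>k0. \<forall>k\<ge>k0. \<forall>m\<ge>k0. \<forall>x y. cmod x \<le> min r \<epsilon>' \<longrightarrow> cmod y \<le> min r \<epsilon>' \<longrightarrow>
      (let u = z0 + x *s v + y *s b in E (n k) u $ i \<noteq> 0 \<and> E (n m) u $ i \<noteq> 0 \<and>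
      dist ((1 / E (n k) u $ i) *s E (n k) u) ((1 / E (n m) u $ i) *s E (n m) u) < e)"
      unfolding Let_def
    proof (intro exI[of _ k0] allI impI)
      fix k m x y assume km: "k0 \<le> k" "k0 \<le> m" and xy: "cmod x \<le> min r \<epsilon>'" "cmod y \<le> min r \<epsilon>'"
      have nzk: "E (n k) (z0 + x *s v + y *s b) $ i \<noteq> 0" if "k0 \<le> k" "cmod x \<le> r" for k x
        using k0 that xy(2) by (intro nz) auto
      let ?R = "\<lambda>k x. (1 / E (n k) (z0 + x *s v + y *s b) $ i) *s E (n k) (z0 + x *s v + y *s b)"
      have comp: "cmod ((?R k x - ?R m x) $ j) \<le> e / 6" for j
      proof (rule max_modulus_disc[OF r(1), where f = "\<lambda>x. (?R k x - ?R m x) $ j" and y = x])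
        have sw: "z0 + x *s v + y *s b = (z0 + y *s b) + x *s v" for x by (simp add: algebra_simps)
        have "(\<lambda>x. E (n k) ((z0 + y *s b) + x *s v) $ j / E (n k) ((z0 + y *s b) + x *s v) $ i -
            E (n m) ((z0 + y *s b) + x *s v) $ j / E (n m) ((z0 + y *s b) + x *s v) $ i) holomorphic_on cball 0 r"
          using nzk[OF km(1)] nzk[OF km(2)] unfolding sw
          by (intro holomorphic_on_diff holomorphic_on_divide holomorphic_on_E_line) auto
        thus "(\<lambda>x. (?R k x - ?R m x) $ j) holomorphic_on cball 0 r" by (simp add: sw)
        fix x' :: complex assume x': "cmod x' = r"
        have u: "z0 + x' *s v + y *s b \<in> T" using inT[OF x'] xy(2) by simp
        have "dist (?R k x') (?R m x') < e / 12 + e / 12"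
          using k0(2)[OF km(1) u] k0(2)[OF km(2) u] dist_triangle2[of "?R k x'" "?R m x'" "affine i (g (z0 + x' *s v + y *s b))"]
          by linarith
        moreover have "cmod ((?R k x' - ?R m x') $ j) \<le> norm (?R k x' - ?R m x')"
          by (rule Finite_Cartesian_Product.norm_nth_le)
        ultimately show "cmod ((?R k x' - ?R m x') $ j) \<le> e / 6" unfolding dist_norm by linarith
      qed (use xy in simp)
      have "dist (?R k x) (?R m x) < e" using norm_vec3_le[OF comp] e by (simp add: dist_norm)
      thus "E (n k) (z0 + x *s v + y *s b) $ i \<noteq> 0 \<and> E (n m) (z0 + x *s v + y *s b) $ i \<noteq> 0 \<and> dist (?R k x) (?R m x) < e"
        using nzk[OF km(1), of x] nzk[OF km(2), of x] xy(1) by simp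
    qed
  qed
qed

text \<open>The uniform Cauchy property in affine coordinates reduces equicontinuity of a whole tail
  at \<open>z0\<close> to continuity of the single map \<open>R k0\<close>. The values
  \<open>R k z0\<close> stay in the compact set \<open>K\<close>, near which \<open>proj\<close> is
  uniformly continuous.\<close>

lemma tail_equicontinuous:
  assumes acs: "all_subseq_converge z0" and r: "strict_mono (r :: nat \<Rightarrow> nat)"
  shows "\<exists>s :: nat \<Rightarrow> nat. strict_mono s \<and> (\<forall>e>0. \<exists>\<delta>>0. \<exists>k0. \<forall>k\<ge>k0. \<forall>u\<in>ball z0 \<delta>. E (r (s k)) u \<noteq> 0 \<and>
    dist (proj (E (r (s k)) u)) (proj (E (r (s k)) z0)) < e)"
proof -
  obtain s1 \<eta> g where s1: "strict_mono s1" and conv: "converges z0 \<eta> (r \<circ> s1) g"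
    using acs r unfolding all_subseq_converge_def by blast
  have z0: "z0 \<noteq> 0" using conv by (simp add: converges_def)
  obtain v \<rho> s2 w Q where v: "indep2 v z0" and \<rho>: "0 < \<rho>" "\<rho> * norm v < \<eta>" and s2: "strict_mono s2"
    and bl: "blowup_limit z0 v \<rho> (r \<circ> s1 \<circ> s2) w Q" and Q0: "Q 0 \<noteq> 0"
    using exists_nonvanishing_limit[OF acs conv strict_mono_o[OF r s1]] by blast
  define n where "n = r \<circ> s1 \<circ> s2"
  obtain b where b: "indep3 z0 v b" using indep3_exists[OF v] by blast
  have conv2: "converges z0 \<eta> n g" unfolding n_def by (rule converges_subseq[OF conv s2])
  obtain i \<epsilon> where \<epsilon>: "0 < \<epsilon>" and UC: "\<And>e. 0 < e \<Longrightarrow> \<exists>k0. \<forall>k\<ge>k0. \<forall>m\<ge>k0. \<forall>x y. cmod x \<le> \<epsilon> \<longrightarrow> cmod y \<le> \<epsilon> \<longrightarrow>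
    (let u = z0 + x *s v + y *s b in E (n k) u $ i \<noteq> 0 \<and> E (n m) u $ i \<noteq> 0 \<and>
      dist ((1 / E (n k) u $ i) *s E (n k) u) ((1 / E (n m) u $ i) *s E (n m) u) < e)"
    using uniformly_Cauchy_near[OF conv2 v b \<rho> bl[folded n_def] Q0] by blast
  obtain \<delta>0 where \<delta>0: "\<delta>0 > 0" "\<And>u. u \<in> ball z0 \<delta>0 \<Longrightarrow>
      \<exists>\<alpha> x y. \<alpha> \<noteq> 0 \<and> cmod x \<le> \<epsilon> \<and> cmod y \<le> \<epsilon> \<and> u = \<alpha> *s (z0 + x *s v + y *s b)"
    using indep3_coordinates[OF b z0 \<epsilon>] by blast
  define R where "R k u = (1 / E (n k) u $ i) *s E (n k) u" for k u
  have R_smult: "R k (\<alpha> *s u) = R k u" if "\<alpha> \<noteq> 0" for \<alpha> u k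
    using that by (simp add: R_def E_smult vec_eq_iff)
  have UCu: "\<exists>k0. \<forall>k\<ge>k0. \<forall>m\<ge>k0. \<forall>u\<in>ball z0 \<delta>0. E (n k) u $ i \<noteq> 0 \<and> dist (R k u) (R m u) < e"
    if e: "0 < e" for e
  proof -
    obtain k0 where k0: "\<And>k m x y. k \<ge> k0 \<Longrightarrow> m \<ge> k0 \<Longrightarrow> cmod x \<le> \<epsilon> \<Longrightarrow> cmod y \<le> \<epsilon> \<Longrightarrow>
      E (n k) (z0 + x *s v + y *s b) $ i \<noteq> 0 \<and> dist (R k (z0 + x *s v + y *s b)) (R m (z0 + x *s v + y *s b)) < e"
      using UC[OF e] unfolding Let_def R_def by blast
    show ?thesis
    proof (intro exI[of _ k0] allI impI ballI)
      fix k m u assume km: "k0 \<le> k" "k0 \<le> m" and u: "u \<in> ball z0 \<delta>0"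
      obtain \<alpha> x y where a: "\<alpha> \<noteq> 0" "cmod x \<le> \<epsilon>" "cmod y \<le> \<epsilon>" "u = \<alpha> *s (z0 + x *s v + y *s b)"
        using \<delta>0(2)[OF u] by blast
      show "E (n k) u $ i \<noteq> 0 \<and> dist (R k u) (R m u) < e"
      proof -
        have "E (n k) u $ i = \<alpha> ^ (d ^ n k) * E (n k) (z0 + x *s v + y *s b) $ i"
          by (simp only: a(4) E_smult vector_smult_component)
        thus ?thesis using k0[OF km a(2,3)] a(1) unfolding a(4) R_smult[OF a(1)] by simp
      qed
    qed
  qed
  obtain k1 where k1: "\<And>k u. k \<ge> k1 \<Longrightarrow> u \<in> ball z0 \<delta>0 \<Longrightarrow> E (n k) u $ i \<noteq> 0 \<and> dist (R k u) (R k1 u) < 1"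
    using UCu[OF zero_less_one] by blast
  have z0b: "z0 \<in> ball z0 \<delta>0" using \<delta>0(1) by simp
  \<comment> \<open>The slice with \<open>i\<close>-th coordinate \<open>1\<close> keeps
    \<open>K\<close> away from the origin, where \<open>proj\<close> is not controlled.\<close>
  define K where "K = cball (R k1 z0) 1 \<inter> {z. z $ i = 1}"
  have K: "compact K" unfolding K_def
    by (intro compact_Int_closed compact_cball closed_Collect_eq continuous_intros)
  have K0: "K \<subseteq> - {0}" by (auto simp: K_def)
  have RK: "R k z0 \<in> K" if "k \<ge> k1" for k
    using k1[OF that z0b] by (simp add: K_def R_def dist_commute)
  have main: "\<exists>\<delta>>0. \<exists>k0. \<forall>k\<ge>k0. \<forall>u\<in>ball z0 \<delta>. E (n k) u \<noteq> 0 \<and> dist (proj (E (n k) u)) (proj (E (n k) z0)) < e"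
    if e: "0 < e" for e
  proof -
    obtain \<delta>1 where \<delta>1: "\<delta>1 > 0" "\<And>x y. x \<in> K \<Longrightarrow> dist x y < \<delta>1 \<Longrightarrow> y \<in> - {0} \<and> dist (proj x) (proj y) < e"
      using compact_uniform_nbhd[OF K K0 _ continuous_on_proj e] by (auto simp: open_Compl)
    obtain k2 where k2: "\<And>k m u. k \<ge> k2 \<Longrightarrow> m \<ge> k2 \<Longrightarrow> u \<in> ball z0 \<delta>0 \<Longrightarrow> dist (R k u) (R m u) < \<delta>1 / 3"
      using UCu[of "\<delta>1 / 3"] \<delta>1(1) by (metis zero_less_divide_iff zero_less_numeral)
    define k0 where "k0 = max k1 k2"
    have "continuous_on (ball z0 \<delta>0) (R k0)"
      unfolding R_def using k1[of k0] by (intro continuous_intros) (auto simp: k0_def)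
    hence "isCont (R k0) z0" using z0b by (simp add: continuous_on_eq_continuous_at)
    then obtain \<delta>2 where \<delta>2: "\<delta>2 > 0" "\<And>u. dist u z0 < \<delta>2 \<Longrightarrow> dist (R k0 u) (R k0 z0) < \<delta>1 / 3"
      using \<delta>1(1) unfolding continuous_at_eps_delta by (metis zero_less_divide_iff zero_less_numeral)
    show ?thesis
    proof (intro exI[of _ "min \<delta>0 \<delta>2"] exI[of _ k0] conjI allI impI ballI)
      show "0 < min \<delta>0 \<delta>2" using \<delta>0(1) \<delta>2(1) by simp
      fix k u assume k: "k0 \<le> k" and "u \<in> ball z0 (min \<delta>0 \<delta>2)"
      hence u: "u \<in> ball z0 \<delta>0" "dist u z0 < \<delta>2" by (auto simp: dist_commute)
      have kk: "k \<ge> k1" "k \<ge> k2" "k0 \<ge> k2" using k by (auto simp: k0_def)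
      have "dist (R k z0) (R k u) < \<delta>1"
        using k2[OF kk(2,3) z0b] k2[OF kk(2,3) u(1)] \<delta>2(2)[OF u(2)]
          dist_triangle[of "R k z0" "R k u" "R k0 z0"] dist_triangle[of "R k0 z0" "R k u" "R k0 u"]
        by (simp add: dist_commute)
      from \<delta>1(2)[OF RK[OF kk(1)] this] have d: "dist (proj (R k z0)) (proj (R k u)) < e" by blast
      have nz: "E (n k) u $ i \<noteq> 0" "E (n k) z0 $ i \<noteq> 0" using k1[OF kk(1)] u(1) z0b by blast+
      thus "E (n k) u \<noteq> 0" by auto
      show "dist (proj (E (n k) u)) (proj (E (n k) z0)) < e"
        using d nz by (simp add: R_def proj_smult dist_commute)
    qed
  qed
  show ?thesis
  proof (intro exI[of _ "s1 \<circ> s2"] conjI allI impI)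
    show "strict_mono (s1 \<circ> s2)" using s1 s2 by (rule strict_mono_o)
    fix e :: real assume "0 < e"
    from main[OF this] show "\<exists>\<delta>>0. \<exists>k0. \<forall>k\<ge>k0. \<forall>u\<in>ball z0 \<delta>. E (r ((s1 \<circ> s2) k)) u \<noteq> 0 \<and>
        dist (proj (E (r ((s1 \<circ> s2) k)) u)) (proj (E (r ((s1 \<circ> s2) k)) z0)) < e"
      unfolding n_def o_def .
  qed
qed

end

section \<open>Weak normality implies equicontinuity\<close>

lemma complex_differentiable_on_quotient:
  "complex_differentiable_on (\<lambda>v. \<i> *s v) (\<lambda>z::complex^3. z $ j / z $ i - c) {z. z $ i \<noteq> 0}"
  unfolding complex_differentiable_on_def
proof
  fix z :: "complex^3" assume "z \<in> {z. z $ i \<noteq> 0}"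
  hence z: "z $ i \<noteq> 0" by simp
  let ?D = "\<lambda>v::complex^3. (v $ j * z $ i - z $ j * v $ i) / (z $ i * z $ i)"
  have "((\<lambda>z. z $ j / z $ i - c) has_derivative ?D) (at z)"
  proof -
    have d: "((\<lambda>z::complex^3. z $ k) has_derivative (\<lambda>v. v $ k)) (at z)" for k
      by (rule bounded_linear_imp_has_derivative[OF bounded_linear_vec_nth])
    show ?thesis using z by (auto intro!: derivative_eq_intros d simp: field_simps)
  qed
  moreover have "?D (\<i> *s v) = \<i> * ?D v" for v by (simp add: algebra_simps diff_divide_distrib)
  ultimately show "\<exists>D. ((\<lambda>z. z $ j / z $ i - c) has_derivative D) (at z) \<and> (\<forall>v. D (\<i> *s v) = \<i> * D v)"
    by blast
qed

lemma affine_proj_nth: "z \<noteq> 0 \<Longrightarrow> affine i (proj z) $ j = z $ j / z $ i"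
  by (simp add: affine_proj)

lemma complex_differentiable_on_cong:
  assumes "open S" "\<And>z. z \<in> S \<Longrightarrow> h z = h' z"
  shows "complex_differentiable_on J h S \<longleftrightarrow> complex_differentiable_on J h' S"
proof -
  have "(h has_derivative D) (at z) \<longleftrightarrow> (h' has_derivative D) (at z)" if "z \<in> S" for D z
    using has_derivative_transform_within_open[OF _ assms(1) that, of h D UNIV h']
      has_derivative_transform_within_open[OF _ assms(1) that, of h' D UNIV h] assms(2) by auto
  thus ?thesis unfolding complex_differentiable_on_def by blast
qed

lemma complex_differentiable_on_subset:
  "complex_differentiable_on J h S \<Longrightarrow> T \<subseteq> S \<Longrightarrow> complex_differentiable_on J h T"
  unfolding complex_differentiable_on_def by blast

lemma open_cone_chart: "open V \<Longrightarrow> V \<subseteq> chart i \<Longrightarrow> {z. z \<noteq> 0 \<and> proj z \<in> V} \<subseteq> {z. z $ i \<noteq> 0}"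
  using chart_proj by blast

lemma holo_affine:
  assumes "open V" "V \<subseteq> chart i"
  shows "holo (\<lambda>q. affine i q $ j - c) V"
  unfolding holo_def
proof (subst complex_differentiable_on_cong[OF open_cone[OF assms(1)], of _ "\<lambda>z. z $ j / z $ i - c"])
  show "complex_differentiable_on (\<lambda>v. \<i> *s v) (\<lambda>z. z $ j / z $ i - c) {z. z \<noteq> 0 \<and> proj z \<in> V}"
    by (rule complex_differentiable_on_subset[OF complex_differentiable_on_quotient open_cone_chart[OF assms]])
qed (simp add: affine_proj_nth)

lemma holo_isCont:
  assumes "holo h V" "p \<in> V"
  shows "isCont h p"
proof -
  let ?z = "rep_cp2 p"
  have "\<exists>D. ((\<lambda>z. h (proj z)) has_derivative D) (at ?z)"
    using assms rep_cp2_nonzero[of p] unfolding holo_def complex_differentiable_on_def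
    by (auto simp: proj_rep_cp2)
  hence "isCont (\<lambda>z. h (proj z)) ?z" using has_derivative_continuous by blast
  from isCont_from_cone[OF rep_cp2_nonzero this] show ?thesis by (simp add: proj_rep_cp2)
qed

text \<open>A least number gives information only when some number qualifies; the affine coordinates
  of a chart show that three functions isolate \<open>p\<close>. The minimum \<open>0\<close> then
  means that \<open>p\<close> is isolated in \<open>A\<close> with no equation imposed.\<close>

lemma local_dim_0_isolated:
  assumes "local_dim A p = 0" "p \<in> A"
  shows "\<exists>V. open V \<and> p \<in> V \<and> A \<inter> V = {p}"
proof -
  define P where "P k \<longleftrightarrow> (\<exists>V (h :: nat \<Rightarrow> cp2 \<Rightarrow> complex). open V \<and> p \<in> V \<and>
    (\<forall>j<k. holo (h j) V \<and> h j p = 0) \<and> {x \<in> A \<inter> V. \<forall>j<k. h j x = 0} = {p})" for k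
  obtain i where i: "p \<in> chart i" using in_some_chart by blast
  define h where "h = (\<lambda>l::nat. \<lambda>q. affine i q $ (if l = 0 then 1 else if l = 1 then 2 else 3) -
    affine i p $ (if l = 0 then 1 else if l = 1 then 2 else (3::3)))"
  have "{x \<in> A \<inter> chart i. \<forall>j<3. h j x = 0} = {p}"
  proof (intro equalityI subsetI)
    fix x assume x: "x \<in> {x \<in> A \<inter> chart i. \<forall>j<3. h j x = 0}"
    hence "h 0 x = 0" "h 1 x = 0" "h 2 x = 0" by auto
    hence "affine i x = affine i p" unfolding vec_eq_iff forall_3 by (simp add: h_def)
    thus "x \<in> {p}" using proj_affine[of x i] proj_affine[OF i] x by simp
  qed (use i assms(2) in \<open>auto simp: h_def\<close>)
  moreover have "\<forall>j<3. holo (h j) (chart i) \<and> h j p = 0"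
    unfolding h_def using holo_affine[OF open_chart order_refl] by auto
  ultimately have "P 3" unfolding P_def using i open_chart by (intro exI[of _ "chart i"] exI[of _ h]) auto
  hence "P (LEAST k. P k)" by (rule LeastI)
  moreover have "(LEAST k. P k) = 0" using assms(1) unfolding local_dim_def P_def .
  ultimately have "P 0" by simp
  thus ?thesis unfolding P_def by auto
qed

text \<open>Codimension two in the plane forces local dimension \<open>0\<close>, so the points of
  \<open>A\<close> are isolated. At a point of \<open>X\<close> outside \<open>A\<close> one of the
  local equations is nonzero, and by continuity it stays nonzero nearby.\<close>

lemma analytic_subset_isolated:
  assumes an: "analytic_subset holo X A" and co: "codim_ge 2 A" and p: "p \<in> X"
  shows "\<exists>W. open W \<and> p \<in> W \<and> W \<subseteq> X \<and> W \<inter> A \<subseteq> {p}"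
proof (cases "p \<in> A")
  case True
  hence "local_dim A p = 0" using co unfolding codim_ge_def by force
  from local_dim_0_isolated[OF this True] obtain V where V: "open V" "p \<in> V" "A \<inter> V = {p}" by blast
  obtain V' where "open V'" "p \<in> V'" "V' \<subseteq> X" using an p unfolding analytic_subset_def by metis
  thus ?thesis using V by (intro exI[of _ "V \<inter> V'"]) auto
next
  case False
  have "\<exists>V H. open V \<and> p \<in> V \<and> V \<subseteq> X \<and> finite H \<and> (\<forall>h\<in>H. holo h V) \<and> A \<inter> V = {y\<in>V. \<forall>h\<in>H. h y = 0}"
    using an p unfolding analytic_subset_def by simp
  then obtain V H where V: "open V" "p \<in> V" "V \<subseteq> X" "finite H" "\<forall>h\<in>H. holo h V" "A \<inter> V = {y\<in>V. \<forall>h\<in>H. h y = 0}"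
    by (elim exE conjE)
  then obtain h where h: "h \<in> H" "h p \<noteq> 0" using False by blast
  have "isCont h x" if "x \<in> V" for x using holo_isCont[OF _ that] V(5) h(1) by blast
  hence "continuous_on V h" by (simp add: continuous_at_imp_continuous_on)
  hence "open (V \<inter> h -` (- {0}))" using V(1) by (intro continuous_open_preimage) auto
  thus ?thesis using V h by (intro exI[of _ "V \<inter> h -` (- {0})"]) auto
qed

text \<open>Coefficients are compared in the frame \<open>z\<close>, \<open>a\<close>,
  \<open>b\<close>: that of \<open>z\<close> forces the proportionality factor to be
  \<open>1\<close>.\<close>

lemma indep3_proj_inj:
  assumes ind: "indep3 z a b" and z: "z \<noteq> 0" and nz: "z + x *s a + y *s b \<noteq> 0" "z + x' *s a + y' *s b \<noteq> 0"
    and eq: "proj (z + x *s a + y *s b) = proj (z + x' *s a + y' *s b)"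
  shows "y = y'"
proof -
  obtain c where c: "z + x *s a + y *s b = c *s (z + x' *s a + y' *s b)"
    using eq proj_eq_iff[OF nz] by blast
  hence e: "(x - c * x') *s a + (y - c * y') *s b = (c - 1) *s z"
    by (simp add: vec_eq_iff algebra_simps)
  have "\<not> indep2 ((c - 1) *s z) z" by (simp add: indep2_def algebra_simps)
  hence "\<not> indep2 ((x - c * x') *s a + (y - c * y') *s b) z" unfolding e .
  hence xy: "x - c * x' = 0" "y - c * y' = 0" using ind unfolding indep3_def by blast+
  hence "(c - 1) *s z = 0" unfolding e[symmetric] by simp
  hence "c - 1 = 0" using z smult_eq_0_iff by blast
  hence "c = 1" by simp
  thus ?thesis using xy(2) by simp
qed

lemma exists_indep2: "z \<noteq> 0 \<Longrightarrow> \<exists>a. indep2 a z"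
proof -
  assume "z \<noteq> 0"
  then obtain i where i: "z $ i \<noteq> 0" by (auto simp: vec_eq_iff)
  obtain k where k: "k \<noteq> i" using that[of 1] that[of 2] by (cases "i = 1") auto
  have "indep2 (axis k 1) z"
    unfolding indep2_def by (rule exI[of _ k], rule exI[of _ i]) (use i k in \<open>simp add: axis_def\<close>)
  thus ?thesis by blast
qed

context stable_rational_map
begin

text \<open>The zero set of one component is a curve: its zero at \<open>z\<close> gives a nonzero
  winding number on a small circle, and this persists on every nearby parallel disc, so each of them
  contains a zero. If all these were zeros of the whole map, the zero set of \<open>E n\<close> in
  the plane, which is finite, would have infinitely many points.\<close>

lemma isolated_zero_not_hypersurface:
  assumes z: "z \<noteq> 0" and r: "0 < r" and E0: "E n z = 0"
    and i: "\<And>u. u \<in> ball z r \<Longrightarrow> E n u $ i = 0 \<Longrightarrow> E n u = 0" and nz: "\<And>u. u \<in> ball z r \<Longrightarrow> u \<noteq> 0"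
  shows False
proof -
  define Z where "Z = {q. E n (rep_cp2 q) = 0}"
  have Z: "finite Z" unfolding Z_def by (rule finite_E_zeros)
  have EZ: "proj u \<in> Z \<longleftrightarrow> E n u = 0" if "u \<noteq> 0" for u
    using E_proj[OF that, of n] by (auto simp: Z_def smult_eq_0_iff)
  obtain a where a: "indep2 a z" using exists_indep2[OF z] by blast
  obtain b where b: "indep3 z a b" using indep3_exists[OF a] by blast
  define t where "t = norm a + norm b + 1"
  define R where "R = r / t"
  have t: "t > 0" by (simp add: t_def add_nonneg_pos)
  have R: "R > 0" "R * t = r" using r t by (auto simp: R_def)
  have inb: "z + x *s a + y *s b \<in> ball z r" if "cmod x < R" "cmod y < R" for x y
  proof -
    have "dist z (z + x *s a + y *s b) = norm (x *s a + y *s b)"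
      by (metis add.assoc add_diff_cancel_left' dist_norm norm_minus_commute)
    also have "\<dots> \<le> cmod x * norm a + cmod y * norm b"
      using norm_triangle_ineq[of "x *s a" "y *s b"] by (simp add: norm_smult)
    also have "\<dots> \<le> R * norm a + R * norm b" using that by (intro add_mono mult_right_mono) auto
    also have "\<dots> < R * t" using R(1) by (simp add: t_def algebra_simps)
    finally show ?thesis using R(2) by simp
  qed
  have inb0: "z + x *s a \<in> ball z r" if "cmod x < R" for x using inb[of x 0] that R(1) by simp
  obtain p where p: "\<And>x. E n (z + x *s a) $ i = poly p x" using poly_line by blast
  have inj: "inj_on (\<lambda>y. proj (z + \<xi> y *s a + y *s b)) S"
    if "\<And>y. y \<in> S \<Longrightarrow> z + \<xi> y *s a + y *s b \<noteq> 0" for \<xi> S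
    by (rule inj_onI) (use indep3_proj_inj[OF b z] that in blast)
  have infball: "infinite (ball (0::complex) s)" if "s > 0" for s
    using uncountable_ball[OF that] by (rule uncountable_infinite)
  \<comment> \<open>Otherwise component \<open>i\<close> vanishes on a whole disc, which already
    represents infinitely many points of the plane.\<close>
  have "p \<noteq> 0"
  proof
    assume p0: "p = 0"
    have b': "indep3 z b a" using b unfolding indep3_def by (metis add.commute)
    have sub: "(\<lambda>x. proj (z + 0 *s b + x *s a)) ` ball 0 R \<subseteq> Z"
    proof clarify
      fix x :: complex assume "x \<in> ball 0 R"
      hence u: "z + x *s a \<in> ball z r" using inb0 by simp
      have "E n (z + x *s a) = 0" using i[OF u] p p0 by simp
      thus "proj (z + 0 *s b + x *s a) \<in> Z" using EZ[OF nz[OF u]] by simp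
    qed
    have "inj_on (\<lambda>x. proj (z + 0 *s b + x *s a)) (ball 0 R)"
    proof (rule inj_onI)
      fix x x' :: complex assume x: "x \<in> ball 0 R" "x' \<in> ball 0 R"
        and e: "proj (z + 0 *s b + x *s a) = proj (z + 0 *s b + x' *s a)"
      have "z + 0 *s b + x *s a \<noteq> 0" "z + 0 *s b + x' *s a \<noteq> 0" using nz inb0 x by simp_all
      from indep3_proj_inj[OF b' z this e] show "x = x'" .
    qed
    hence "finite (ball (0::complex) R)" using finite_imageD finite_subset[OF sub Z] by blast
    thus False using infball[OF R(1)] by simp
  qed
  hence "finite (cmod ` {x. poly p x = 0})" using poly_roots_finite by blast
  hence "infinite ({0<..<R} - cmod ` {x. poly p x = 0})"
    using R(1) by (intro Diff_infinite_finite) (auto simp: infinite_Ioo)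
  then obtain \<rho> where "\<rho> \<in> {0<..<R} - cmod ` {x. poly p x = 0}" using infinite_imp_nonempty by blast
  hence \<rho>: "0 < \<rho>" "\<rho> < R" "\<And>x. cmod x = \<rho> \<Longrightarrow> poly p x \<noteq> 0" by auto
  obtain N where N: "wind \<rho> (\<lambda>x. E n (z + x *s a) $ i) N"
    using E_line_wind[OF \<rho>(1), of n z a i] \<rho>(3) by (auto simp: p)
  have "N \<noteq> 0"
  proof
    assume "N = 0"
    have ps: "poly p x \<noteq> 0" if "x \<in> sphere 0 \<rho>" for x using \<rho>(3) that by simp
    obtain m u where mu: "p = m * u" "lead_coeff m = 1" "\<forall>x\<in>cball 0 \<rho>. poly u x \<noteq> 0" "wind \<rho> (poly p) (degree m)"
      using poly_zero_factor[OF \<rho>(1) ps] by blast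
    have "wind \<rho> (poly p) 0" using N \<open>N = 0\<close> by (simp add: p)
    from wind_unique[OF \<rho>(1) mu(4) this] obtain c where "m = [:c:]" by (rule degree_eq_zeroE)
    hence "poly p 0 = poly u 0" using mu(1,2) by simp
    moreover have "poly p 0 = 0" using p[of 0] E0 by simp
    moreover have "poly u 0 \<noteq> 0" using mu(3) \<rho>(1) by auto
    ultimately show False by simp
  qed
  let ?K = "(\<lambda>x. z + x *s a) ` sphere 0 \<rho>"
  define W where "W = {u. E n u $ i \<noteq> 0}"
  have "compact ?K" by (intro compact_continuous_image continuous_intros compact_sphere)
  moreover have "?K \<subseteq> W" using \<rho>(3) by (auto simp: W_def p)
  moreover have "open W" unfolding W_def by (intro open_Collect_neq continuous_intros)
  ultimately obtain \<delta> where \<delta>: "\<delta> > 0" "\<And>x y. x \<in> ?K \<Longrightarrow> dist x y < \<delta> \<Longrightarrow> y \<in> W"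
    using compact_uniform_nbhd[of ?K W "\<lambda>x. x" 1] by (auto simp del: image_iff)
  define \<epsilon> where "\<epsilon> = min (\<delta> / t) R / 2"
  have \<epsilon>: "\<epsilon> > 0" "\<epsilon> < R" "\<epsilon> < \<delta> / t" 
  proof -
    have m: "0 < min q R / 2 \<and> min q R / 2 < R \<and> min q R / 2 < q" if "0 < q" for q using that R(1) by auto
    have "0 < \<delta> / t" using \<delta>(1) t by simp
    from m[OF this] show "\<epsilon> > 0" "\<epsilon> < R" "\<epsilon> < \<delta> / t" unfolding \<epsilon>_def by blast+
  qed
  have "\<epsilon> * norm b \<le> \<epsilon> * t" using \<epsilon>(1) by (intro mult_left_mono) (auto simp: t_def)
  also have "\<epsilon> * t < \<delta>" using \<epsilon>(3) t by (simp add: pos_less_divide_eq)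
  finally have \<epsilon>b: "\<epsilon> * norm b < \<delta>" .
  have circ: "E n (z + x *s a + y *s b) $ i \<noteq> 0" if "cmod x = \<rho>" "cmod y \<le> \<epsilon>" for x y
  proof -
    have "dist (z + x *s a) (z + x *s a + y *s b) = cmod y * norm b" by (simp add: dist_norm norm_smult)
    also have "\<dots> \<le> \<epsilon> * norm b" using that by (intro mult_right_mono) auto
    finally have "dist (z + x *s a) (z + x *s a + y *s b) < \<delta>" using \<epsilon>b by linarith
    moreover have "z + x *s a \<in> ?K" using that(1) by (intro imageI) simp
    ultimately have "z + x *s a + y *s b \<in> W" using \<delta>(2) by blast
    thus ?thesis by (simp add: W_def)
  qed
  have "\<exists>x\<in>ball 0 \<rho>. E n (z + x *s a + y *s b) $ i = 0" if y: "y \<in> ball 0 \<epsilon>" for y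
  proof -
    have wy: "wind \<rho> (\<lambda>x. E n (z + x *s a + y *s b) $ i) N"
    proof (rule wind_homotopic[where K = "\<lambda>x y. E n (z + x *s a + y *s b) $ i" and Y = "cball 0 \<epsilon>" and ?y0.0 = 0])
      show "continuous_on (sphere 0 \<rho> \<times> cball 0 \<epsilon>) (\<lambda>(x, y). E n (z + x *s a + y *s b) $ i)"
        unfolding case_prod_beta by (intro continuous_intros)
      show "wind \<rho> (\<lambda>x. E n (z + x *s a + 0 *s b) $ i) N" using N by simp
    qed (use \<epsilon>(1) y circ in auto)
    have sw: "z + x *s a + y *s b = (z + y *s b) + x *s a" for x by (simp add: algebra_simps)
    obtain p' where "\<And>x. E n ((z + y *s b) + x *s a) $ i = poly p' x" using poly_line by blast
    hence p': "E n (z + x *s a + y *s b) $ i = poly p' x" for x by (simp only: sw)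
    have ps: "poly p' x \<noteq> 0" if "x \<in> sphere 0 \<rho>" for x using circ[of x y] that y by (simp add: p')
    have "wind \<rho> (poly p') N" using wy by (simp only: p')
    from wind_poly_root[OF \<rho>(1) ps this \<open>N \<noteq> 0\<close>] show ?thesis by (simp add: p')
  qed
  \<comment> \<open>One zero is chosen on each parallel disc; an arbitrary choice is injective,
    since different \<open>y\<close> give different points of the plane.\<close>
  then obtain \<xi> where \<xi>: "\<And>y. y \<in> ball 0 \<epsilon> \<Longrightarrow> \<xi> y \<in> ball 0 \<rho>"
    "\<And>y. y \<in> ball 0 \<epsilon> \<Longrightarrow> E n (z + \<xi> y *s a + y *s b) $ i = 0" by metis
  have ub: "z + \<xi> y *s a + y *s b \<in> ball z r" if "y \<in> ball 0 \<epsilon>" for y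
    using \<xi>(1)[OF that] that \<rho>(2) \<epsilon>(2) by (intro inb) auto
  have sub: "(\<lambda>y. proj (z + \<xi> y *s a + y *s b)) ` ball 0 \<epsilon> \<subseteq> Z"
  proof (rule image_subsetI)
    fix y :: complex assume y: "y \<in> ball 0 \<epsilon>"
    show "proj (z + \<xi> y *s a + y *s b) \<in> Z"
      using EZ[OF nz[OF ub[OF y]]] i[OF ub[OF y] \<xi>(2)[OF y]] by blast
  qed
  have "inj_on (\<lambda>y. proj (z + \<xi> y *s a + y *s b)) (ball 0 \<epsilon>)"
    by (rule inj) (use nz ub in blast)
  hence "finite (ball (0::complex) \<epsilon>)" using finite_imageD finite_subset[OF sub Z] by blast
  thus False using infball[OF \<epsilon>(1)] by simp
qed

end

section \<open>Hausdorff convergence of graphs\<close>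

lemma graph_on_continuous_unique:
  fixes l :: "'a::metric_space \<Rightarrow> 'b::metric_space option"
  assumes "(x, y) \<in> closure {(x, y). x \<in> X \<and> l x = Some y}" "continuous_on U (\<lambda>x. the (l x))" "open U" "x \<in> U"
  shows "y = the (l x)"
proof -
  have c: "isCont (\<lambda>x. the (l x)) x" using assms(2-4) by (simp add: continuous_on_eq_continuous_at)
  have "dist y (the (l x)) \<le> 0 + e" if e: "0 < e" for e
  proof -
    obtain \<delta> where \<delta>: "\<delta> > 0" "\<And>x'. dist x' x < \<delta> \<Longrightarrow> dist (the (l x')) (the (l x)) < e / 2"
      using c half_gt_zero[OF e] unfolding continuous_at_eps_delta by blast
    have "min \<delta> (e / 2) > 0" using \<delta>(1) e by simp
    then obtain z where z: "z \<in> {(x, y). x \<in> X \<and> l x = Some y}" "dist z (x, y) < min \<delta> (e / 2)"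
      using assms(1) unfolding closure_approachable by blast
    have zl: "l (fst z) = Some (snd z)" using z(1) by auto
    have d: "dist (fst z) x < min \<delta> (e / 2)" "dist (snd z) y < min \<delta> (e / 2)"
      using dist_fst_le[of z "(x, y)"] dist_snd_le[of z "(x, y)"] z(2) by simp_all
    have "dist (snd z) (the (l x)) < e / 2" using \<delta>(2)[of "fst z"] d(1) zl by simp
    hence "dist y (the (l x)) < e / 2 + e / 2"
      using dist_triangle[of y "the (l x)" "snd z"] d(2) by (simp add: dist_commute)
    thus ?thesis by simp
  qed
  hence "dist y (the (l x)) \<le> 0" by (rule field_le_epsilon)
  thus ?thesis by simp
qed

lemma hausdorff_dist_lessD:
  assumes "hausdorff_dist A B < ennreal e" "a \<in> A"
  shows "\<exists>b\<in>B. dist b a < e"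
proof -
  obtain e' where e': "ennreal e' < ennreal e" "0 < e'" "A \<subseteq> (\<Union>b\<in>B. ball b e')"
    using assms(1) unfolding hausdorff_dist_def by (auto simp: Inf_less_iff)
  then obtain b where "b \<in> B" "dist b a < e'" using assms(2) by auto
  moreover have "e' < e" using e'(1,2) by (metis ennreal_leI leI leD)
  ultimately show ?thesis by (metis less_trans)
qed

text \<open>The Hausdorff distance supplies a nearby point of the limit graph over a possibly
  different base point \<open>x'\<close>; uniform continuity of the limit brings it back to
  \<open>x\<close>. The conclusion concerns only points at which \<open>g k\<close> is
  defined.\<close>

lemma strongly_converges_near_graph:
  assumes conv: "strongly_converges_on X g l" and K: "compact K" "K \<subseteq> X" "K \<subseteq> U"
    and U: "open U" "continuous_on U (\<lambda>x. the (l x))" and e: "0 < e"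
  shows "\<forall>\<^sub>F k in sequentially. \<forall>x\<in>K. \<forall>y. g k x = Some y \<longrightarrow> dist y (the (l x)) < e"
proof -
  obtain \<delta> where \<delta>: "\<delta> > 0" "\<And>x y. x \<in> K \<Longrightarrow> dist x y < \<delta> \<Longrightarrow> dist (the (l x)) (the (l y)) < e / 2"
    using compact_uniform_nbhd[OF K(1,3) U, of "e / 2"] e by auto
  define \<delta>' where "\<delta>' = min \<delta> (e / 2)"
  have \<delta>': "\<delta>' > 0" "\<delta>' \<le> \<delta>" "\<delta>' \<le> e / 2" using \<delta>(1) e by (auto simp: \<delta>'_def)
  have "(\<lambda>n. hausdorff_dist (graph_on X (g n) \<inter> K \<times> UNIV) (graph_on X l \<inter> K \<times> UNIV)) \<longlonglongrightarrow> 0"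
    using conv K(1,2) unfolding strongly_converges_on_def by blast
  hence "\<forall>\<^sub>F n in sequentially. hausdorff_dist (graph_on X (g n) \<inter> K \<times> UNIV) (graph_on X l \<inter> K \<times> UNIV) < ennreal \<delta>'"
    using order_tendstoD(2) \<delta>'(1) by (metis ennreal_less_zero_iff)
  thus ?thesis
  proof eventually_elim
    case (elim k)
    show ?case
    proof (intro ballI allI impI)
      fix x y assume x: "x \<in> K" and y: "g k x = Some y"
      have "(x, y) \<in> graph_on X (g k) \<inter> K \<times> UNIV"
        using x y K(2) closure_subset[of "{(x, y). x \<in> X \<and> g k x = Some y}"] unfolding graph_on_def by auto
      from hausdorff_dist_lessD[OF elim this] obtain x' y' where xy': "(x', y') \<in> graph_on X l" "x' \<in> K" "dist (x', y') (x, y) < \<delta>'"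
        by auto
      have "y' = the (l x')"
        using graph_on_continuous_unique[OF _ U(2,1), of x' y' X] xy'(1,2) K(3) unfolding graph_on_def by blast
      moreover have "dist x' x < \<delta>'" "dist y' y < \<delta>'"
        using xy'(3) dist_fst_le[of "(x', y')" "(x, y)"] dist_snd_le[of "(x', y')" "(x, y)"] by simp_all
      moreover have "dist (the (l x')) (the (l x)) < e / 2"
        using \<delta>(2)[OF xy'(2), of x] calculation(2) \<delta>'(2) by simp
      ultimately show "dist y (the (l x)) < e"
        using dist_triangle[of y "the (l x)" y'] \<delta>'(3) by (simp add: dist_commute)
    qed
  qed
qed

context stable_rational_map
begin

text \<open>The exceptional set and the indeterminacy set of the limit are both discrete, so a
  punctured neighbourhood of \<open>proj z0\<close> avoids them. That late iterates are defined on
  compact subsets needs a separate argument: on a small ball all their defined values lie in one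
  chart \<open>i\<close>, so a zero of component \<open>i\<close> is a zero of the whole map, and
  \<open>isolated_zero_not_hypersurface\<close> excludes this.\<close>

lemma weak_imp_converges:
  assumes wc: "weakly_converges_on X (\<lambda>k. iterate f (n k)) l" and mero: "meromorphic_map_on X l"
    and z0: "z0 \<noteq> 0" "proj z0 \<in> X" and n: "\<And>k. n k \<ge> 1"
  shows "\<exists>\<eta> g. converges z0 \<eta> n g"
proof -
  obtain A where A: "analytic_subset holo X A" "codim_ge 2 A" "strongly_converges_on (X - A) (\<lambda>k. iterate f (n k)) l"
    using wc unfolding weakly_converges_on_def by blast
  obtain W1 where W1: "open W1" "proj z0 \<in> W1" "W1 \<subseteq> X" "W1 \<inter> A \<subseteq> {proj z0}"
    using analytic_subset_isolated[OF A(1,2) z0(2)] by blast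
  have "analytic_subset holo X (X - dom l)" "codim_ge 2 (X - dom l)"
    using mero unfolding meromorphic_map_on_def by blast+
  from analytic_subset_isolated[OF this z0(2)]
  obtain W2 where W2: "open W2" "proj z0 \<in> W2" "W2 \<subseteq> X" "W2 \<inter> (X - dom l) \<subseteq> {proj z0}" by blast
  have dl: "open (dom l)" "continuous_on (dom l) (\<lambda>x. the (l x))"
    using mero unfolding meromorphic_map_on_def holomorphic_map_on_def by blast+
  have "open {z. z \<noteq> 0 \<and> proj z \<in> W1 \<inter> W2}" by (intro open_cone open_Int W1 W2)
  moreover have "z0 \<in> {z. z \<noteq> 0 \<and> proj z \<in> W1 \<inter> W2}" using z0 W1 W2 by simp
  ultimately obtain \<eta> where \<eta>: "\<eta> > 0" "ball z0 \<eta> \<subseteq> {z. z \<noteq> 0 \<and> proj z \<in> W1 \<inter> W2}"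
    unfolding open_contains_ball by blast
  have nzP: "u \<noteq> 0" if "u \<in> punct z0 \<eta>" for u using that \<eta>(2) unfolding punct_def by blast
  have inY: "proj u \<in> X - A \<and> proj u \<in> dom l" if u: "u \<in> punct z0 \<eta>" for u
  proof -
    have "u \<noteq> 0" "proj u \<in> W1 \<inter> W2" "indep2 u z0" using u \<eta>(2) unfolding punct_def by blast+
    moreover have "proj u \<noteq> proj z0"
    proof
      assume "proj u = proj z0"
      then obtain c where "u = c *s z0" using proj_eq_iff[OF \<open>u \<noteq> 0\<close> z0(1)] by blast
      thus False using \<open>indep2 u z0\<close> by (simp add: indep2_def mult_ac)
    qed
    ultimately show ?thesis using W1(3,4) W2(3,4) by blast
  qed
  define g where "g u = the (l (proj u))" for u
  have projc: "continuous_on (punct z0 \<eta>) proj"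
    by (rule continuous_on_subset[OF continuous_on_proj]) (use nzP in auto)
  have contg: "continuous_on (punct z0 \<eta>) g"
    unfolding g_def by (rule continuous_on_compose2[OF dl(2) projc]) (use inY in blast)
  have near: "\<forall>\<^sub>F k in sequentially. \<forall>u\<in>K. E (n k) u \<noteq> 0 \<longrightarrow> dist (proj (E (n k) u)) (g u) < e"
    if K: "compact K" "K \<subseteq> punct z0 \<eta>" and e: "0 < e" for K e
  proof -
    have K1: "compact (proj ` K)" by (rule compact_continuous_image[OF continuous_on_subset[OF projc K(2)] K(1)])
    have K2: "proj ` K \<subseteq> X - A" "proj ` K \<subseteq> dom l" using inY K(2) by blast+
    from strongly_converges_near_graph[OF A(3) K1 K2 dl e]
    show ?thesis
    proof eventually_elim
      case (elim k)
      show ?case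
      proof (intro ballI impI)
        fix u assume u: "u \<in> K" "E (n k) u \<noteq> 0"
        have "iterate f (n k) (proj u) = Some (proj (E (n k) u))"
          using iterate_proj[OF n nzP] u K(2) by auto
        thus "dist (proj (E (n k) u)) (g u) < e" using elim u(1) unfolding g_def by blast
      qed
    qed
  qed
  have nonzero: "\<exists>r>0. \<forall>\<^sub>F k in sequentially. \<forall>u\<in>ball u0 r. E (n k) u \<noteq> 0" if u0: "u0 \<in> punct z0 \<eta>" for u0
  proof -
    obtain i where i: "g u0 \<in> chart i" using in_some_chart by blast
    have "open (punct z0 \<eta> \<inter> g -` chart i)" by (rule continuous_open_preimage[OF contg open_punct open_chart])
    moreover have "u0 \<in> punct z0 \<eta> \<inter> g -` chart i" using u0 i by simp
    ultimately obtain r where r: "r > 0" "cball u0 r \<subseteq> punct z0 \<eta> \<inter> g -` chart i"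
      using open_contains_cball by blast
    have cb: "cball u0 r \<subseteq> punct z0 \<eta>" "g ` cball u0 r \<subseteq> chart i" using r(2) by auto
    have cg: "compact (g ` cball u0 r)"
      by (rule compact_continuous_image[OF continuous_on_subset[OF contg cb(1)] compact_cball])
    obtain \<delta> where \<delta>: "\<delta> > 0" "\<And>x y. x \<in> g ` cball u0 r \<Longrightarrow> dist x y < \<delta> \<Longrightarrow> y \<in> chart i"
      using compact_uniform_nbhd[OF cg cb(2) open_chart continuous_on_affine zero_less_one] by blast
    have "\<forall>\<^sub>F k in sequentially. \<forall>u\<in>ball u0 r. E (n k) u \<noteq> 0"
      using near[OF compact_cball cb(1) \<delta>(1)]
    proof eventually_elim
      case (elim k)
      have key: "E (n k) u = 0" if u: "u \<in> ball u0 r" "E (n k) u $ i = 0" for u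
      proof (rule ccontr)
        assume nz: "E (n k) u \<noteq> 0"
        have uc: "u \<in> cball u0 r" using u(1) by simp
        have "dist (g u) (proj (E (n k) u)) < \<delta>" using elim uc nz by (simp add: dist_commute)
        hence "proj (E (n k) u) \<in> chart i" using \<delta>(2) uc by blast
        thus False using chart_proj[OF nz] u(2) by simp
      qed
      show ?case
      proof
        fix u1 assume u1: "u1 \<in> ball u0 r"
        obtain r1 where r1: "r1 > 0" "ball u1 r1 \<subseteq> ball u0 r" using u1 open_contains_ball[of "ball u0 r"] open_ball by blast
        have nzb: "u \<noteq> 0" if "u \<in> ball u0 r" for u
          using nzP cb(1) that ball_subset_cball by blast
        show "E (n k) u1 \<noteq> 0"
        proof
          assume "E (n k) u1 = 0"
          from isolated_zero_not_hypersurface[OF nzb[OF u1] r1(1) this, of i] show False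
            using key nzb r1(2) by blast
        qed
      qed
    qed
    thus ?thesis using r(1) by blast
  qed
  have "converges z0 \<eta> n g"
    unfolding converges_def
  proof (intro conjI allI impI \<eta>(1) z0(1) contg)
    fix K and e :: real assume K: "compact K" "K \<subseteq> punct z0 \<eta>" and e: "0 < e"
    have "\<exists>r. \<forall>u0\<in>K. r u0 > 0 \<and> (\<forall>\<^sub>F k in sequentially. \<forall>u\<in>ball u0 (r u0). E (n k) u \<noteq> 0)"
      using nonzero K(2) by (intro bchoice) blast
    then obtain r where r: "\<And>u0. u0 \<in> K \<Longrightarrow> r u0 > 0"
      "\<And>u0. u0 \<in> K \<Longrightarrow> \<forall>\<^sub>F k in sequentially. \<forall>u\<in>ball u0 (r u0). E (n k) u \<noteq> 0" by blast
    have "K \<subseteq> (\<Union>u0\<in>K. ball u0 (r u0))" using r(1) by force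
    then obtain C where C: "C \<subseteq> K" "finite C" "K \<subseteq> (\<Union>u0\<in>C. ball u0 (r u0))"
      using compactE_image[OF K(1), of K "\<lambda>u0. ball u0 (r u0)"] by auto
    have "\<forall>\<^sub>F k in sequentially. \<forall>u0\<in>C. \<forall>u\<in>ball u0 (r u0). E (n k) u \<noteq> 0"
      using C(1,2) r(2) by (intro eventually_ball_finite) auto
    with near[OF K e]
    show "\<forall>\<^sub>F k in sequentially. \<forall>u\<in>K. E (n k) u \<noteq> 0 \<and> dist (proj (E (n k) u)) (g u) < e"
      by eventually_elim (use C(3) in blast)
  qed
  thus ?thesis by blast
qed

lemma weakly_normal_imp_all_subseq_converge:
  assumes wn: "weakly_normal_on X (\<lambda>n. iterate f (Suc n))" and z0: "z0 \<noteq> 0" "proj z0 \<in> X"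
  shows "all_subseq_converge z0"
  unfolding all_subseq_converge_def
proof (intro allI impI)
  fix r :: "nat \<Rightarrow> nat" assume r: "strict_mono r"
  \<comment> \<open>The normality hypothesis numbers the iterates from \<open>f\<close> itself at
    index \<open>0\<close>. Dropping the first entry of \<open>r\<close> makes all its values
    positive, so that they can be shifted down by one.\<close>
  define r' where "r' k = r (Suc k) - 1" for k
  have pos: "r (Suc k) \<ge> 1" for k using strict_monoD[OF r, of k "Suc k"] by simp
  have Sr: "Suc (r' k) = r (Suc k)" for k using pos[of k] by (simp add: r'_def)
  have "strict_mono r'"
  proof (rule strict_monoI)
    fix a b :: nat assume "a < b"
    hence "Suc (r' a) < Suc (r' b)" unfolding Sr using r by (simp add: strict_mono_less)
    thus "r' a < r' b" by simp
  qed
  then obtain s l where s: "strict_mono (s :: nat \<Rightarrow> nat)" "meromorphic_map_on X l"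
    "weakly_converges_on X ((\<lambda>n. iterate f (Suc n)) \<circ> r' \<circ> s) l"
    using wn unfolding weakly_normal_on_def by blast
  have e: "(\<lambda>n. iterate f (Suc n)) \<circ> r' \<circ> s = (\<lambda>k. iterate f (r (Suc (s k))))" by (simp add: fun_eq_iff Sr)
  obtain \<eta> g where conv: "converges z0 \<eta> (\<lambda>k. r (Suc (s k))) g"
    using weak_imp_converges[OF s(3)[unfolded e] s(2) z0 pos] by blast
  have "strict_mono (\<lambda>k. Suc (s k))" using s(1) by (simp add: strict_mono_def)
  thus "\<exists>(s :: nat \<Rightarrow> nat) \<eta> g. strict_mono s \<and> converges z0 \<eta> (r \<circ> s) g"
    using conv by (intro exI[of _ "\<lambda>k. Suc (s k)"] exI[of _ \<eta>] exI[of _ g]) (simp add: o_def)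
qed

lemma isCont_iterate:
  assumes "n \<ge> 1" "z0 \<noteq> 0" "E n z0 \<noteq> 0"
  shows "isCont (\<lambda>x. the (iterate f n x)) (proj z0)"
proof (rule isCont_from_cone[OF assms(2)])
  define S where "S = {z. z \<noteq> 0 \<and> E n z \<noteq> 0}"
  have "open S" unfolding S_def by (intro open_Collect_conj open_Collect_neq continuous_intros)
  have "continuous_on S (\<lambda>z. proj (E n z))"
    by (rule continuous_on_compose2[OF continuous_on_proj]) (auto simp: S_def intro!: continuous_intros)
  hence "continuous_on S (\<lambda>z. the (iterate f n (proj z)))"
    by (rule continuous_on_eq) (use iterate_proj[OF assms(1)] in \<open>auto simp: S_def\<close>)
  moreover have "z0 \<in> S" using assms by (simp add: S_def)
  ultimately show "isCont (\<lambda>z. the (iterate f n (proj z))) z0"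
    using \<open>open S\<close> continuous_on_eq_continuous_at by blast
qed

text \<open>Indeterminacy sets grow with \<open>n\<close>, while along a subsequence the late lifts
  are nonzero at \<open>?z\<close>, so no iterate is indeterminate at \<open>p\<close>. A failure of
  equicontinuity would be witnessed by iterates with increasing indices and points tending to
  \<open>p\<close>, contradicting \<open>tail_equicontinuous\<close> for a subsequence of
  them.\<close>

lemma weak_normal_equicontinuous_at:
  assumes wn: "weakly_normal_on X (\<lambda>n. iterate f (Suc n))" and p: "p \<in> X"
  shows "\<forall>n\<ge>1. p \<notin> indet (iterate f n)"
    and "\<And>\<epsilon>. 0 < \<epsilon> \<Longrightarrow> \<exists>\<delta>>0. \<exists>n0. \<forall>n\<ge>n0. \<forall>y. dist p y < \<delta> \<longrightarrow> dist (the (iterate f (Suc n) p)) (the (iterate f (Suc n) y)) < \<epsilon>"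
proof -
  let ?z = "rep_cp2 p"
  have z: "?z \<noteq> 0" "proj ?z = p" by (rule rep_cp2_nonzero, rule proj_rep_cp2)
  have acs: "all_subseq_converge ?z"
    using weakly_normal_imp_all_subseq_converge[OF wn] z p by simp
  show "\<forall>n\<ge>1. p \<notin> indet (iterate f n)"
  proof (intro allI impI notI)
    fix n :: nat assume n: "1 \<le> n" "p \<in> indet (iterate f n)"
    have "strict_mono (\<lambda>k::nat. k)" by (simp add: strict_mono_def)
    from tail_equicontinuous[OF acs this] obtain s :: "nat \<Rightarrow> nat" where s: "strict_mono s"
      "\<And>e. e > 0 \<Longrightarrow> \<exists>\<delta>>0. \<exists>k0. \<forall>k\<ge>k0. \<forall>u\<in>ball ?z \<delta>. E (s k) u \<noteq> 0 \<and>
        dist (proj (E (s k) u)) (proj (E (s k) ?z)) < e" by auto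
    obtain \<delta> k0 where k0: "\<delta> > 0" "\<And>k u. k \<ge> k0 \<Longrightarrow> u \<in> ball ?z \<delta> \<Longrightarrow> E (s k) u \<noteq> 0"
      using s(2)[OF zero_less_one] by blast
    let ?k = "max k0 n"
    have "E (s ?k) ?z \<noteq> 0" using k0 by simp
    moreover have "s ?k \<ge> n" using seq_suble[OF s(1), of ?k] by simp
    hence "p \<in> indet (iterate f (s ?k))" using indet_mono[OF n(1), of "s ?k"] n(2) by blast
    ultimately show False using indet_proj[of "s ?k" ?z] z \<open>s ?k \<ge> n\<close> n(1) by simp
  qed
  fix \<epsilon> :: real assume \<epsilon>: "0 < \<epsilon>"
  show "\<exists>\<delta>>0. \<exists>n0. \<forall>n\<ge>n0. \<forall>y. dist p y < \<delta> \<longrightarrow> dist (the (iterate f (Suc n) p)) (the (iterate f (Suc n) y)) < \<epsilon>"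
  proof (rule ccontr)
    assume neg: "\<not> ?thesis"
    define bad where "bad k n \<longleftrightarrow> (\<exists>y. dist p y < 1 / Suc k \<and>
      \<not> dist (the (iterate f (Suc n) p)) (the (iterate f (Suc n) y)) < \<epsilon>)" for k n :: nat
    have ex: "\<exists>n\<ge>n0. bad k n" for k n0
    proof -
      have "1 / real (Suc k) > 0" by simp
      thus ?thesis using neg unfolding bad_def by blast
    qed
    have "\<exists>r::nat \<Rightarrow> nat. \<forall>k. bad k (r k) \<and> r k < r (Suc k)"
    proof (rule dependent_nat_choice)
      show "\<exists>x. bad 0 x" using ex by blast
      show "\<exists>y. bad (Suc n) y \<and> x < y" for x n using ex[of "Suc x" "Suc n"] by (auto simp: Suc_le_eq)
    qed
    then obtain r :: "nat \<Rightarrow> nat" where r: "\<And>k. bad k (r k)" "\<And>k. r k < r (Suc k)" by blast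
    have "strict_mono (\<lambda>k. Suc (r k))" using r(2) by (simp add: strict_mono_Suc_iff)
    from tail_equicontinuous[OF acs this] obtain s :: "nat \<Rightarrow> nat" where s: "strict_mono s"
      "\<And>e. e > 0 \<Longrightarrow> \<exists>\<delta>>0. \<exists>k0. \<forall>k\<ge>k0. \<forall>u\<in>ball ?z \<delta>. E (Suc (r (s k))) u \<noteq> 0 \<and>
        dist (proj (E (Suc (r (s k))) u)) (proj (E (Suc (r (s k))) ?z)) < e" by auto
    obtain \<delta> k0 where k0: "\<delta> > 0" "\<And>k u. k \<ge> k0 \<Longrightarrow> u \<in> ball ?z \<delta> \<Longrightarrow> E (Suc (r (s k))) u \<noteq> 0 \<and>
        dist (proj (E (Suc (r (s k))) u)) (proj (E (Suc (r (s k))) ?z)) < \<epsilon>"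
      using s(2)[OF \<epsilon>] by blast
    obtain \<delta>' where \<delta>': "\<delta>' > 0" "\<And>q. dist q (proj ?z) < \<delta>' \<Longrightarrow> \<exists>u. norm (u - ?z) < \<delta> \<and> u \<noteq> 0 \<and> proj u = q"
      using lift_near[OF z(1) k0(1)] by blast
    obtain k1 :: nat where k1: "1 / real (Suc k1) < \<delta>'" using \<delta>'(1) nat_approx_posE by blast
    let ?k = "max k0 k1"
    have sk: "s ?k \<ge> k1" using seq_suble[OF s(1), of ?k] by simp
    obtain y where y: "dist p y < 1 / Suc (s ?k)"
      "\<not> dist (the (iterate f (Suc (r (s ?k))) p)) (the (iterate f (Suc (r (s ?k))) y)) < \<epsilon>"
      using r(1)[of "s ?k"] unfolding bad_def by blast
    \<comment> \<open>The bad point for index \<open>s ?k\<close> is within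
      \<open>1 / Suc (s ?k)\<close> of \<open>p\<close>, so taking \<open>?k\<close> beyond
      \<open>k1\<close> brings it into the range where it lifts to a vector close to
      \<open>?z\<close>.\<close>
    have "1 / real (Suc (s ?k)) \<le> 1 / real (Suc k1)" using sk by (simp add: frac_le)
    hence "dist y (proj ?z) < \<delta>'" using y(1) k1 z(2) by (simp add: dist_commute)
    then obtain u where u: "norm (u - ?z) < \<delta>" "u \<noteq> 0" "proj u = y" using \<delta>'(2) by blast
    have "u \<in> ball ?z \<delta>" using u(1) by (simp add: dist_norm norm_minus_commute)
    from k0(2)[OF _ this, of ?k] k0(2)[of ?k ?z] k0(1)
    have "E (Suc (r (s ?k))) u \<noteq> 0" "E (Suc (r (s ?k))) ?z \<noteq> 0"
      "dist (proj (E (Suc (r (s ?k))) u)) (proj (E (Suc (r (s ?k))) ?z)) < \<epsilon>" by auto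
    moreover have "the (iterate f (Suc (r (s ?k))) y) = proj (E (Suc (r (s ?k))) u)"
      using iterate_proj[OF _ u(2), of "Suc (r (s ?k))"] u(3) calculation(1) by simp
    moreover have "the (iterate f (Suc (r (s ?k))) p) = proj (E (Suc (r (s ?k))) ?z)"
      using iterate_proj[OF _ z(1), of "Suc (r (s ?k))"] z(2) calculation(2) by simp
    ultimately show False using y(2) by (simp add: dist_commute)
  qed
qed

text \<open>Equicontinuity of the tail at a point is completed by the finitely many earlier
  iterates, each continuous because no point of \<open>U\<close> is indeterminate.\<close>

lemma weak_fatou_subset_fatou: "weak_fatou_set f \<subseteq> fatou_set f"
proof
  fix p assume "p \<in> weak_fatou_set f"
  then obtain U where U: "open U" "weakly_normal_on U (\<lambda>n. iterate f (Suc n))" "p \<in> U"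
    unfolding weak_fatou_set_def by blast
  have noI: "x \<notin> indet (iterate f n)" if "x \<in> U" "n \<ge> 1" for x n
    using weak_normal_equicontinuous_at(1)[OF U(2) that(1)] that(2) by blast
  have "U \<inter> (\<Union>n\<in>{1..}. indet (iterate f n)) = {}" using noI by auto
  hence sub: "U \<subseteq> - closure (\<Union>n\<in>{1..}. indet (iterate f n))"
    using open_Int_closure_eq_empty[OF U(1)] by blast
  have "locally_equicontinuous_on U (\<lambda>n x. the (iterate f (Suc n) x))"
    unfolding locally_equicontinuous_on_def
  proof (intro ballI)
    fix q assume "q \<in> U"
    show "\<exists>V. open V \<and> q \<in> V \<and> V \<subseteq> U \<and> (\<forall>x\<in>V. \<forall>\<epsilon>>0. \<exists>\<delta>>0. \<forall>n. \<forall>y\<in>V. dist x y < \<delta> \<longrightarrow>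
        dist (the (iterate f (Suc n) x)) (the (iterate f (Suc n) y)) < \<epsilon>)"
    proof (intro exI[of _ U] conjI ballI allI impI U(1) \<open>q \<in> U\<close> order_refl)
      fix x and \<epsilon> :: real assume x: "x \<in> U" and \<epsilon>: "0 < \<epsilon>"
      obtain \<delta> n0 where \<delta>: "\<delta> > 0" "\<And>n y. n \<ge> n0 \<Longrightarrow> dist x y < \<delta> \<Longrightarrow>
          dist (the (iterate f (Suc n) x)) (the (iterate f (Suc n) y)) < \<epsilon>"
        using weak_normal_equicontinuous_at(2)[OF U(2) x \<epsilon>] by blast
      have "\<exists>\<delta>>0. \<forall>y. dist x y < \<delta> \<longrightarrow> dist (the (iterate f (Suc n) x)) (the (iterate f (Suc n) y)) < \<epsilon>" for n
      proof -
        have "E (Suc n) (rep_cp2 x) \<noteq> 0"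
          using noI[OF x, of "Suc n"] indet_proj[of "Suc n" "rep_cp2 x"] rep_cp2_nonzero by (simp add: proj_rep_cp2)
        from isCont_iterate[OF _ rep_cp2_nonzero this]
        have "isCont (\<lambda>x. the (iterate f (Suc n) x)) x" by (simp add: proj_rep_cp2)
        thus ?thesis using \<epsilon> unfolding continuous_at_eps_delta by (metis dist_commute)
      qed
      then obtain \<Delta> where \<Delta>: "\<And>n. \<Delta> n > 0" "\<And>n y. dist x y < \<Delta> n \<Longrightarrow>
          dist (the (iterate f (Suc n) x)) (the (iterate f (Suc n) y)) < \<epsilon>" by metis
      define \<delta>' where "\<delta>' = Min (insert \<delta> (\<Delta> ` {..<n0}))"
      have "\<delta>' > 0" unfolding \<delta>'_def using \<delta>(1) \<Delta>(1) by (subst Min_gr_iff) auto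
      moreover have "dist (the (iterate f (Suc n) x)) (the (iterate f (Suc n) y)) < \<epsilon>" if "dist x y < \<delta>'" for n y
      proof (cases "n < n0")
        case True
        hence "\<delta>' \<le> \<Delta> n" unfolding \<delta>'_def by (intro Min_le) auto
        thus ?thesis using \<Delta>(2)[of y n] that by simp
      next
        case False
        have "\<delta>' \<le> \<delta>" unfolding \<delta>'_def by (intro Min_le) auto
        thus ?thesis using \<delta>(2)[of n y] that False by simp
      qed
      ultimately show "\<exists>\<delta>>0. \<forall>n. \<forall>y\<in>U. dist x y < \<delta> \<longrightarrow>
          dist (the (iterate f (Suc n) x)) (the (iterate f (Suc n) y)) < \<epsilon>" by blast
    qed
  qed
  thus "p \<in> fatou_set f" unfolding fatou_set_def using U(1,3) sub by blast
qed

end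

section \<open>Equicontinuity implies strong normality\<close>

definition cdiff :: "(complex^3 \<Rightarrow> complex) \<Rightarrow> complex^3 \<Rightarrow> bool" where
  "cdiff h z \<longleftrightarrow> (\<exists>D. (h has_derivative D) (at z) \<and> (\<forall>v. D (\<i> *s v) = \<i> * D v))"

lemma complex_differentiable_on_cdiff:
  "complex_differentiable_on (\<lambda>v. \<i> *s v) h S \<longleftrightarrow> (\<forall>z\<in>S. cdiff h z)"
  by (simp add: complex_differentiable_on_def cdiff_def)

lemma cdiff_const: "cdiff (\<lambda>z. c) z"
  unfolding cdiff_def by (intro exI[of _ "\<lambda>_. 0"]) simp

lemma cdiff_nth: "cdiff (\<lambda>z. z $ i) z"
  unfolding cdiff_def
  by (intro exI[of _ "\<lambda>v. v $ i"]) (simp add: bounded_linear_imp_has_derivative bounded_linear_vec_nth)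

lemma cdiff_add:
  assumes "cdiff f z" "cdiff h z" shows "cdiff (\<lambda>z. f z + h z) z"
proof -
  obtain D D' where D: "(f has_derivative D) (at z)" "\<forall>v. D (\<i> *s v) = \<i> * D v"
    "(h has_derivative D') (at z)" "\<forall>v. D' (\<i> *s v) = \<i> * D' v" using assms unfolding cdiff_def by blast
  have "((\<lambda>z. f z + h z) has_derivative (\<lambda>v. D v + D' v)) (at z)" by (rule has_derivative_add[OF D(1,3)])
  thus ?thesis unfolding cdiff_def using D(2,4)
    by (intro exI[of _ "\<lambda>v. D v + D' v"]) (simp add: algebra_simps)
qed

lemma cdiff_mult:
  assumes "cdiff f z" "cdiff h z" shows "cdiff (\<lambda>z. f z * h z) z"
proof -
  obtain D D' where D: "(f has_derivative D) (at z)" "\<forall>v. D (\<i> *s v) = \<i> * D v"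
    "(h has_derivative D') (at z)" "\<forall>v. D' (\<i> *s v) = \<i> * D' v" using assms unfolding cdiff_def by blast
  have "((\<lambda>z. f z * h z) has_derivative (\<lambda>v. f z * D' v + D v * h z)) (at z)" by (rule has_derivative_mult[OF D(1,3)])
  thus ?thesis unfolding cdiff_def using D(2,4)
    by (intro exI[of _ "\<lambda>v. f z * D' v + D v * h z"]) (simp add: algebra_simps)
qed

lemma cdiff_divide:
  assumes "cdiff f z" "cdiff h z" "h z \<noteq> 0" shows "cdiff (\<lambda>z. f z / h z) z"
proof -
  obtain D D' where D: "(f has_derivative D) (at z)" "\<forall>v. D (\<i> *s v) = \<i> * D v"
    "(h has_derivative D') (at z)" "\<forall>v. D' (\<i> *s v) = \<i> * D' v" using assms unfolding cdiff_def by blast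
  have "((\<lambda>z. f z / h z) has_derivative (\<lambda>v. (D v * h z - f z * D' v) / (h z * h z))) (at z)"
    by (rule has_derivative_divide'[OF D(1,3) assms(3)])
  thus ?thesis unfolding cdiff_def using D(2,4)
    by (intro exI[of _ "\<lambda>v. (D v * h z - f z * D' v) / (h z * h z)"]) (simp add: algebra_simps diff_divide_distrib)
qed

lemma cdiff_sum: "(\<And>a. a \<in> A \<Longrightarrow> cdiff (f a) z) \<Longrightarrow> cdiff (\<lambda>z. \<Sum>a\<in>A. f a z) z"
  by (induction A rule: infinite_finite_induct) (auto intro: cdiff_const cdiff_add)

lemma cdiff_prod: "(\<And>a. a \<in> A \<Longrightarrow> cdiff (f a) z) \<Longrightarrow> cdiff (\<lambda>z. \<Prod>a\<in>A. f a z) z"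
  by (induction A rule: infinite_finite_induct) (auto intro: cdiff_const cdiff_mult)

lemma cdiff_power: "cdiff f z \<Longrightarrow> cdiff (\<lambda>z. f z ^ n) z"
  by (induction n) (auto intro: cdiff_const cdiff_mult)

lemma cdiff_poly3_eval: "cdiff (poly3_eval P) z"
  unfolding poly3_eval_def[abs_def]
  by (intro cdiff_sum cdiff_mult cdiff_const cdiff_prod cdiff_power cdiff_nth)

lemma cdiff_transform:
  assumes "cdiff f z" "open T" "z \<in> T" "\<And>w. w \<in> T \<Longrightarrow> f w = h w"
  shows "cdiff h z"
proof -
  obtain D where D: "(f has_derivative D) (at z)" "\<forall>v. D (\<i> *s v) = \<i> * D v"
    using assms(1) unfolding cdiff_def by blast
  have "(h has_derivative D) (at z)"
    by (rule has_derivative_transform_within_open[OF D(1) assms(2,3)]) (rule assms(4))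
  thus ?thesis unfolding cdiff_def using D(2) by blast
qed

lemma complex_linear:
  fixes D :: "complex^3 \<Rightarrow> complex"
  assumes "linear D" "\<And>v. D (\<i> *s v) = \<i> * D v"
  shows "D (c *s v) = c * D v"
proof -
  have eq: "c * x = Re c *\<^sub>R x + Im c *\<^sub>R (\<i> * x)" for x by (simp add: complex_eq_iff)
  have "(c *s v) $ i = (Re c *\<^sub>R v + Im c *\<^sub>R (\<i> *s v)) $ i" for i
    using eq[of "v $ i"] by simp
  hence "c *s v = Re c *\<^sub>R v + Im c *\<^sub>R (\<i> *s v)" unfolding vec_eq_iff by blast
  hence "D (c *s v) = Re c *\<^sub>R D v + Im c *\<^sub>R (\<i> * D v)"
    using assms(2) by (simp add: linear_add[OF assms(1)] linear_scale[OF assms(1)])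
  also have "\<dots> = (of_real (Re c) + \<i> * of_real (Im c)) * D v" by (simp add: scaleR_conv_of_real algebra_simps)
  finally show ?thesis by (simp add: complex_eq[symmetric])
qed

lemma bounded_linear_smult: "bounded_linear (\<lambda>c. c *s (w::complex^3))"
  by (rule bounded_linear_intro[of _ "norm w"])
    (simp_all add: vec_eq_iff norm_smult algebra_simps)

lemma derivative_along_line:
  fixes f :: "complex^3 \<Rightarrow> complex"
  assumes D: "(f has_derivative D) (at (w + t *s v))" "\<And>v. D (\<i> *s v) = \<i> * D v"
  shows "((\<lambda>t. f (w + t *s v)) has_field_derivative D v) (at t)"
proof -
  have "((\<lambda>t. w + t *s v) has_derivative (\<lambda>h. h *s v)) (at t)"
  proof -
    have "((\<lambda>h. h *s v) has_derivative (\<lambda>h. h *s v)) (at t)"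
      by (rule bounded_linear_imp_has_derivative[OF bounded_linear_smult])
    from has_derivative_add[OF has_derivative_const this, of w] show ?thesis by simp
  qed
  from has_derivative_compose[OF this D(1)]
  have "((\<lambda>t. f (w + t *s v)) has_derivative (\<lambda>h. D (h *s v))) (at t)" .
  moreover have "D (h *s v) = D v * h" for h
    using complex_linear[OF has_derivative_linear[OF D(1)] D(2)] by (simp add: mult.commute)
  ultimately show ?thesis by (simp add: has_field_derivative_def)
qed

text \<open>Cauchy's inequality on discs in the direction \<open>v\<close> bounds differences of
  derivatives by differences of values, so the derivatives are uniformly Cauchy on a smaller ball
  and differentiation passes to the limit. Complex linearity of the derivative is a closed
  condition.\<close>

lemma cdiff_uniform_limit:
  fixes F :: "nat \<Rightarrow> complex^3 \<Rightarrow> complex"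
  assumes S: "open S" and F: "\<And>k z. z \<in> S \<Longrightarrow> cdiff (F k) z"
    and uc: "\<And>e. 0 < e \<Longrightarrow> \<exists>N. \<forall>k\<ge>N. \<forall>m\<ge>N. \<forall>x\<in>S. cmod (F k x - F m x) \<le> e"
    and lim: "\<And>x. x \<in> S \<Longrightarrow> (\<lambda>k. F k x) \<longlonglongrightarrow> L x" and z: "z \<in> S"
  shows "cdiff L z"
proof -
  obtain r where r: "r > 0" "ball z r \<subseteq> S" using S z unfolding open_contains_ball by blast
  define \<epsilon> where "\<epsilon> = r / 2"
  have \<epsilon>: "\<epsilon> > 0" "ball z (2 * \<epsilon>) \<subseteq> S" using r by (simp_all add: \<epsilon>_def)
  have zB: "z \<in> ball z \<epsilon>" using \<epsilon>(1) by simp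
  have BS: "ball z \<epsilon> \<subseteq> S" using \<epsilon> subset_ball[of \<epsilon> "2 * \<epsilon>" z] by auto
  have "\<forall>k. \<forall>w\<in>S. \<exists>D. (F k has_derivative D) (at w) \<and> (\<forall>v. D (\<i> *s v) = \<i> * D v)"
    using F unfolding cdiff_def by blast
  then obtain D where D: "\<And>k w. w \<in> S \<Longrightarrow> (F k has_derivative D k w) (at w)"
    "\<And>k w v. w \<in> S \<Longrightarrow> D k w (\<i> *s v) = \<i> * D k w v" by metis
  have est: "cmod (D k w v - D m w v) \<le> M / \<epsilon> * norm v"
    if w: "w \<in> ball z \<epsilon>" and M: "\<And>x. x \<in> S \<Longrightarrow> cmod (F k x - F m x) \<le> M" for k m w v M
  proof (cases "v = 0")
    case True
    have "linear (D j w)" for j using D(1) w BS by (meson has_derivative_linear subsetD)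
    thus ?thesis using True by (simp add: linear_0)
  next
    case False
    \<comment> \<open>A disc of this radius in the direction \<open>v\<close>, centred in the ball
      of radius \<open>\<epsilon>\<close>, stays in the ball of radius
      \<open>2 * \<epsilon>\<close>.\<close>
    define \<rho> where "\<rho> = \<epsilon> / norm v"
    have \<rho>: "\<rho> > 0" using \<epsilon>(1) False by (simp add: \<rho>_def)
    have inS: "w + t *s v \<in> S" if "cmod t \<le> \<rho>" for t
    proof -
      have "norm (t *s v) \<le> \<epsilon>" using that False by (simp add: norm_smult \<rho>_def field_simps)
      moreover have "dist z (w + t *s v) \<le> dist z w + norm (t *s v)"
        using dist_triangle[of z "w + t *s v" w] by (simp add: dist_norm)
      ultimately have "w + t *s v \<in> ball z (2 * \<epsilon>)" using w by simp
      thus ?thesis using \<epsilon>(2) by blast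
    qed
    let ?f = "\<lambda>t. F k (w + t *s v) - F m (w + t *s v)"
    have der: "(?f has_field_derivative D k (w + t *s v) v - D m (w + t *s v) v) (at t)" if "cmod t \<le> \<rho>" for t
      using inS[OF that] D by (intro DERIV_diff derivative_along_line) auto
    have "cmod ((deriv ^^ 1) ?f 0) \<le> fact 1 * M / \<rho> ^ 1"
    proof (rule Cauchy_inequality[OF _ _ \<rho>])
      have "?f field_differentiable (at t within ball 0 \<rho>)" if "t \<in> ball 0 \<rho>" for t
        unfolding field_differentiable_def
        by (rule exI, rule has_field_derivative_at_within[OF der]) (use that in simp)
      thus "?f holomorphic_on ball 0 \<rho>" unfolding holomorphic_on_def by (rule ballI)
      show "continuous_on (cball 0 \<rho>) ?f"
        using der by (intro continuous_at_imp_continuous_on ballI) (auto intro: DERIV_isCont)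
      show "cmod (?f t) \<le> M" if "cmod (0 - t) = \<rho>" for t using M[OF inS[of t]] that by simp
    qed
    moreover have "deriv ?f 0 = D k w v - D m w v" using DERIV_imp_deriv[OF der[of 0]] \<rho> by simp
    ultimately show ?thesis by (simp add: \<rho>_def field_simps)
  qed
  have Cau: "\<exists>N. \<forall>k\<ge>N. \<forall>m\<ge>N. \<forall>w\<in>ball z \<epsilon>. \<forall>v. cmod (D k w v - D m w v) \<le> e * norm v" if e: "0 < e" for e
  proof -
    obtain N where N: "\<And>k m x. k \<ge> N \<Longrightarrow> m \<ge> N \<Longrightarrow> x \<in> S \<Longrightarrow> cmod (F k x - F m x) \<le> e * \<epsilon>"
      using uc[of "e * \<epsilon>"] e \<epsilon>(1) by auto
    have "cmod (D k w v - D m w v) \<le> e * norm v" if "k \<ge> N" "m \<ge> N" "w \<in> ball z \<epsilon>" for k m w v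
      using est[OF that(3), of k m "e * \<epsilon>" v] N[OF that(1,2)] \<epsilon>(1) by simp
    thus ?thesis by blast
  qed
  have "\<exists>l. (\<lambda>k. D k w v) \<longlonglongrightarrow> l" if w: "w \<in> ball z \<epsilon>" for w v
  proof -
    have "Cauchy (\<lambda>k. D k w v)"
      unfolding Cauchy_iff
    proof (intro allI impI)
      fix e :: real assume e: "0 < e"
      have "norm v + 1 > 0" by (simp add: add_nonneg_pos)
      hence "0 < e / (norm v + 1)" using e by simp
      from Cau[OF this] obtain N where N: "\<And>k m. k \<ge> N \<Longrightarrow> m \<ge> N \<Longrightarrow> cmod (D k w v - D m w v) \<le> e / (norm v + 1) * norm v"
        using w by blast
      have "e / (norm v + 1) * norm v < e" using e \<open>norm v + 1 > 0\<close> by (simp add: field_simps)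
      thus "\<exists>M. \<forall>m\<ge>M. \<forall>n\<ge>M. cmod (D m w v - D n w v) < e" using N le_less_trans by blast
    qed
    thus ?thesis using Cauchy_convergent convergent_def by blast
  qed
  then obtain G where G: "\<And>w v. w \<in> ball z \<epsilon> \<Longrightarrow> (\<lambda>k. D k w v) \<longlonglongrightarrow> G w v" by metis
  have Dw: "(F n has_derivative D n x) (at x within ball z \<epsilon>)" if "x \<in> ball z \<epsilon>" for n x
    by (rule has_derivative_at_withinI, rule D(1), rule subsetD[OF BS that])
  have unif: "\<forall>\<^sub>F n in sequentially. \<forall>x\<in>ball z \<epsilon>. \<forall>h. cmod (D n x h - G x h) \<le> e * norm h"
    if e: "0 < e" for e
  proof -
    from Cau[OF e] obtain N where N: "\<forall>k\<ge>N. \<forall>m\<ge>N. \<forall>w\<in>ball z \<epsilon>. \<forall>v. cmod (D k w v - D m w v) \<le> e * norm v" ..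
    show ?thesis unfolding eventually_sequentially
    proof (intro exI[of _ N] allI impI ballI)
      fix k x h assume k: "N \<le> k" and x: "x \<in> ball z \<epsilon>"
      have "(\<lambda>m. cmod (D k x h - D m x h)) \<longlonglongrightarrow> cmod (D k x h - G x h)" by (intro tendsto_intros G[OF x])
      moreover have "\<forall>m\<ge>N. cmod (D k x h - D m x h) \<le> e * norm h" using N k x by blast
      ultimately show "cmod (D k x h - G x h) \<le> e * norm h" by (blast intro: LIMSEQ_le_const2)
    qed
  qed
  have "\<exists>g. \<forall>x\<in>ball z \<epsilon>. (\<lambda>n. F n x) \<longlonglongrightarrow> g x \<and> (g has_derivative G x) (at x within ball z \<epsilon>)"
    by (rule has_derivative_sequence[where f = F and f' = D and ?x0.0 = z and l = "L z",
          OF convex_ball Dw unif zB lim[OF z]])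
  then obtain g where g: "\<And>x. x \<in> ball z \<epsilon> \<Longrightarrow> (\<lambda>n. F n x) \<longlonglongrightarrow> g x"
    "\<And>x. x \<in> ball z \<epsilon> \<Longrightarrow> (g has_derivative G x) (at x within ball z \<epsilon>)" by blast
  have gd: "(g has_derivative G z) (at z)" using g(2)[OF zB] zB by (simp add: at_within_open[OF _ open_ball])
  have "G z (\<i> *s v) = \<i> * G z v" for v
  proof -
    have "(\<lambda>k. D k z (\<i> *s v)) \<longlonglongrightarrow> \<i> * G z v"
      using tendsto_mult_left[OF G[OF zB, of v], of \<i>] by (simp add: D(2)[OF z])
    thus ?thesis using G[OF zB] LIMSEQ_unique by blast
  qed
  hence "cdiff g z" unfolding cdiff_def using gd by blast
  thus ?thesis
  proof (rule cdiff_transform[OF _ open_ball zB])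
    fix w assume w: "w \<in> ball z \<epsilon>"
    show "g w = L w" using LIMSEQ_unique[OF g(1)[OF w] lim] w BS by blast
  qed
qed

text \<open>The Arzela-Ascoli argument: a diagonal subsequence converges on the countable dense set,
  equicontinuity spreads this to all of \<open>V\<close>, and a finite cover makes it uniform on
  compact sets. Density is asked of \<open>T \<inter> V\<close> in \<open>V\<close> because
  equicontinuity compares only points of \<open>V\<close>.\<close>

lemma equicontinuous_subsequence:
  fixes a :: "nat \<Rightarrow> 'a::metric_space \<Rightarrow> 'b::metric_space"
  assumes V: "open V" and cpt: "compact (UNIV :: 'b set)" and T: "countable T" "V \<subseteq> closure (T \<inter> V)"
    and eq: "\<And>x e. x \<in> V \<Longrightarrow> 0 < e \<Longrightarrow> \<exists>\<delta>>0. \<forall>k. \<forall>y\<in>V. dist x y < \<delta> \<longrightarrow> dist (a k x) (a k y) < e"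
  shows "\<exists>s g. strict_mono (s :: nat \<Rightarrow> nat) \<and> continuous_on V g \<and>
    (\<forall>K e. compact K \<longrightarrow> K \<subseteq> V \<longrightarrow> 0 < e \<longrightarrow> (\<forall>\<^sub>F k in sequentially. \<forall>x\<in>K. dist (a (s k) x) (g x) < e))"
proof -
  define P where "P n s \<longleftrightarrow> convergent (\<lambda>k::nat. a (s k) (from_nat_into T n))" for n and s :: "nat \<Rightarrow> nat"
  interpret subseqs P
  proof
    fix n and s :: "nat \<Rightarrow> nat"
    have "seq_compact (UNIV :: 'b set)" using cpt by (simp add: compact_eq_seq_compact_metric)
    then obtain l r where "strict_mono (r :: nat \<Rightarrow> nat)" "((\<lambda>k. a (s k) (from_nat_into T n)) \<circ> r) \<longlonglongrightarrow> l"
      unfolding seq_compact_def by (metis UNIV_I)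
    thus "\<exists>r'. strict_mono r' \<and> P n (s \<circ> r')" unfolding P_def convergent_def by (auto simp: o_def)
  qed
  define s where "s = diagseq"
  have s: "strict_mono s" unfolding s_def by (rule subseq_diagseq)
  have convT: "convergent (\<lambda>k. a (s k) t)" if t: "t \<in> T" for t
  proof -
    from from_nat_into_surj[OF T(1) t] obtain n where n: "from_nat_into T n = t" ..
    \<comment> \<open>Beyond its first \<open>Suc n\<close> entries the diagonal sequence is a
      subsequence of the \<open>n\<close>-th one.\<close>
    have "P n (s \<circ> (+) (Suc n))"
      unfolding s_def
    proof (rule diagseq_holds)
      fix r s' :: "nat \<Rightarrow> nat" and m assume "strict_mono r" "P m s'"
      thus "P m (s' \<circ> r)" unfolding P_def
        using convergent_subseq_convergent[of "\<lambda>k. a (s' k) (from_nat_into T m)" r] by (simp add: o_def)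
    qed
    hence "convergent (\<lambda>k. a (s (k + Suc n)) t)" by (simp add: P_def n o_def add.commute)
    thus ?thesis using convergent_ignore_initial_segment[of "\<lambda>k. a (s k) t" "Suc n"] by simp
  qed
  have "\<exists>l. (\<lambda>k. a (s k) x) \<longlonglongrightarrow> l" if x: "x \<in> V" for x
  proof -
    have "Cauchy (\<lambda>k. a (s k) x)"
      unfolding Cauchy_def
    proof (intro allI impI)
      fix e :: real assume e: "0 < e"
      obtain \<delta> where \<delta>: "\<delta> > 0" "\<And>k y. y \<in> V \<Longrightarrow> dist x y < \<delta> \<Longrightarrow> dist (a k x) (a k y) < e / 3"
        using eq[OF x, of "e / 3"] e by auto
      obtain t where t: "t \<in> T" "t \<in> V" "dist t x < \<delta>"
        using T(2) x \<delta>(1) unfolding closure_approachable subset_eq by blast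
      have "Cauchy (\<lambda>k. a (s k) t)" using convT[OF t(1)] by (rule convergent_Cauchy)
      then obtain N where N: "\<And>m n. m \<ge> N \<Longrightarrow> n \<ge> N \<Longrightarrow> dist (a (s m) t) (a (s n) t) < e / 3"
        using e unfolding Cauchy_def by (metis divide_pos_pos zero_less_numeral)
      have "dist (a (s m) x) (a (s n) x) < e" if "m \<ge> N" "n \<ge> N" for m n
      proof -
        have d: "dist (a (s m) x) (a (s m) t) < e / 3" "dist (a (s n) x) (a (s n) t) < e / 3"
          using \<delta>(2)[OF t(2)] t(3) by (simp_all add: dist_commute)
        have "dist (a (s m) x) (a (s n) x) \<le> dist (a (s m) x) (a (s m) t) + dist (a (s m) t) (a (s n) t) + dist (a (s n) t) (a (s n) x)"
          using dist_triangle[of "a (s m) x" "a (s n) x" "a (s m) t"] dist_triangle[of "a (s m) t" "a (s n) x" "a (s n) t"] by linarith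
        thus ?thesis using d N[OF that] by (simp add: dist_commute)
      qed
      thus "\<exists>M. \<forall>m\<ge>M. \<forall>n\<ge>M. dist (a (s m) x) (a (s n) x) < e" by blast
    qed
    thus ?thesis using compact_imp_complete[OF cpt] unfolding complete_def by blast
  qed
  then obtain g where g: "\<And>x. x \<in> V \<Longrightarrow> (\<lambda>k. a (s k) x) \<longlonglongrightarrow> g x" by metis
  have geq: "\<exists>\<delta>>0. \<forall>y\<in>V. dist x y < \<delta> \<longrightarrow> (\<forall>k. dist (a k x) (a k y) < e) \<and> dist (g x) (g y) \<le> e"
    if x: "x \<in> V" and e: "0 < e" for x e
  proof -
    obtain \<delta> where \<delta>: "\<delta> > 0" "\<And>k y. y \<in> V \<Longrightarrow> dist x y < \<delta> \<Longrightarrow> dist (a k x) (a k y) < e"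
      using eq[OF x e] by auto
    have "dist (g x) (g y) \<le> e" if y: "y \<in> V" "dist x y < \<delta>" for y
    proof -
      have "(\<lambda>k. dist (a (s k) x) (a (s k) y)) \<longlonglongrightarrow> dist (g x) (g y)" by (intro tendsto_intros g x y)
      thus ?thesis by (rule LIMSEQ_le_const2) (use \<delta>(2)[OF y] less_imp_le in blast)
    qed
    thus ?thesis using \<delta> by blast
  qed
  have "continuous_on V g"
    unfolding continuous_on_iff
  proof (intro ballI allI impI)
    fix x and e :: real assume x: "x \<in> V" and e: "0 < e"
    obtain \<delta> where "\<delta> > 0" "\<And>y. y \<in> V \<Longrightarrow> dist x y < \<delta> \<Longrightarrow> dist (g x) (g y) \<le> e / 2"
      using geq[OF x half_gt_zero[OF e]] by blast
    thus "\<exists>d>0. \<forall>x'\<in>V. dist x' x < d \<longrightarrow> dist (g x') (g x) < e"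
      using e by (intro exI[of _ \<delta>]) (force simp: dist_commute)
  qed
  moreover have "\<forall>\<^sub>F k in sequentially. \<forall>x\<in>K. dist (a (s k) x) (g x) < e"
    if K: "compact K" "K \<subseteq> V" and e: "0 < e" for K e
  proof -
    have e4: "0 < e / 4" using e by simp
    have "\<forall>x\<in>K. \<exists>\<delta>>0. \<forall>y\<in>V. dist x y < \<delta> \<longrightarrow> (\<forall>k. dist (a k x) (a k y) < e / 4) \<and> dist (g x) (g y) \<le> e / 4"
      using geq[OF _ e4] K(2) by blast
    then obtain \<delta> where \<delta>: "\<And>x. x \<in> K \<Longrightarrow> \<delta> x > 0" "\<And>x y k. x \<in> K \<Longrightarrow> y \<in> V \<Longrightarrow> dist x y < \<delta> x \<Longrightarrow>
        dist (a k x) (a k y) < e / 4 \<and> dist (g x) (g y) \<le> e / 4" by metis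
    have "K \<subseteq> (\<Union>x\<in>K. ball x (\<delta> x))" using \<delta>(1) by force
    then obtain C where C: "C \<subseteq> K" "finite C" "K \<subseteq> (\<Union>x\<in>C. ball x (\<delta> x))"
      using compactE_image[OF K(1), of K "\<lambda>x. ball x (\<delta> x)"] by auto
    have "\<forall>\<^sub>F k in sequentially. \<forall>c\<in>C. dist (a (s k) c) (g c) < e / 4"
      using C(1,2) K(2) g e4 by (intro eventually_ball_finite ballI tendstoD) auto
    thus ?thesis
    proof eventually_elim
      case (elim k)
      show ?case
      proof
        fix x assume x: "x \<in> K"
        then obtain c where c: "c \<in> C" "dist c x < \<delta> c" using C(3) by auto
        have cK: "c \<in> K" "x \<in> V" using c(1) C(1) x K(2) by auto
        have "dist (a (s k) x) (g x) \<le> dist (a (s k) x) (a (s k) c) + dist (a (s k) c) (g c) + dist (g c) (g x)"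
          using dist_triangle[of "a (s k) x" "g x" "a (s k) c"] dist_triangle[of "a (s k) c" "g x" "g c"] by linarith
        thus "dist (a (s k) x) (g x) < e"
          using \<delta>(2)[OF cK c(2), of "s k"] elim c(1) e by (auto simp: dist_commute)
      qed
    qed
  qed
  ultimately show ?thesis using s by blast
qed

section \<open>Holomorphic maps in affine charts and analyticity of their graphs\<close>

lemma has_derivative_vec3:
  fixes h :: "complex^3 \<Rightarrow> complex^3"
  assumes "\<And>j. ((\<lambda>u. h u $ j) has_derivative D j) (at z)"
  shows "(h has_derivative (\<lambda>v. \<chi> j. D j v)) (at z)"
proof -
  have "((\<lambda>u. \<Sum>j\<in>UNIV. h u $ j *s axis j 1) has_derivative (\<lambda>v. \<Sum>j\<in>UNIV. D j v *s axis j 1)) (at z)"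
    by (intro has_derivative_sum bounded_linear.has_derivative[OF bounded_linear_smult] assms)
  moreover have "(\<lambda>u. \<Sum>j\<in>UNIV. h u $ j *s axis j 1) = h" by (rule ext) (rule basis_expansion)
  moreover have "(\<lambda>v. \<Sum>j\<in>UNIV. D j v *s axis j 1) = (\<lambda>v. \<chi> j. D j v)"
    using basis_expansion[of "\<chi> j. D j _"] by (intro ext) (metis (no_types, lifting) sum.cong vec_lambda_beta)
  ultimately show ?thesis by simp
qed

text \<open>Holomorphy of \<open>g\<close> expressed by affine coordinates pulled back to the cone.
  Unlike the test against all local holomorphic functions, this form passes directly to uniform
  limits and supplies the equations of the graph.\<close>

definition local_affine_holo :: "cp2 set \<Rightarrow> (cp2 \<Rightarrow> cp2) \<Rightarrow> bool" where
  "local_affine_holo V g \<longleftrightarrow> (\<forall>z i. z \<noteq> 0 \<longrightarrow> proj z \<in> V \<longrightarrow> g (proj z) \<in> chart i \<longrightarrow>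
    (\<forall>j. cdiff (\<lambda>u. affine i (g (proj u)) $ j) z))"

lemma open_preimage_cone:
  assumes "open V" "continuous_on V g" "open W"
  shows "open {z. z \<noteq> 0 \<and> proj z \<in> V \<and> g (proj z) \<in> W}"
proof -
  have "open (V \<inter> g -` W)" using assms by (intro continuous_open_preimage) auto
  from open_cone[OF this] show ?thesis by (simp add: vimage_def Int_def)
qed

text \<open>In a chart, \<open>affine i (g (proj u))\<close> is a holomorphic lift of
  \<open>g\<close> to the cone, so the pullback of \<open>h \<circ> g\<close> is obtained by the
  chain rule from the pullback of \<open>h\<close>.\<close>

lemma local_affine_holo_imp_holomorphic:
  assumes V: "open V" and cont: "continuous_on V g" and loc: "local_affine_holo V g"
  shows "holomorphic_map_on V g"
  unfolding holomorphic_map_on_def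
proof (intro conjI allI impI V cont)
  fix W and h :: "cp2 \<Rightarrow> complex" assume W: "open W" and h: "holo h W"
  show "holo (h \<circ> g) (V \<inter> g -` W)"
    unfolding holo_def complex_differentiable_on_cdiff
  proof
    fix z assume "z \<in> {z. z \<noteq> 0 \<and> proj z \<in> V \<inter> g -` W}"
    hence z: "z \<noteq> 0" "proj z \<in> V" "g (proj z) \<in> W" by auto
    obtain i where i: "g (proj z) \<in> chart i" using in_some_chart by blast
    define \<rho> where "\<rho> u = affine i (g (proj u))" for u
    have "\<forall>j. \<exists>D. ((\<lambda>u. \<rho> u $ j) has_derivative D) (at z) \<and> (\<forall>v. D (\<i> *s v) = \<i> * D v)"
      using loc z(1,2) i unfolding local_affine_holo_def cdiff_def \<rho>_def by blast
    then obtain D where D: "\<And>j. ((\<lambda>u. \<rho> u $ j) has_derivative D j) (at z)" "\<And>j v. D j (\<i> *s v) = \<i> * D j v"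
      by metis
    have \<rho>': "(\<rho> has_derivative (\<lambda>v. \<chi> j. D j v)) (at z)" by (rule has_derivative_vec3[OF D(1)])
    have "\<rho> z \<noteq> 0" "proj (\<rho> z) = g (proj z)" unfolding \<rho>_def using i by (simp_all add: affine_nonzero proj_affine)
    hence "\<rho> z \<in> {z. z \<noteq> 0 \<and> proj z \<in> W}" using z(3) by simp
    hence "cdiff (\<lambda>z. h (proj z)) (\<rho> z)" using h unfolding holo_def complex_differentiable_on_cdiff by blast
    then obtain G where G: "((\<lambda>z. h (proj z)) has_derivative G) (at (\<rho> z))" "\<And>v. G (\<i> *s v) = \<i> * G v"
      unfolding cdiff_def by blast
    have "((\<lambda>u. h (proj (\<rho> u))) has_derivative (\<lambda>v. G (\<chi> j. D j v))) (at z)"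
      by (rule has_derivative_compose[OF \<rho>' G(1)])
    moreover have "G (\<chi> j. D j (\<i> *s v)) = \<i> * G (\<chi> j. D j v)" for v
    proof -
      have "(\<chi> j. D j (\<i> *s v)) = \<i> *s (\<chi> j. D j v)" by (simp add: vec_eq_iff D(2))
      thus ?thesis using G(2) by simp
    qed
    ultimately have "cdiff (\<lambda>u. h (proj (\<rho> u))) z" unfolding cdiff_def by blast
    thus "cdiff (\<lambda>z. (h \<circ> g) (proj z)) z"
    proof (rule cdiff_transform[OF _ open_preimage_cone[OF V cont open_chart[of i]]])
      show "z \<in> {z. z \<noteq> 0 \<and> proj z \<in> V \<and> g (proj z) \<in> chart i}" using z i by simp
    qed (simp add: \<rho>_def proj_affine)
  qed
qed

lemma holo2_affine_difference:
  assumes V: "open V" and cont: "continuous_on V g" and loc: "local_affine_holo V g"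
    and V1: "V1 \<subseteq> V" "g ` V1 \<subseteq> chart i"
  shows "holo2 (\<lambda>(x, y). affine i y $ j - affine i (g x) $ j) (V1 \<times> chart i)"
  unfolding holo2_def complex_differentiable_on_def
proof
  fix p :: "(complex^3) \<times> (complex^3)"
  assume "p \<in> {(z, w). z \<noteq> 0 \<and> w \<noteq> 0 \<and> (proj z, proj w) \<in> V1 \<times> chart i}"
  then obtain z w where p: "p = (z, w)" "z \<noteq> 0" "w \<noteq> 0" "proj z \<in> V1" "proj w \<in> chart i" by auto
  have zi: "proj z \<in> V" "g (proj z) \<in> chart i" using p V1 by auto
  obtain D1 where D1: "((\<lambda>u. affine i (g (proj u)) $ j) has_derivative D1) (at z)" "\<And>v. D1 (\<i> *s v) = \<i> * D1 v"
    using loc p(2) zi unfolding local_affine_holo_def cdiff_def by blast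
  have wi: "w $ i \<noteq> 0" using p(3,5) chart_proj by blast
  have "cdiff (\<lambda>w. w $ j / w $ i) w" by (intro cdiff_divide cdiff_nth wi)
  hence "cdiff (\<lambda>w. affine i (proj w) $ j) w"
    by (rule cdiff_transform[OF _ open_Compl[OF closed_singleton[of 0]]]) (use p(3) in \<open>auto simp: affine_proj\<close>)
  then obtain D2 where D2: "((\<lambda>w. affine i (proj w) $ j) has_derivative D2) (at w)" "\<And>v. D2 (\<i> *s v) = \<i> * D2 v"
    unfolding cdiff_def by blast
  have f1: "((\<lambda>q. affine i (g (proj (fst q))) $ j) has_derivative (\<lambda>v. D1 (fst v))) (at p)"
    by (rule has_derivative_compose[OF bounded_linear_imp_has_derivative[OF bounded_linear_fst]]) (use D1(1) p(1) in simp)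
  have f2: "((\<lambda>q. affine i (proj (snd q)) $ j) has_derivative (\<lambda>v. D2 (snd v))) (at p)"
    by (rule has_derivative_compose[OF bounded_linear_imp_has_derivative[OF bounded_linear_snd]]) (use D2(1) p(1) in simp)
  have "((\<lambda>q. affine i (proj (snd q)) $ j - affine i (g (proj (fst q))) $ j) has_derivative (\<lambda>v. D2 (snd v) - D1 (fst v))) (at p)"
    by (rule has_derivative_diff[OF f2 f1])
  hence "((\<lambda>(z, w). (\<lambda>(x, y). affine i y $ j - affine i (g x) $ j) (proj z, proj w)) has_derivative
      (\<lambda>v. D2 (snd v) - D1 (fst v))) (at p)" by (simp add: case_prod_unfold)
  moreover have "(\<lambda>v. D2 (snd v) - D1 (fst v)) ((\<lambda>(v, w). (\<i> *s v, \<i> *s w)) v) = \<i> * (D2 (snd v) - D1 (fst v))" for v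
    by (simp add: case_prod_beta D1(2) D2(2) right_diff_distrib)
  ultimately show "\<exists>D. ((\<lambda>(z, w). (\<lambda>(x, y). affine i y $ j - affine i (g x) $ j) (proj z, proj w)) has_derivative D) (at p) \<and>
      (\<forall>v. D ((\<lambda>(v, w). (\<i> *s v, \<i> *s w)) v) = \<i> * D v)" by blast
qed

lemma graph_on_total:
  assumes "open V" "continuous_on V g" "\<And>x. x \<in> V \<Longrightarrow> l x = Some (g x)"
  shows "graph_on V l = {(x, g x) | x. x \<in> V}"
proof
  have c: "continuous_on V (\<lambda>x. the (l x))" by (rule continuous_on_eq[OF assms(2)]) (simp add: assms(3))
  show "graph_on V l \<subseteq> {(x, g x) | x. x \<in> V}"
  proof
    fix p assume p: "p \<in> graph_on V l"
    obtain x y where xy: "p = (x, y)" by (cases p)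
    have "x \<in> V" using p xy by (simp add: graph_on_def)
    moreover have "y = the (l x)"
      using graph_on_continuous_unique[OF _ c assms(1) \<open>x \<in> V\<close>, of y V] p xy by (simp add: graph_on_def)
    ultimately show "p \<in> {(x, g x) | x. x \<in> V}" using assms(3) xy by auto
  qed
  show "{(x, g x) | x. x \<in> V} \<subseteq> graph_on V l"
    using closure_subset[of "{(x, y). x \<in> V \<and> l x = Some y}"] assms(3) unfolding graph_on_def by auto
qed

lemma codim_ge_empty: "codim_ge c {}"
  by (simp add: codim_ge_def)

lemma analytic_subset_empty: "open X \<Longrightarrow> analytic_subset holo X {}"
  unfolding analytic_subset_def
  by (intro conjI ballI exI[of _ X] exI[of _ "{\<lambda>_. 1}"])
    (auto simp: holo_def complex_differentiable_on_cdiff cdiff_const)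

text \<open>Near the graph the equations are the differences of the affine coordinates of
  \<open>y\<close> and \<open>g x\<close>; off the graph, which is closed over \<open>V\<close>, the
  constant \<open>1\<close> cuts out the empty set. The indeterminacy set is empty, so the
  conditions on it are trivial.\<close>

lemma meromorphic_map_on_total:
  assumes V: "open V" and cont: "continuous_on V g" and loc: "local_affine_holo V g"
  shows "meromorphic_map_on V (\<lambda>x. if x \<in> V then Some (g x) else None)"
proof -
  let ?l = "\<lambda>x. if x \<in> V then Some (g x) else None"
  have dom: "dom ?l = V" by (auto simp: dom_def)
  have gr: "graph_on V ?l = {(x, g x) | x. x \<in> V}" by (rule graph_on_total[OF V cont]) simp
  have hm: "holomorphic_map_on V (\<lambda>x. the (?l x))"
  proof -
    have hg: "holomorphic_map_on V g" by (rule local_affine_holo_imp_holomorphic[OF assms])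
    have c: "continuous_on V (\<lambda>x. the (?l x))" by (rule continuous_on_eq[OF cont]) simp
    have "local_affine_holo V (\<lambda>x. the (?l x))"
      unfolding local_affine_holo_def
    proof (intro allI impI)
      fix z i j assume z: "z \<noteq> 0" "proj z \<in> V" "the (?l (proj z)) \<in> chart i"
      have "cdiff (\<lambda>u. affine i (g (proj u)) $ j) z" using loc z unfolding local_affine_holo_def by simp
      thus "cdiff (\<lambda>u. affine i (the (?l (proj u))) $ j) z"
        by (rule cdiff_transform[OF _ open_cone[OF V]]) (use z in auto)
    qed
    from local_affine_holo_imp_holomorphic[OF V c this] show ?thesis .
  qed
  have an: "analytic_subset holo2 (V \<times> UNIV) (graph_on V ?l)"
    unfolding analytic_subset_def gr
  proof (intro conjI ballI)
    show "{(x, g x) | x. x \<in> V} \<subseteq> V \<times> UNIV" by auto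
    fix p :: "cp2 \<times> cp2" assume "p \<in> V \<times> UNIV"
    then obtain x y where p: "p = (x, y)" "x \<in> V" by auto
    show "\<exists>N H. open N \<and> p \<in> N \<and> N \<subseteq> V \<times> UNIV \<and> finite H \<and> (\<forall>h\<in>H. holo2 h N) \<and>
        {(x, g x) | x. x \<in> V} \<inter> N = {y \<in> N. \<forall>h\<in>H. h y = 0}"
    proof (cases "y = g x")
      case True
      obtain i where i: "g x \<in> chart i" using in_some_chart by blast
      define V1 where "V1 = V \<inter> g -` chart i"
      have V1: "open V1" "V1 \<subseteq> V" "g ` V1 \<subseteq> chart i"
        unfolding V1_def by (auto intro: continuous_open_preimage[OF cont V open_chart])
      let ?h = "\<lambda>j (x, y). affine i y $ j - affine i (g x) $ j"
      show ?thesis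
      proof (intro exI[of _ "V1 \<times> chart i"] exI[of _ "range ?h"] conjI)
        show "open (V1 \<times> chart i)" by (intro open_Times V1 open_chart)
        show "p \<in> V1 \<times> chart i" using p True i by (simp add: V1_def)
        show "\<forall>h\<in>range ?h. holo2 h (V1 \<times> chart i)"
          using holo2_affine_difference[OF assms V1(2,3)] by blast
        show "{(x, g x) | x. x \<in> V} \<inter> (V1 \<times> chart i) = {y \<in> V1 \<times> chart i. \<forall>h\<in>range ?h. h y = 0}"
        proof (intro equalityI subsetI)
          fix q assume q: "q \<in> {y \<in> V1 \<times> chart i. \<forall>h\<in>range ?h. h y = 0}"
          obtain a b where ab: "q = (a, b)" by (cases q)
          have "affine i b $ j = affine i (g a) $ j" for j using q ab by auto
          hence "affine i b = affine i (g a)" by (simp add: vec_eq_iff)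
          moreover have "b \<in> chart i" "g a \<in> chart i" "a \<in> V" using q ab V1(2,3) by auto
          ultimately have "b = g a" using proj_affine by metis
          thus "q \<in> {(x, g x) | x. x \<in> V} \<inter> (V1 \<times> chart i)" using q ab \<open>a \<in> V\<close> by auto
        qed auto
      qed (use V1 in auto)
    next
      case False
      define N where "N = (V \<times> UNIV) \<inter> (\<lambda>q. dist (snd q) (g (fst q))) -` {0<..}"
      have "continuous_on (V \<times> UNIV) (\<lambda>q. g (fst q))"
        by (rule continuous_on_compose2[OF cont]) (auto intro!: continuous_intros)
      hence "continuous_on (V \<times> (UNIV :: cp2 set)) (\<lambda>q. dist (snd q) (g (fst q)))"
        by (intro continuous_intros)
      hence "open N" unfolding N_def by (intro continuous_open_preimage open_Times V open_UNIV open_greaterThan)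
      moreover have "holo2 (\<lambda>_. 1) N" unfolding holo2_def complex_differentiable_on_def
        by (intro ballI exI[of _ "\<lambda>_. 0"]) (simp add: case_prod_unfold)
      ultimately show ?thesis using p False
        by (intro exI[of _ N] exI[of _ "{\<lambda>_. 1}"]) (auto simp: N_def)
    qed
  qed
  show ?thesis
    unfolding meromorphic_map_on_def dom
    using V hm an analytic_subset_empty[OF V] codim_ge_empty by simp
qed

lemma hausdorff_dist_graphs_le:
  assumes "\<And>x. x \<in> K \<Longrightarrow> dist (a x) (g x) < e" "0 < e" "K \<subseteq> V"
  shows "hausdorff_dist ({(x, a x) | x. x \<in> V} \<inter> K \<times> UNIV) ({(x, g x) | x. x \<in> V} \<inter> K \<times> UNIV) \<le> ennreal e"
  unfolding hausdorff_dist_def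
proof (rule Inf_lower, intro CollectI exI[of _ e] conjI refl assms(2))
  have d: "dist (x, a x) (x, g x) < e" "dist (x, g x) (x, a x) < e" if "x \<in> K" for x
    using assms(1)[OF that] by (simp_all add: dist_Pair_Pair dist_commute)
  show "{(x, a x) | x. x \<in> V} \<inter> K \<times> UNIV \<subseteq> (\<Union>b\<in>{(x, g x) | x. x \<in> V} \<inter> K \<times> UNIV. ball b e)"
    using d by fastforce
  show "{(x, g x) | x. x \<in> V} \<inter> K \<times> UNIV \<subseteq> (\<Union>b\<in>{(x, a x) | x. x \<in> V} \<inter> K \<times> UNIV. ball b e)"
    using d by fastforce
qed

lemma countable_dense_cp2:
  obtains T :: "cp2 set" where "countable T" "\<And>V. open V \<Longrightarrow> V \<subseteq> closure (T \<inter> V)"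
proof -
  obtain B :: "(complex^3) set" where B: "countable B" "\<And>X. open X \<Longrightarrow> X \<noteq> {} \<Longrightarrow> \<exists>d\<in>B. d \<in> X"
    by (rule countable_dense_setE) blast
  show ?thesis
  proof (rule that[of "proj ` B"])
    show "countable (proj ` B)" using B(1) by simp
    fix V :: "cp2 set" assume V: "open V"
    show "V \<subseteq> closure (proj ` B \<inter> V)"
    proof
      fix x assume x: "x \<in> V"
      show "x \<in> closure (proj ` B \<inter> V)"
        unfolding closure_approachable
      proof (intro allI impI)
        fix e :: real assume e: "0 < e"
        let ?X = "{z. z \<noteq> 0 \<and> proj z \<in> V \<inter> ball x e}"
        have "open ?X" using V by (intro open_cone) auto
        moreover have "rep_cp2 x \<in> ?X" using x e rep_cp2_nonzero by (simp add: proj_rep_cp2)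
        ultimately obtain b where "b \<in> B" "b \<in> ?X" using B(2) by blast
        thus "\<exists>y\<in>proj ` B \<inter> V. dist y x < e" by (auto simp: dist_commute)
      qed
    qed
  qed
qed

context stable_rational_map
begin

text \<open>Equicontinuity gives locally uniform convergence of a subsequence to a continuous map.
  In a chart the iterates are quotients of polynomials, so the limit is holomorphic, hence
  meromorphic without indeterminacy. Over a compact set the graphs of maps at distance below
  \<open>e\<close> are within Hausdorff distance \<open>e\<close>.\<close>

lemma fatou_subset_strong_fatou: "fatou_set f \<subseteq> strong_fatou_set f"
proof
  fix p assume "p \<in> fatou_set f"
  then obtain U where U: "open U" "U \<subseteq> - closure (\<Union>n\<in>{1..}. indet (iterate f n))"
    "locally_equicontinuous_on U (\<lambda>n x. the (iterate f (Suc n) x))" "p \<in> U"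
    unfolding fatou_set_def by blast
  from U(3)[unfolded locally_equicontinuous_on_def, THEN bspec, OF U(4)]
  obtain V where V: "open V" "p \<in> V" "V \<subseteq> U" and eq0: "\<forall>x\<in>V. \<forall>e>0. \<exists>\<delta>>0. \<forall>n. \<forall>y\<in>V.
      dist x y < \<delta> \<longrightarrow> dist (the (iterate f (Suc n) x)) (the (iterate f (Suc n) y)) < e"
    by (elim exE conjE) (rule that)
  note eq = eq0[THEN bspec, THEN spec, THEN mp]
  define a where "a n x = the (iterate f (Suc n) x)" for n x
  have Enz: "E (Suc n) z \<noteq> 0" if "z \<noteq> 0" "proj z \<in> V" for n z
  proof -
    have "proj z \<notin> indet (iterate f (Suc n))"
      using that(2) V(3) U(2) closure_subset[of "\<Union>n\<in>{1..}. indet (iterate f n)"] by fastforce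
    thus ?thesis using indet_proj[OF _ that(1), of "Suc n"] by simp
  qed
  have it: "iterate f (Suc n) (proj z) = Some (proj (E (Suc n) z))" "a n (proj z) = proj (E (Suc n) z)"
    if "z \<noteq> 0" "proj z \<in> V" for n z
    using iterate_proj[OF _ that(1), of "Suc n"] Enz[OF that] by (simp_all add: a_def)
  have ita: "iterate f (Suc n) x = Some (a n x)" if "x \<in> V" for n x
    using it[of "rep_cp2 x"] that rep_cp2_nonzero by (simp add: proj_rep_cp2)
  have ca: "continuous_on V (a n)" for n
    unfolding continuous_on_iff
  proof (intro ballI allI impI)
    fix x and e :: real assume x: "x \<in> V" "0 < e"
    from eq[OF this] show "\<exists>d>0. \<forall>x'\<in>V. dist x' x < d \<longrightarrow> dist (a n x') (a n x) < e"
      unfolding a_def by (metis dist_commute)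
  qed
  have "strongly_normal_on V (\<lambda>n. iterate f (Suc n))"
    unfolding strongly_normal_on_def
  proof (intro allI impI)
    fix r :: "nat \<Rightarrow> nat" assume r: "strict_mono r"
    obtain T :: "cp2 set" where T: "countable T" "V \<subseteq> closure (T \<inter> V)" using countable_dense_cp2 V(1) by metis
    have "\<exists>\<delta>>0. \<forall>k. \<forall>y\<in>V. dist x y < \<delta> \<longrightarrow> dist (a (r k) x) (a (r k) y) < e" if "x \<in> V" "0 < e" for x e
      using eq[OF that] unfolding a_def by blast
    from equicontinuous_subsequence[OF V(1) compact_UNIV_cp2 T this]
    obtain s g where s: "strict_mono (s :: nat \<Rightarrow> nat)" and g: "continuous_on V g"
      and lim: "\<And>K e. compact K \<Longrightarrow> K \<subseteq> V \<Longrightarrow> 0 < e \<Longrightarrow> \<forall>\<^sub>F k in sequentially. \<forall>x\<in>K. dist (a (r (s k)) x) (g x) < e"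
      by blast
    have loc: "local_affine_holo V g"
      unfolding local_affine_holo_def
    proof (intro allI impI)
      fix z i j assume z: "z \<noteq> 0" "proj z \<in> V" "g (proj z) \<in> chart i"
      have "open {z. z \<noteq> 0 \<and> proj z \<in> V \<and> g (proj z) \<in> chart i}" by (rule open_preimage_cone[OF V(1) g open_chart])
      then obtain \<epsilon> where \<epsilon>: "\<epsilon> > 0" "cball z \<epsilon> \<subseteq> {z. z \<noteq> 0 \<and> proj z \<in> V \<and> g (proj z) \<in> chart i}"
        using z unfolding open_contains_cball by blast
      have cb: "u \<noteq> 0" "proj u \<in> V" "g (proj u) \<in> chart i" if "u \<in> cball z \<epsilon>" for u
        using subsetD[OF \<epsilon>(2) that] by simp_all
      let ?K = "proj ` cball z \<epsilon>"
      have K: "compact ?K"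
        by (intro compact_continuous_image continuous_on_subset[OF continuous_on_proj] compact_cball) (use \<epsilon>(2) in blast)
      have KV: "?K \<subseteq> V" "g ` ?K \<subseteq> chart i" using cb by auto
      have gK: "compact (g ` ?K)" by (rule compact_continuous_image[OF continuous_on_subset[OF g KV(1)] K])
      define n where "n k = Suc (r (s k))" for k
      have conv: "\<exists>N. \<forall>k\<ge>N. \<forall>u\<in>cball z \<epsilon>. E (n k) u $ i \<noteq> 0 \<and>
          cmod (E (n k) u $ j / E (n k) u $ i - affine i (g (proj u)) $ j) < e" if e: "0 < e" for e
      proof -
        obtain \<delta> where \<delta>: "\<delta> > 0" "\<And>x y. x \<in> g ` ?K \<Longrightarrow> dist x y < \<delta> \<Longrightarrow> y \<in> chart i \<and> dist (affine i x) (affine i y) < e"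
          using compact_uniform_nbhd[OF gK KV(2) open_chart continuous_on_affine e] by blast
        obtain N where N: "\<And>k x. k \<ge> N \<Longrightarrow> x \<in> ?K \<Longrightarrow> dist (a (r (s k)) x) (g x) < \<delta>"
          using lim[OF K KV(1) \<delta>(1)] unfolding eventually_sequentially by blast
        show ?thesis
        proof (intro exI[of _ N] allI impI ballI)
          fix k u assume k: "N \<le> k" and u: "u \<in> cball z \<epsilon>"
          have nz: "E (n k) u \<noteq> 0" unfolding n_def by (rule Enz[OF cb(1,2)[OF u]])
          have "dist (g (proj u)) (proj (E (n k) u)) < \<delta>"
            using N[OF k imageI[OF u, of proj]] it(2)[OF cb(1,2)[OF u]] by (simp add: n_def dist_commute)
          from \<delta>(2)[OF imageI[OF imageI[OF u]] this]
          have c: "proj (E (n k) u) \<in> chart i" "dist (affine i (g (proj u))) (affine i (proj (E (n k) u))) < e" by auto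
          have "dist (affine i (g (proj u)) $ j) (affine i (proj (E (n k) u)) $ j) < e"
            using order_le_less_trans[OF dist_vec_nth_le c(2)] .
          thus "E (n k) u $ i \<noteq> 0 \<and> cmod (E (n k) u $ j / E (n k) u $ i - affine i (g (proj u)) $ j) < e"
            using c(1) nz by (simp add: chart_proj affine_proj dist_norm norm_minus_commute)
        qed
      qed
      obtain N0 where N0: "\<And>k u. k \<ge> N0 \<Longrightarrow> u \<in> cball z \<epsilon> \<Longrightarrow> E (n k) u $ i \<noteq> 0" using conv[OF zero_less_one] by blast
      \<comment> \<open>The shift by \<open>N0\<close> makes every quotient of the sequence defined,
        as \<open>cdiff_uniform_limit\<close> asks for differentiability at all indices.\<close>
      define G where "G k u = E (n (k + N0)) u $ j / E (n (k + N0)) u $ i" for k u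
      show "cdiff (\<lambda>u. affine i (g (proj u)) $ j) z"
      proof (rule cdiff_uniform_limit[of "ball z \<epsilon>" G])
        show "cdiff (G k) u" if u: "u \<in> ball z \<epsilon>" for k u
        proof -
          obtain W where W: "self_map W = E (n (k + N0))" using E_poly by blast
          have "cdiff (\<lambda>u. E (n (k + N0)) u $ l) u" for l
            unfolding W[symmetric] self_map_def using cdiff_poly3_eval by simp
          moreover have "u \<in> cball z \<epsilon>" using u by simp
          hence "E (n (k + N0)) u $ i \<noteq> 0" using N0[of "k + N0"] by simp
          ultimately show ?thesis unfolding G_def[abs_def] by (intro cdiff_divide)
        qed
        show "(\<lambda>k. G k u) \<longlonglongrightarrow> affine i (g (proj u)) $ j" if u: "u \<in> ball z \<epsilon>" for u
        proof (rule metric_LIMSEQ_I)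
          fix e :: real assume "0 < e"
          from conv[OF this] obtain N where N: "\<And>k u. k \<ge> N \<Longrightarrow> u \<in> cball z \<epsilon> \<Longrightarrow>
            cmod (E (n k) u $ j / E (n k) u $ i - affine i (g (proj u)) $ j) < e" by blast
          have "u \<in> cball z \<epsilon>" using u by simp
          thus "\<exists>no. \<forall>k\<ge>no. dist (G k u) (affine i (g (proj u)) $ j) < e"
            using N[of "_ + N0" u] by (intro exI[of _ N]) (simp add: G_def dist_norm)
        qed
        fix e :: real assume e: "0 < e"
        from conv[OF half_gt_zero[OF e]] obtain N where N: "\<And>k u. k \<ge> N \<Longrightarrow> u \<in> cball z \<epsilon> \<Longrightarrow>
            cmod (E (n k) u $ j / E (n k) u $ i - affine i (g (proj u)) $ j) < e / 2" by blast
        have Nb: "cmod (G k u - affine i (g (proj u)) $ j) < e / 2" if "k \<ge> N" "u \<in> ball z \<epsilon>" for k u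
          using N[of "k + N0" u] that by (simp add: G_def)
        have "cmod (G k u - G m u) \<le> e" if "k \<ge> N" "m \<ge> N" "u \<in> ball z \<epsilon>" for k m u
          using norm_triangle_ineq4[of "G k u - affine i (g (proj u)) $ j" "G m u - affine i (g (proj u)) $ j"]
            Nb[OF that(1,3)] Nb[OF that(2,3)] by simp
        thus "\<exists>N. \<forall>k\<ge>N. \<forall>m\<ge>N. \<forall>u\<in>ball z \<epsilon>. cmod (G k u - G m u) \<le> e" by blast
      qed (use \<epsilon>(1) in auto)
    qed
    let ?l = "\<lambda>x. if x \<in> V then Some (g x) else None"
    have "strongly_converges_on V ((\<lambda>n. iterate f (Suc n)) \<circ> r \<circ> s) ?l"
      unfolding strongly_converges_on_def
    proof (intro allI impI, elim conjE)
      fix K assume K: "compact K" "K \<subseteq> V"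
      have grl: "graph_on V ?l = {(x, g x) | x. x \<in> V}" by (rule graph_on_total[OF V(1) g]) simp
      have gra: "graph_on V (((\<lambda>n. iterate f (Suc n)) \<circ> r \<circ> s) k) = {(x, a (r (s k)) x) | x. x \<in> V}" for k
        by (rule graph_on_total[OF V(1) ca]) (simp add: ita)
      show "(\<lambda>k. hausdorff_dist (graph_on V (((\<lambda>n. iterate f (Suc n)) \<circ> r \<circ> s) k) \<inter> K \<times> UNIV)
          (graph_on V ?l \<inter> K \<times> UNIV)) \<longlonglongrightarrow> 0"
        unfolding grl gra
      proof (rule order_tendstoI)
        fix c :: ennreal assume "0 < c"
        then obtain b where b: "0 < b" "b < c" using dense by blast
        hence "b \<noteq> top" using top.extremum_strict by blast
        then obtain e where e: "b = ennreal e" "0 \<le> e" by (cases b) auto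
        have e0: "0 < e" using b(1) e by (simp add: ennreal_less_zero_iff)
        from lim[OF K e0]
        show "\<forall>\<^sub>F k in sequentially. hausdorff_dist ({(x, a (r (s k)) x) | x. x \<in> V} \<inter> K \<times> UNIV)
            ({(x, g x) | x. x \<in> V} \<inter> K \<times> UNIV) < c"
        proof eventually_elim
          case (elim k)
          have "hausdorff_dist ({(x, a (r (s k)) x) | x. x \<in> V} \<inter> K \<times> UNIV) ({(x, g x) | x. x \<in> V} \<inter> K \<times> UNIV) \<le> ennreal e"
            by (rule hausdorff_dist_graphs_le[OF _ e0 K(2)]) (use elim in blast)
          thus ?case using b(2) e(1) by simp
        qed
      qed simp
    qed
    thus "\<exists>s l. strict_mono (s :: nat \<Rightarrow> nat) \<and> meromorphic_map_on V l \<and>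
        strongly_converges_on V ((\<lambda>n. iterate f (Suc n)) \<circ> r \<circ> s) l"
      using s meromorphic_map_on_total[OF V(1) g loc] by blast
  qed
  thus "p \<in> strong_fatou_set f" unfolding strong_fatou_set_def using V by blast
qed

end

lemma strongly_normal_imp_weakly_normal:
  assumes "open U" "strongly_normal_on U g"
  shows "weakly_normal_on U g"
  unfolding weakly_normal_on_def
proof (intro allI impI)
  fix r :: "nat \<Rightarrow> nat" assume "strict_mono r"
  then obtain s l where s: "strict_mono (s :: nat \<Rightarrow> nat)" "meromorphic_map_on U l" "strongly_converges_on U (g \<circ> r \<circ> s) l"
    using assms(2) unfolding strongly_normal_on_def by blast
  have "weakly_converges_on U (g \<circ> r \<circ> s) l"
    unfolding weakly_converges_on_def
    by (intro exI[of _ "{}"] conjI analytic_subset_empty[OF assms(1)] codim_ge_empty) (use s(3) in simp)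
  thus "\<exists>s l. strict_mono (s :: nat \<Rightarrow> nat) \<and> meromorphic_map_on U l \<and> weakly_converges_on U (g \<circ> r \<circ> s) l"
    using s by blast
qed

lemma strong_fatou_subset_weak_fatou: "strong_fatou_set f \<subseteq> weak_fatou_set f"
  unfolding strong_fatou_set_def weak_fatou_set_def using strongly_normal_imp_weakly_normal by blast

theorem theorem3p17:
  fixes f :: "cp2 \<rightharpoonup> cp2"
  assumes "rational_map f" and "dominant f" and "algebraically_stable f" and "2 \<le> rat_degree f"
  shows "fatou_set f = strong_fatou_set f \<and> strong_fatou_set f = weak_fatou_set f"
proof -
  interpret stable_rational_map f "lift_of f" "rat_degree f" by (rule stable_rational_mapI[OF assms])
  show ?thesis
    using fatou_subset_strong_fatou strong_fatou_subset_weak_fatou[of f] weak_fatou_subset_fatou by blast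
qed

end
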